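(* Let $\alpha,\beta\in\overline{\Delta}$ with $\alpha\neq\beta$, and let $n\in\mathbb{N}\cup\{0\}$. Let $f$ be a continuous complex-valued function on $\overline{\Delta}$. Assume that for every circle $\Gamma\in\mathcal{C}_\alpha\cup\mathcal{C}_\beta$ the function $z\mapsto (z-c(\Gamma))^n f(z)$ extends holomorphically from $\Gamma$. Then $f$ is polyanalytic of order $\leq n$ on $\Delta$, and consequently for every circle $\Gamma\subset\overline{\Delta}$ the function $z\mapsto (z-c(\Gamma))^n f(z)$ extends holomorphically from $\Gamma$.
   Context: $\Delta$ is the open unit disc in $\mathbb{C}$, $\overline{\Delta}$ its closure, $b\Delta$ its boundary. For a circle $\Gamma$, $c(\Gamma)$ denotes its (Euclidean) center. For $\alpha\in\Delta$, $\mathcal{C}_\alpha$ is the family of all circles $\left\{\frac{\alpha-R\zeta}{1-\overline{\alpha}R\zeta}:\ \zeta\in b\Delta\right\}$, $0<R<1$ (the circles in $\Delta$ with hyperbolic center $\alpha$). For $\alpha\in b\Delta$, $\mathcal{C}_\alpha$ is the family of all circles contained in $\overline{\Delta}$ which pass through $\alpha$. A continuous function on a circle $\Gamma$ extends holomorphically from $\Gamma$ if it extends to a continuous function on the closed disc bounded by $\Gamma$ that is holomorphic on the open disc bounded by $\Gamma$. A function $f$ is polyanalytic of order $\leq n$ on $\Delta$ if $f(z)=a_0(z)+a_1(z)\overline{z}+\cdots+a_n(z)\overline{z}^n$ $(z\in\Delta)$ where $a_0,\dots,a_n$ are holomorphic functions on $\Delta$. *)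

theory Defs
  imports "HOL-Complex_Analysis.Complex_Analysis"
begin

definition is_circle :: "complex set \<Rightarrow> bool" where
  "is_circle \<Gamma> \<longleftrightarrow> (\<exists>c r. r > 0 \<and> \<Gamma> = sphere c r)"

text \<open>The description picks out a unique point only for circles (of positive radius);
  see \<open>circle_center_sphere\<close>.\<close>

definition circle_center :: "complex set \<Rightarrow> complex" where
  "circle_center \<Gamma> = (THE c. \<exists>r>0. \<Gamma> = sphere c r)"

lemma sphere_eq_imp_center_eq:
  fixes c d :: complex
  assumes "r > 0" "s > 0" "sphere c r = sphere d s"
  shows "c = d"
proof (rule ccontr)
  assume "c \<noteq> d"
  define D where "D = norm (c - d)"
  define u where "u = sgn (c - d)"
  have D: "D > 0" and u: "norm u = 1" and cd: "c = d + D *\<^sub>R u"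
    using \<open>c \<noteq> d\<close> by (auto simp: D_def u_def norm_sgn sgn_div_norm)
  have "c + r *\<^sub>R u \<in> sphere d s" "c - r *\<^sub>R u \<in> sphere d s"
    unfolding assms(3)[symmetric] using assms(1) u by (auto simp: dist_norm)
  moreover have "c + r *\<^sub>R u = d + (D + r) *\<^sub>R u" "c - r *\<^sub>R u = d + (D - r) *\<^sub>R u"
    by (simp_all add: cd algebra_simps)
  ultimately have "\<bar>D + r\<bar> = s" "\<bar>D - r\<bar> = s"
    using u by (simp_all add: dist_norm)
  then show False
    using D assms(1) by linarith
qed

lemma circle_center_sphere:
  assumes "r > 0"
  shows "circle_center (sphere c r) = c"
  unfolding circle_center_def
  using assms sphere_eq_imp_center_eq by (intro the_equality) blast+

text \<open>The interior case consists of the circles with hyperbolic center \<open>\<alpha>\<close>, the other one of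
  the circles in the closed disc through \<open>\<alpha>\<close> (the unit circle itself included); the latter is
  meant for boundary points only.\<close>

definition circle_family :: "complex \<Rightarrow> complex set set" where
  "circle_family \<alpha> =
    (if \<alpha> \<in> ball 0 1
     then {(\<lambda>\<zeta>. (\<alpha> - of_real R * \<zeta>) / (1 - cnj \<alpha> * of_real R * \<zeta>)) ` sphere 0 1 | R :: real.
             0 < R \<and> R < 1}
     else {\<Gamma>. is_circle \<Gamma> \<and> \<Gamma> \<subseteq> cball 0 1 \<and> \<alpha> \<in> \<Gamma>})"

definition extends_holomorphically_from :: "complex set \<Rightarrow> (complex \<Rightarrow> complex) \<Rightarrow> bool" where
  "extends_holomorphically_from \<Gamma> g \<longleftrightarrow>
    (\<exists>c r. r > 0 \<and> \<Gamma> = sphere c r \<and>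
      (\<exists>F. continuous_on (cball c r) F \<and> F holomorphic_on ball c r \<and> (\<forall>z\<in>\<Gamma>. F z = g z)))"

definition polyanalytic_on_disc :: "nat \<Rightarrow> (complex \<Rightarrow> complex) \<Rightarrow> bool" where
  "polyanalytic_on_disc n f \<longleftrightarrow>
    (\<exists>a :: nat \<Rightarrow> complex \<Rightarrow> complex. (\<forall>k\<le>n. a k holomorphic_on ball 0 1) \<and>
      (\<forall>z\<in>ball 0 1. f z = (\<Sum>k\<le>n. a k z * cnj z ^ k)))"

end

theory Submission
  imports Defs
begin

text \<open>The circles attached to a point \<open>\<alpha>\<close>, interior or not, are those with center \<open>t\<alpha>\<close> and squared radius
\<open>(1 - t)(1 - t|\<alpha>|\<^sup>2)\<close>, where \<open>0 < t < 1\<close>; the unit circle \<open>t = 0\<close> is a limit of them. Let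
\<open>circle_ext t\<close> be the extension of \<open>(z - t\<alpha>)^n f(z)\<close> from the circle \<open>t\<close>, and let \<open>leaf \<alpha> z\<close> be the
parameter of the circle through \<open>z\<close>; the circles around \<open>z\<close> are those with \<open>t < leaf \<alpha> z\<close>. On the
circle \<open>t\<close>, \<open>cnj z\<close> is the value of a rational function of \<open>z\<close>. Hence \<open>F = circle_ext t z / (z - t\<alpha>)^n\<close> is
an extension of \<open>f\<close>, as a function of \<open>z\<close> and \<open>cnj z\<close>, to the points \<open>(z, w)\<close> with
\<open>(z - t\<alpha>)(w - t cnj \<alpha>) = r\<^sup>2\<close>. For fixed \<open>z\<close>, as \<open>t\<close> falls from \<open>leaf \<alpha> z\<close> to \<open>0\<close>, the point \<open>w\<close> runs from
\<open>cnj z\<close> to \<open>1/z\<close>. In the coordinate \<open>y = w/(1 - zw)\<close> this path is a ray, with the vertex \<open>corner z\<close>,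
which does not depend on \<open>\<alpha>\<close>, and the direction \<open>1 / slope \<alpha> z\<close>.

The two points \<open>\<alpha>\<close> and \<open>\<beta>\<close> give two rays and a sector between them. Integrate \<open>F\<close> along the boundary of the
sector against a kernel with poles outside the sector that vary holomorphically with \<open>z\<close>. The result
\<open>moment\<close> is holomorphic in \<open>z\<close>: the circle extensions are, and the only other dependence on \<open>z\<close> is through the
common vertex, where the integrands of the two rays agree and cancel (\<open>endpoint_constant\<close>,
\<open>leaf_integral_nearly_holomorphic\<close>, \<open>moment_holomorphic\<close>). It is zero on the unit circle, where
\<open>leaf\<close> is zero, and so it is zero on one side of the geodesic through \<open>\<alpha>\<close> and \<open>\<beta>\<close>
(\<open>moment_zero_half\<close>).

When \<open>z\<close> approaches the geodesic segment between \<open>\<alpha>\<close> and \<open>\<beta>\<close>, the sector opens to a half plane, and to the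
complementary half plane when \<open>z\<close> comes from the other side. So, for \<open>z\<close> on the segment, \<open>F\<close> lives on a line
and is annihilated by kernels with poles on either side of it. After a Cayley transform this says that all Fourier
coefficients with index outside \<open>0..n\<close> vanish, so \<open>circle_ext t z\<close> is a polynomial of degree at most \<open>n\<close> in
\<open>t\<close> (\<open>moments_imp_polynomial\<close>, \<open>circle_ext_polynomial_on_geodesic\<close>).

The segment enters every disc of the pencil of \<open>\<alpha>\<close>. Since \<open>circle_ext t\<close> is holomorphic, the identity
theorem for fixed values of \<open>t\<close> makes \<open>circle_ext t z\<close> a polynomial in \<open>t\<close> for every \<open>z\<close>
(\<open>circle_ext_interpolation\<close>). Setting \<open>t = leaf \<alpha> z\<close> shows that \<open>f\<close> times the \<open>n\<close>-th power of
\<open>slope \<alpha>\<close> is polyanalytic away from \<open>\<alpha>\<close> (\<open>polyanalytic_times_slope\<close>). The same holds for \<open>\<beta>\<close>, and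
because the coefficients of a polyanalytic function are unique, neither point is a pole of the coefficients of
\<open>f\<close>. Finally, \<open>cnj z = cnj c + r\<^sup>2/(z - c)\<close> on a circle yields the extensions from circles inside the
disc, and a limit those from circles that touch its boundary (\<open>polyanalytic_extends\<close>).\<close>

section \<open>Holomorphy from local approximation, and vanishing on a boundary arc\<close>

lemma triangle_integral_bound:
  fixes M h :: "complex \<Rightarrow> complex"
  assumes "continuous_on (convex hull {a,b,c}) M" and "h holomorphic_on convex hull {a,b,c}"
    and "\<And>z. z \<in> convex hull {a,b,c} \<Longrightarrow> norm (M z - h z) \<le> B"
    and "dist a b \<le> d" "dist b c \<le> d" "dist c a \<le> d"
  shows "norm (contour_integral (linepath a b) M + contour_integral (linepath b c) M
           + contour_integral (linepath c a) M) \<le> 3 * (B * d)"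
proof -
  have B: "0 \<le> B"
    using assms(3)[of a] norm_ge_zero order_trans by (meson hull_inc insertI1)
  have segs: "closed_segment a b \<subseteq> convex hull {a,b,c}" "closed_segment b c \<subseteq> convex hull {a,b,c}"
      "closed_segment c a \<subseteq> convex hull {a,b,c}"
    by (auto simp: segments_subset_convex_hull)
  have hc: "continuous_on (convex hull {a,b,c}) h"
    using assms(2) holomorphic_on_imp_continuous_on by blast
  have side: "norm (contour_integral (linepath x y) M - contour_integral (linepath x y) h) \<le> B * d
       \<and> (h contour_integrable_on linepath x y)"
    if xy: "closed_segment x y \<subseteq> convex hull {a,b,c}" and d: "dist x y \<le> d" for x y
  proof -
    have Mi: "M contour_integrable_on linepath x y" and hi: "h contour_integrable_on linepath x y"
      using xy assms(1) hc
      by (meson contour_integrable_continuous_linepath continuous_on_subset)+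
    have "norm (contour_integral (linepath x y) (\<lambda>z. M z - h z)) \<le> B * norm (y - x)"
      using Mi hi xy assms(3) B
      by (intro contour_integral_bound_linepath contour_integrable_diff) auto
    also have "\<dots> \<le> B * d"
      using d B by (intro mult_left_mono) (auto simp: dist_norm norm_minus_commute)
    finally show ?thesis
      using Mi hi by (simp add: contour_integral_diff)
  qed
  let ?H = "contour_integral (linepath a b) h + contour_integral (linepath b c) h
           + contour_integral (linepath c a) h"
  have "?H = 0"
    using Cauchy_theorem_triangle[OF assms(2)] by (metis has_chain_integral_chain_integral3)
  moreover have "norm ((contour_integral (linepath a b) M - contour_integral (linepath a b) h)
     + (contour_integral (linepath b c) M - contour_integral (linepath b c) h)
     + (contour_integral (linepath c a) M - contour_integral (linepath c a) h)) \<le> B * d + B * d + B * d"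
    using side[OF segs(1)] side[OF segs(2)] side[OF segs(3)] assms(4-6)
    by (intro norm_triangle_mono) auto
  ultimately show ?thesis
    by (simp add: algebra_simps)
qed

text \<open>Goursat's subdivision argument compares the function with a holomorphic one only on triangles that shrink to a
point, so an error of order \<open>o(r)\<close> on discs of radius \<open>r\<close> does no harm. This gives holomorphy of
integrals with a moving endpoint, for which no derivative is at hand.\<close>
lemma locally_nearly_holomorphic_imp_holomorphic:
  fixes M :: "complex \<Rightarrow> complex"
  assumes "open S" and contM: "continuous_on S M"
    and approx: "\<And>x \<epsilon>. x \<in> S \<Longrightarrow> \<epsilon> > 0 \<Longrightarrow>
      \<exists>r0>0. \<forall>r. 0 < r \<and> r < r0 \<longrightarrow>
        (\<exists>h. h holomorphic_on ball x r \<and> (\<forall>z\<in>ball x r. norm (M z - h z) \<le> \<epsilon> * r))"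
  shows "M holomorphic_on S"
proof -
  define T where "T x y z = contour_integral (linepath x y) M + contour_integral (linepath y z) M
        + contour_integral (linepath z x) M" for x y z
  have "T a b c = 0" if sub: "convex hull {a,b,c} \<subseteq> S" for a b c
  proof (rule ccontr)
    assume ne: "T a b c \<noteq> 0"
    have contf: "continuous_on (convex hull {a,b,c}) M"
      using contM sub continuous_on_subset by blast
    define K where "K = 1 + max (dist a b) (max (dist b c) (dist c a))"
    define e where "e = norm (T a b c) / K^2"
    have K1: "K \<ge> 1"  by (simp add: K_def max.coboundedI1)
    then have K: "K > 0" by linarith
    have dK: "dist a b \<le> K" "dist b c \<le> K" "dist c a \<le> K"
      by (simp_all add: K_def)
    have e: "e > 0"
      unfolding e_def using ne K1 by simp
    define At where "At x y z n \<longleftrightarrow>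
        convex hull {x,y,z} \<subseteq> convex hull {a,b,c} \<and>
        dist x y \<le> K/2^n \<and> dist y z \<le> K/2^n \<and> dist z x \<le> K/2^n \<and>
        norm (T x y z) \<ge> e*(K/2^n)^2"
      for x y z n
    have At0: "At a b c 0"
      using dK K by (simp add: At_def e_def)
    have AtSuc: "\<exists>x' y' z'. At x' y' z' (Suc n) \<and> convex hull {x',y',z'} \<subseteq> convex hull {x,y,z}"
      if At: "At x y z n" for x y z n
    proof -
      have contf': "continuous_on (convex hull {x,y,z}) M"
        using At contf At_def continuous_on_subset by metis
      then obtain x' y' z' where *: "{x',y',z'} \<subseteq> convex hull {x,y,z}"
        "dist x' y' \<le> K/2^n/2" "dist y' z' \<le> K/2^n/2" "dist z' x' \<le> K/2^n/2"
        "e * (K/2^n/2)^2 \<le> norm (T x' y' z')"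
        using At Cauchy_theorem_quadrisection[OF contf', of "K/2^n" e]
        unfolding At_def T_def by (simp (no_asm_use)) metis
      moreover have "convex hull {x',y',z'} \<subseteq> convex hull {x,y,z}"
        using *(1) by (simp add: hull_minimal)
      moreover have "K / 2 ^ n / 2 = K / 2 ^ Suc n" by simp
      ultimately show ?thesis
        using At unfolding At_def
        by (intro exI[where x = x'] exI[where x = y'] exI[where x = z'] conjI) (auto simp: mult.commute)
    qed
    obtain fa fb fc
      where f0 [simp]: "fa 0 = a" "fb 0 = b" "fc 0 = c"
        and A: "\<And>n. At (fa n) (fb n) (fc n) n"
        and conv_le: "\<And>n. convex hull {fa(Suc n), fb(Suc n), fc(Suc n)} \<subseteq> convex hull {fa n, fb n, fc n}"
      by (rule Chain3 [of At, OF At0 AtSuc]) auto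
    obtain x where x: "\<And>n. x \<in> convex hull {fa n, fb n, fc n}"
    proof (rule bounded_closed_nest)
      show "\<And>n. closed (convex hull {fa n, fb n, fc n})"
        by (simp add: compact_imp_closed finite_imp_compact_convex_hull)
      show "\<And>m n. m \<le> n \<Longrightarrow> convex hull {fa n, fb n, fc n} \<subseteq> convex hull {fa m, fb m, fc m}"
        by (erule transitive_stepwise_le) (auto simp: conv_le)
    qed (fastforce intro: finite_imp_bounded_convex_hull)+
    have "x \<in> S"
      using x[of 0] sub by auto
    then obtain r0 where r0: "r0 > 0" "\<And>r. 0 < r \<Longrightarrow> r < r0 \<Longrightarrow>
        \<exists>h. h holomorphic_on ball x r \<and> (\<forall>z\<in>ball x r. norm (M z - h z) \<le> e / 7 * r)"
      using approx[of x "e/7"] e by (metis divide_pos_pos zero_less_numeral)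
    obtain n where n: "2 * K / r0 < 2 ^ n"
      using real_arch_pow[of 2 "2*K/r0"] by auto
    define d where "d = K / 2 ^ n"
    have d: "0 < d" "2 * d < r0"
      using n K r0(1) by (auto simp: d_def field_simps)
    obtain h where h: "h holomorphic_on ball x (2*d)"
        "\<And>z. z \<in> ball x (2*d) \<Longrightarrow> norm (M z - h z) \<le> e / 7 * (2*d)"
      using r0(2)[of "2*d"] d by auto
    let ?C = "convex hull {fa n, fb n, fc n}"
    have At: "?C \<subseteq> convex hull {a,b,c}" "dist (fa n) (fb n) \<le> d" "dist (fb n) (fc n) \<le> d"
        "dist (fc n) (fa n) \<le> d" "e * d^2 \<le> norm (T (fa n) (fb n) (fc n))"
      using A[of n] by (auto simp: At_def d_def)
    have sub2: "?C \<subseteq> ball x (2*d)"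
    proof
      fix y assume "y \<in> ?C"
      from triangle_points_closer[OF x this] have "norm (x - y) \<le> d"
        using At(2-4) by (auto simp: dist_norm)
      then show "y \<in> ball x (2*d)"
        using d by (auto simp: dist_norm)
    qed
    have "norm (T (fa n) (fb n) (fc n)) \<le> 3 * (e / 7 * (2*d) * d)"
      unfolding T_def
    proof (rule triangle_integral_bound[where h = h])
      show "continuous_on ?C M" using contf At(1) continuous_on_subset by blast
      show "h holomorphic_on ?C" using h(1) sub2 holomorphic_on_subset by blast
    qed (use At sub2 h(2) in auto)
    also have "\<dots> < e * d^2"
      using e d by (simp add: power2_eq_square)
    finally show False
      using At(5) by linarith
  qed
  then have "M analytic_on S"
    using assms(1,2) unfolding T_def by (intro Morera_triangle) auto
  then show ?thesis
    by (rule analytic_imp_holomorphic)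
qed

text \<open>Fubini's theorem moves a contour integral over a triangle under the integral sign, where it vanishes; no bound on
the derivative in \<open>z\<close> is involved.\<close>
lemma holomorphic_on_integral:
  fixes f :: "complex \<Rightarrow> real \<Rightarrow> complex"
  assumes "open U" and cont: "continuous_on (U \<times> {a..b}) (\<lambda>(z,t). f z t)"
    and hol: "\<And>t. t \<in> {a..b} \<Longrightarrow> (\<lambda>z. f z t) holomorphic_on U"
  shows "(\<lambda>z. integral {a..b} (f z)) holomorphic_on U"
proof -
  define I where "I z = integral {a..b} (f z)" for z
  have contI: "continuous_on U I"
    using integral_continuous_on_param[of U a b f] cont by (simp add: I_def)
  have swap: "contour_integral (linepath p q) I
        = integral {a..b} (\<lambda>t. contour_integral (linepath p q) (\<lambda>z. f z t))
      \<and> (\<lambda>t. contour_integral (linepath p q) (\<lambda>z. f z t)) integrable_on {a..b}"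
    if pq: "closed_segment p q \<subseteq> U" for p q
  proof -
    have lp: "linepath p q x \<in> U" if "x \<in> {0..1}" for x
      using pq that linepath_in_path by blast
    have c1: "continuous_on ({0..1} \<times> {a..b}) (\<lambda>(x,t). f (linepath p q x) t * (q - p))"
    proof -
      have "continuous_on ({0..1} \<times> {a..b}) (\<lambda>w. (case (linepath p q (fst w), snd w) of (z,t) \<Rightarrow> f z t) * (q - p))"
        using lp unfolding linepath_def
        by (intro continuous_on_mult continuous_on_const continuous_on_compose2[OF cont])
           (auto intro!: continuous_intros)
      then show ?thesis by (simp add: case_prod_beta)
    qed
    have c2: "continuous_on ({a..b} \<times> {0..1}) (\<lambda>(t,x). f (linepath p q x) t * (q - p))"
    proof -
      have "continuous_on ({a..b} \<times> {0..1}) (\<lambda>w. (case (snd w, fst w) of (x,t) \<Rightarrow> f (linepath p q x) t * (q - p)))"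
        by (rule continuous_on_compose2[OF c1]) (auto intro!: continuous_intros)
      then show ?thesis by (simp add: case_prod_beta)
    qed
    have "contour_integral (linepath p q) I = integral {0..1} (\<lambda>x. integral {a..b} (\<lambda>t. f (linepath p q x) t * (q - p)))"
      by (simp add: contour_integral_integral I_def)
    also have "\<dots> = integral {a..b} (\<lambda>t. integral {0..1} (\<lambda>x. f (linepath p q x) t * (q - p)))"
      using integral_swap_continuous[of 0 a 1 b "\<lambda>x t. f (linepath p q x) t * (q - p)"] c1
      by (simp add: cbox_Pair_eq)
    finally have 1: "contour_integral (linepath p q) I
        = integral {a..b} (\<lambda>t. contour_integral (linepath p q) (\<lambda>z. f z t))"
      by (simp add: contour_integral_integral)
    have "continuous_on {a..b} (\<lambda>t. integral {0..1} (\<lambda>x. f (linepath p q x) t * (q - p)))"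
      using integral_continuous_on_param[of "{a..b}" "0::real" 1 "\<lambda>t x. f (linepath p q x) t * (q - p)"] c2 by simp
    then have "(\<lambda>t. integral {0..1} (\<lambda>x. f (linepath p q x) t * (q - p))) integrable_on {a..b}"
      by (rule integrable_continuous_real)
    then show ?thesis
      using 1 by (simp add: contour_integral_integral)
  qed
  have "contour_integral (linepath p q) I + contour_integral (linepath q r) I + contour_integral (linepath r p) I = 0"
    if sub: "convex hull {p,q,r} \<subseteq> U" for p q r
  proof -
    have s1: "closed_segment p q \<subseteq> U" "closed_segment q r \<subseteq> U" "closed_segment r p \<subseteq> U"
      by (rule order_trans[OF _ sub], simp add: segments_subset_convex_hull)+
    have tri: "contour_integral (linepath p q) (\<lambda>z. f z t) + contour_integral (linepath q r) (\<lambda>z. f z t)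
        + contour_integral (linepath r p) (\<lambda>z. f z t) = 0" if "t \<in> {a..b}" for t
      using Cauchy_theorem_triangle[OF holomorphic_on_subset[OF hol[OF that] sub]]
      by (metis has_chain_integral_chain_integral3)
    have "contour_integral (linepath p q) I + contour_integral (linepath q r) I + contour_integral (linepath r p) I
       = integral {a..b} (\<lambda>t. contour_integral (linepath p q) (\<lambda>z. f z t) + contour_integral (linepath q r) (\<lambda>z. f z t)
        + contour_integral (linepath r p) (\<lambda>z. f z t))"
      using swap[OF s1(1)] swap[OF s1(2)] swap[OF s1(3)]
      by (simp add: Henstock_Kurzweil_Integration.integral_add integrable_add)
    also have "\<dots> = integral {a..b} (\<lambda>t. 0)"
      using tri by (intro Henstock_Kurzweil_Integration.integral_cong) auto
    finally show ?thesis by simp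
  qed
  then have "I analytic_on U"
    using assms(1) contI by (intro Morera_triangle) auto
  then show ?thesis
    unfolding I_def by (rule analytic_imp_holomorphic)
qed

text \<open>The set \<open>U\<close> is bounded by an arc of the unit circle and a chord. The function
\<open>\<phi> w = cnj \<zeta> * w - (1 - e)\<close> has real part zero on the chord and positive real part inside. By the maximum
principle \<open>M * exp (N * \<phi>)\<close> is bounded by the maximum of \<open>M\<close> on the chord, for every \<open>N\<close>; now let \<open>N\<close> tend
to infinity.\<close>
lemma holomorphic_zero_near_boundary_arc:
  fixes M :: "complex \<Rightarrow> complex"
  assumes \<zeta>: "norm \<zeta> = 1" and e: "0 < e"
    and U: "U = {z. norm z \<le> 1 \<and> 1 - e \<le> Re (cnj \<zeta> * z)}"
    and cont: "continuous_on U M" and hol: "M holomorphic_on interior U"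
    and zero: "\<And>z. z \<in> U \<Longrightarrow> norm z = 1 \<Longrightarrow> M z = 0"
    and z: "norm z < 1" "1 - e < Re (cnj \<zeta> * z)"
  shows "M z = 0"
proof -
  have clU: "closed U"
    unfolding U by (intro closed_Collect_conj closed_Collect_le continuous_intros)
  have bdU: "bounded U"
    unfolding bounded_iff by (intro exI[of _ 1]) (simp add: U)
  then have "compact (M ` U)"
    using clU cont compact_continuous_image compact_eq_bounded_closed by blast
  then obtain C where C: "\<And>w. w \<in> U \<Longrightarrow> norm (M w) \<le> C"
    by (meson bounded_iff compact_imp_bounded imageI)
  have zU: "z \<in> U" using z by (auto simp: U)
  have C0: "0 \<le> C" using C[OF zU] norm_ge_zero order_trans by blast
  define \<phi> where "\<phi> w = cnj \<zeta> * w - of_real (1 - e)" for w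
  have bound: "norm (M z * exp (of_nat N * \<phi> z)) \<le> C" for N :: nat
  proof (rule maximum_modulus_frontier[OF _ _ bdU _ zU])
    show "(\<lambda>w. M w * exp (of_nat N * \<phi> w)) holomorphic_on interior U"
      unfolding \<phi>_def by (intro holomorphic_intros hol)
    show "continuous_on (closure U) (\<lambda>w. M w * exp (of_nat N * \<phi> w))"
      using clU cont unfolding \<phi>_def by (auto intro!: continuous_intros simp: closure_closed)
    fix w assume w: "w \<in> frontier U"
    then have wU: "w \<in> U"
      using clU by (auto simp: frontier_def)
    show "norm (M w * exp (of_nat N * \<phi> w)) \<le> C"
    proof (cases "norm w = 1 \<or> Re (cnj \<zeta> * w) = 1 - e")
      case True
      then show ?thesis
      proof
        assume "norm w = 1" then show ?thesis using zero[OF wU] C0 by simp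
      next
        assume "Re (cnj \<zeta> * w) = 1 - e"
        then show ?thesis using C[OF wU] by (simp add: norm_mult \<phi>_def)
      qed
    next
      case False
      have op: "open {w. norm w < 1 \<and> 1 - e < Re (cnj \<zeta> * w)}"
        by (intro open_Collect_conj open_Collect_less continuous_intros)
      have "w \<in> interior U"
        using False wU by (intro interiorI[OF op]) (auto simp: U)
      then show ?thesis using w by (simp add: frontier_def)
    qed
  qed
  have "norm (M z) \<le> C * exp (- (real N * Re (\<phi> z)))" for N :: nat
    using bound[of N] by (simp add: norm_mult exp_minus field_simps)
  moreover have "(\<lambda>N. C * exp (- (real N * Re (\<phi> z)))) \<longlonglongrightarrow> C * 0"
  proof (intro tendsto_mult tendsto_const)
    have "0 < Re (\<phi> z)" using z by (simp add: \<phi>_def)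
    then have "norm (exp (- Re (\<phi> z))) < 1" by simp
    then have "(\<lambda>N. exp (- Re (\<phi> z)) ^ N) \<longlonglongrightarrow> 0" by (rule LIMSEQ_power_zero)
    then show "(\<lambda>N. exp (- (real N * Re (\<phi> z)))) \<longlonglongrightarrow> 0"
      by (simp add: exp_of_nat_mult[symmetric])
  qed
  ultimately have "norm (M z) \<le> 0"
    by (intro LIMSEQ_le_const[where X = "\<lambda>N. C * exp (- (real N * Re (\<phi> z)))"]) auto
  then show ?thesis by simp
qed

section \<open>Continuous functions on a circle made of two arcs\<close>

text \<open>In terms of \<open>u = 1/t\<close> this is the Cayley transform \<open>(u - cnj \<tau>) / (u - \<tau>)\<close>, which maps the real line to
the unit circle; \<open>t = 0\<close> goes to \<open>1\<close>.\<close>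
definition cayley :: "complex \<Rightarrow> real \<Rightarrow> complex" where
  "cayley \<tau> t = (1 - of_real t * cnj \<tau>) / (1 - of_real t * \<tau>)"

definition cayley' :: "complex \<Rightarrow> real \<Rightarrow> complex" where
  "cayley' \<tau> t = (\<tau> - cnj \<tau>) / (1 - of_real t * \<tau>) ^ 2"

lemma cayley_denom_nz:
  assumes "Im \<tau> \<noteq> 0"
  shows "1 - of_real t * \<tau> \<noteq> 0" and "1 - of_real t * cnj \<tau> \<noteq> 0"
  using assms by (auto simp: complex_eq_iff)

lemma norm_cayley: "Im \<tau> \<noteq> 0 \<Longrightarrow> norm (cayley \<tau> t) = 1"
proof -
  assume t: "Im \<tau> \<noteq> 0"
  have "1 - of_real t * cnj \<tau> = cnj (1 - of_real t * \<tau>)" by simp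
  then have "norm (1 - of_real t * cnj \<tau>) = norm (1 - of_real t * \<tau>)"
    by (simp only: complex_mod_cnj)
  then show ?thesis using cayley_denom_nz[OF t] by (simp add: cayley_def norm_divide)
qed

lemma cayley_nz: "Im \<tau> \<noteq> 0 \<Longrightarrow> cayley \<tau> t \<noteq> 0"
  using norm_cayley[of \<tau> t] by auto

lemma cayley_0 [simp]: "cayley \<tau> 0 = 1"
  by (simp add: cayley_def)

lemma cayley_deriv:
  assumes "Im \<tau> \<noteq> 0"
  shows "(cayley \<tau> has_vector_derivative cayley' \<tau> t) (at t within S)"
proof -
  have "((\<lambda>z. (1 - z * cnj \<tau>) / (1 - z * \<tau>)) has_field_derivative cayley' \<tau> t) (at (of_real t))"
    using cayley_denom_nz[OF assms, of t]
    by (auto intro!: derivative_eq_intros simp: cayley'_def field_simps power2_eq_square)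
  then show ?thesis
    unfolding cayley_def[abs_def] by (rule has_vector_derivative_real_field)
qed

lemma continuous_on_cayley [continuous_intros]:
  assumes "Im \<tau> \<noteq> 0" shows "continuous_on S (cayley \<tau>)" "continuous_on S (cayley' \<tau>)"
  unfolding cayley_def[abs_def] cayley'_def[abs_def]
  using cayley_denom_nz[OF assms] by (auto intro!: continuous_intros)

lemma continuous_on_cayley_powi [continuous_intros]:
  assumes "Im \<tau> \<noteq> 0" shows "continuous_on S (\<lambda>t. cayley \<tau> t powi k)"
  using cayley_nz[OF assms] by (auto intro!: continuous_intros assms)

lemma cayley_powi_integral:
  assumes "Im \<tau> \<noteq> 0" and "k \<noteq> -1" and "0 \<le> a"
  shows "integral {0..a} (\<lambda>t. cayley \<tau> t powi k * cayley' \<tau> t) = (cayley \<tau> a powi (k + 1) - 1) / of_int (k + 1)"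
proof -
  have "((\<lambda>t. cayley \<tau> t powi (k + 1) / of_int (k + 1)) has_vector_derivative
      cayley \<tau> t powi k * cayley' \<tau> t) (at t within {0..a})" for t
  proof -
    have k: "of_int (k + 1) \<noteq> (0::complex)" using assms(2) by (metis add_eq_0_iff2 of_int_eq_0_iff)
    have "((\<lambda>z. z powi (k + 1) / of_int (k + 1)) has_field_derivative cayley \<tau> t powi k) (at (cayley \<tau> t) within cayley \<tau> ` {0..a})"
      using cayley_nz[OF assms(1), of t] k by (auto intro!: derivative_eq_intros)
    from field_vector_diff_chain_within[OF cayley_deriv[OF assms(1)] this]
    show ?thesis by (simp add: o_def mult.commute)
  qed
  from fundamental_theorem_of_calculus[OF assms(3) this]
  show ?thesis by (simp add: integral_unique diff_divide_distrib)
qed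

text \<open>The logarithmic derivative is \<open>2\<i> Im \<tau> / |1 - t\<tau>|\<^sup>2\<close>: the sign of \<open>Im \<tau>\<close> decides in which direction
the arc is traversed.\<close>
lemma cayley_log_integral:
  assumes "Im \<tau> \<noteq> 0" and "0 < a"
  obtains P where "P > 0" and "integral {0..a} (\<lambda>t. cayley \<tau> t powi (-1) * cayley' \<tau> t) = 2 * \<i> * of_real (Im \<tau> * P)"
proof
  let ?g = "\<lambda>t::real. 1 / (norm (1 - of_real t * \<tau>))\<^sup>2"
  have cont: "continuous_on {0..a} ?g"
    using cayley_denom_nz[OF assms(1)] by (intro continuous_intros) auto
  then have int: "(?g has_integral integral {0..a} ?g) {0..a}"
    by (simp add: integrable_continuous_real integrable_integral)
  have "integral {0..a} ?g \<noteq> 0"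
  proof
    assume 0: "integral {0..a} ?g = 0"
    have "?g 0 = 0"
      by (rule has_integral_0_cbox_imp_0[of 0 a ?g])
        (use cont int 0 assms in \<open>auto simp: box_real\<close>)
    then show False by simp
  qed
  then show "0 < integral {0..a} ?g"
    using integral_nonneg[OF integrable_continuous_real[OF cont]] by force
  have "cayley \<tau> t powi (-1) * cayley' \<tau> t = 2 * \<i> * of_real (Im \<tau>) * of_real (?g t)" for t
  proof -
    have *: "of_real ((norm (1 - of_real t * \<tau>))\<^sup>2) = (1 - of_real t * \<tau>) * (1 - of_real t * cnj \<tau>)"
      using complex_norm_square[of "1 - of_real t * \<tau>"] by simp
    have "cayley \<tau> t powi (-1) * cayley' \<tau> t = (\<tau> - cnj \<tau>) / ((1 - of_real t * \<tau>) * (1 - of_real t * cnj \<tau>))"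
    proof -
      have "inverse (v / u) * (x / u ^ 2) = x / (u * v)" if "u \<noteq> 0" "v \<noteq> 0" for u v x :: complex
        using that by (simp add: field_simps power2_eq_square)
      then show ?thesis
        using cayley_denom_nz[OF assms(1), of t] by (simp add: cayley_def cayley'_def power_int_minus)
    qed
    also have "\<dots> = 2 * \<i> * of_real (Im \<tau>) * of_real (?g t)"
      unfolding of_real_divide * complex_diff_cnj by simp
    finally show ?thesis .
  qed
  then have "integral {0..a} (\<lambda>t. cayley \<tau> t powi (-1) * cayley' \<tau> t)
      = integral {0..a} (\<lambda>t. (2 * \<i> * of_real (Im \<tau>)) * of_real (?g t))"
    by simp
  also have "\<dots> = 2 * \<i> * of_real (Im \<tau>) * integral {0..a} (\<lambda>t. of_real (?g t))"
    by (rule integral_mult_right)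
  also have "integral {0..a} (\<lambda>t. of_real (?g t) :: complex) = of_real (integral {0..a} ?g)"
    using has_integral_of_real[OF int] by (rule integral_unique)
  finally show "integral {0..a} (\<lambda>t. cayley \<tau> t powi (-1) * cayley' \<tau> t)
      = 2 * \<i> * of_real (Im \<tau> * integral {0..a} ?g)" by simp
qed

lemma bump_integrals_zero_imp_zero:
  fixes \<eta> :: "real \<Rightarrow> complex"
  assumes cont: "continuous_on {0..a} \<eta>" and s: "0 < s" "s < a"
    and bump: "\<And>\<rho>. 0 < \<rho> \<Longrightarrow> \<rho> \<le> s \<Longrightarrow> \<rho> \<le> a - s \<Longrightarrow>
      integral {0..a} (\<lambda>t. \<eta> t * of_real (max 0 (\<rho> - \<bar>t - s\<bar>))) = 0"
  shows "\<eta> s = 0"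
proof (rule ccontr)
  assume ne: "\<eta> s \<noteq> 0"
  obtain d where d: "d > 0" "\<And>t. t \<in> {0..a} \<Longrightarrow> \<bar>t - s\<bar> < d \<Longrightarrow> norm (\<eta> t - \<eta> s) < norm (\<eta> s) / 2"
    using cont ne s unfolding continuous_on_iff dist_norm
    by (metis atLeastAtMost_iff half_gt_zero less_eq_real_def real_norm_def zero_less_norm_iff)
  define \<rho> where "\<rho> = min d (min s (a - s))"
  let ?b = "\<lambda>t::real. max 0 (\<rho> - \<bar>t - s\<bar>)"
  have \<rho>: "0 < \<rho>" "\<rho> \<le> s" "\<rho> \<le> a - s" "\<rho> \<le> d"
    using d(1) s by (auto simp: \<rho>_def)
  have cb: "continuous_on {0..a} ?b" by (intro continuous_intros)
  then have ib: "(?b has_integral integral {0..a} ?b) {0..a}"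
    by (simp add: integrable_continuous_real integrable_integral)
  have "integral {0..a} ?b \<noteq> 0"
  proof
    assume 0: "integral {0..a} ?b = 0"
    have "?b s = 0"
      by (rule has_integral_0_cbox_imp_0[of 0 a ?b])
        (use cb ib 0 s in \<open>auto simp: box_real\<close>)
    then show False using \<rho> by simp
  qed
  then have pos: "0 < integral {0..a} ?b"
    using integral_nonneg[OF integrable_continuous_real[OF cb]] by force
  have "integral {0..a} (\<lambda>t. (\<eta> s - \<eta> t) * of_real (?b t))
     = integral {0..a} (\<lambda>t. \<eta> s * of_real (?b t)) - integral {0..a} (\<lambda>t. \<eta> t * of_real (?b t))"
    unfolding left_diff_distrib
    by (intro Henstock_Kurzweil_Integration.integral_diff integrable_continuous_real continuous_intros cont)
  also have "\<dots> = \<eta> s * of_real (integral {0..a} ?b)"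
  proof -
    have "((\<lambda>t. of_real (?b t) :: complex) has_integral of_real (integral {0..a} ?b)) {0..a}"
      by (rule has_integral_of_real[OF ib])
    then show ?thesis using bump[OF \<rho>(1-3)] by (simp add: integral_unique)
  qed
  finally have "norm (\<eta> s) * integral {0..a} ?b = norm (integral {0..a} (\<lambda>t. (\<eta> s - \<eta> t) * of_real (?b t)))"
    using pos by (simp add: norm_mult)
  also have "\<dots> \<le> integral {0..a} (\<lambda>t. norm (\<eta> s) / 2 * ?b t)"
  proof (rule integral_norm_bound_integral)
    show "(\<lambda>t. (\<eta> s - \<eta> t) * of_real (?b t)) integrable_on {0..a}"
      by (intro integrable_continuous_real continuous_intros cont)
    show "(\<lambda>t. norm (\<eta> s) / 2 * ?b t) integrable_on {0..a}"
      by (intro integrable_continuous_real continuous_intros)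
    fix t assume t: "t \<in> {0..a}"
    show "norm ((\<eta> s - \<eta> t) * of_real (?b t)) \<le> norm (\<eta> s) / 2 * ?b t"
    proof (cases "\<bar>t - s\<bar> < \<rho>")
      case True
      then have "norm (\<eta> t - \<eta> s) \<le> norm (\<eta> s) / 2"
        using d(2)[OF t] \<rho>(4) by fastforce
      moreover have "norm ((\<eta> s - \<eta> t) * of_real (?b t)) = norm (\<eta> t - \<eta> s) * ?b t"
        by (simp add: norm_mult norm_minus_commute)
      ultimately show ?thesis using mult_right_mono[of "norm (\<eta> t - \<eta> s)" "norm (\<eta> s) / 2" "?b t"] by simp
    qed simp
  qed
  also have "\<dots> = norm (\<eta> s) / 2 * integral {0..a} ?b" by simp
  finally show False using pos ne by simp
qed

definition arc_int :: "complex \<Rightarrow> real \<Rightarrow> (real \<Rightarrow> complex) \<Rightarrow> complex" where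
  "arc_int \<kappa> A F = integral {0..A} (\<lambda>t. F t * cayley' \<kappa> t)"

lemma arc_int_cmult: "arc_int \<kappa> A (\<lambda>t. c * F t) = c * arc_int \<kappa> A F"
  by (simp add: arc_int_def mult.assoc)

lemma arc_int_add:
  assumes "Im \<kappa> \<noteq> 0" "continuous_on {0..A} F" "continuous_on {0..A} F'"
  shows "arc_int \<kappa> A (\<lambda>t. F t + F' t) = arc_int \<kappa> A F + arc_int \<kappa> A F'"
  unfolding arc_int_def distrib_right
  by (intro Henstock_Kurzweil_Integration.integral_add integrable_continuous_real continuous_intros assms)

lemma arc_int_diff:
  assumes "Im \<kappa> \<noteq> 0" "continuous_on {0..A} F" "continuous_on {0..A} F'"
  shows "arc_int \<kappa> A (\<lambda>t. F t - F' t) = arc_int \<kappa> A F - arc_int \<kappa> A F'"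
  using arc_int_add[OF assms(1,2), of "\<lambda>t. - 1 * F' t"] assms(3) arc_int_cmult[of \<kappa> A "- 1" F']
  by (simp add: continuous_intros)

lemma arc_int_sum:
  assumes "Im \<kappa> \<noteq> 0" "\<And>j. j \<in> J \<Longrightarrow> continuous_on {0..A} (F j)" "finite J"
  shows "arc_int \<kappa> A (\<lambda>t. \<Sum>j\<in>J. F j t) = (\<Sum>j\<in>J. arc_int \<kappa> A (F j))"
  unfolding arc_int_def sum_distrib_right
  by (intro Henstock_Kurzweil_Integration.integral_sum integrable_continuous_real continuous_intros assms)

lemma arc_int_uniform:
  assumes k: "Im \<kappa> \<noteq> 0" and F: "continuous_on {0..A} F" and A: "0 < A"
  obtains C where "C > 0" and "\<And>(p :: complex \<Rightarrow> real) q e. continuous_on (sphere 0 1) p \<Longrightarrow> continuous_on (sphere 0 1) q \<Longrightarrow>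
      (\<And>z. z \<in> sphere 0 1 \<Longrightarrow> \<bar>p z - q z\<bar> < e) \<Longrightarrow>
      norm (arc_int \<kappa> A (\<lambda>t. of_real (p (cayley \<kappa> t)) * F t) - arc_int \<kappa> A (\<lambda>t. of_real (q (cayley \<kappa> t)) * F t)) \<le> C * e"
proof -
  have sk: "cayley \<kappa> t \<in> sphere 0 1" for t using norm_cayley[OF k] by auto
  have cF: "continuous_on {0..A} (\<lambda>t. F t * cayley' \<kappa> t)"
    by (intro continuous_intros F continuous_on_cayley k)
  have "bounded ((\<lambda>t. F t * cayley' \<kappa> t) ` {0..A})"
    by (intro compact_imp_bounded compact_continuous_image cF compact_Icc)
  then obtain B where B: "B > 0" "\<And>t. t \<in> {0..A} \<Longrightarrow> norm (F t * cayley' \<kappa> t) \<le> B"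
    unfolding bounded_pos by blast
  show thesis
  proof (rule that)
    show "0 < B * A" using B A by simp
    fix p q :: "complex \<Rightarrow> real" and e
    assume p: "continuous_on (sphere 0 1) p" and q: "continuous_on (sphere 0 1) q"
      and pq: "\<And>z. z \<in> sphere 0 1 \<Longrightarrow> \<bar>p z - q z\<bar> < e"
    have e: "0 < e" using pq[OF sk[of 0]] by (meson abs_ge_zero le_less_trans)
    have c: "continuous_on {0..A} (\<lambda>t. of_real (r (cayley \<kappa> t)) :: complex)" if "continuous_on (sphere 0 1) r" for r :: "complex \<Rightarrow> real"
      by (intro continuous_intros continuous_on_compose2[OF that] k) (use sk in auto)
    have "arc_int \<kappa> A (\<lambda>t. of_real (p (cayley \<kappa> t)) * F t) - arc_int \<kappa> A (\<lambda>t. of_real (q (cayley \<kappa> t)) * F t)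
        = integral {0..A} (\<lambda>t. of_real (p (cayley \<kappa> t) - q (cayley \<kappa> t)) * (F t * cayley' \<kappa> t))"
      using arc_int_diff[OF k continuous_on_mult[OF c[OF p] F] continuous_on_mult[OF c[OF q] F]]
      by (simp add: arc_int_def algebra_simps)
    also have "norm \<dots> \<le> (e * B) * (A - 0)"
    proof (rule integral_bound)
      show "continuous_on {0..A} (\<lambda>t. of_real (p (cayley \<kappa> t) - q (cayley \<kappa> t)) * (F t * cayley' \<kappa> t))"
        unfolding of_real_diff by (intro continuous_intros c p q cF)
      fix t assume t: "t \<in> {0..A}"
      have "norm (of_real (p (cayley \<kappa> t) - q (cayley \<kappa> t)) * (F t * cayley' \<kappa> t))
          = \<bar>p (cayley \<kappa> t) - q (cayley \<kappa> t)\<bar> * norm (F t * cayley' \<kappa> t)"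
        by (simp only: norm_mult norm_of_real)
      also have "\<dots> \<le> e * B"
        using pq[OF sk] B(2)[OF t] e by (intro mult_mono) (auto intro: less_imp_le)
      finally show "norm (of_real (p (cayley \<kappa> t) - q (cayley \<kappa> t)) * (F t * cayley' \<kappa> t)) \<le> e * B" .
    qed (use A in auto)
    finally show "norm (arc_int \<kappa> A (\<lambda>t. of_real (p (cayley \<kappa> t)) * F t)
        - arc_int \<kappa> A (\<lambda>t. of_real (q (cayley \<kappa> t)) * F t)) \<le> B * A * e"
      by (simp add: mult_ac)
  qed
qed

text \<open>Both maps trace an arc of the unit circle from \<open>1\<close> to the same endpoint, in opposite directions because
\<open>Im \<tau>\<close> and \<open>Im \<sigma>\<close> have opposite signs. Together the arcs make up the circle, and a pair of functions
on \<open>[0, a]\<close> and \<open>[0, b]\<close> stands for a function on the circle. Its Fourier coefficients are the differences of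
the two integrals in \<open>same_moments\<close>, up to a factor.\<close>
locale two_arcs =
  fixes \<tau> \<sigma> :: complex and a b :: real
  assumes opp: "Im \<tau> * Im \<sigma> < 0" and ab: "0 < a" "0 < b"
    and ends: "cayley \<tau> a = cayley \<sigma> b"
begin

lemma im_nz: "Im \<tau> \<noteq> 0" "Im \<sigma> \<noteq> 0"
  using opp by auto

lemmas arc_intros = continuous_on_cayley[OF im_nz(1)] continuous_on_cayley[OF im_nz(2)]
  continuous_on_cayley_powi[OF im_nz(1)] continuous_on_cayley_powi[OF im_nz(2)]

definition same_moments :: "(real \<Rightarrow> complex) \<Rightarrow> (real \<Rightarrow> complex) \<Rightarrow> bool" where
  "same_moments \<Phi> \<Psi> \<longleftrightarrow> continuous_on {0..a} \<Phi> \<and> continuous_on {0..b} \<Psi> \<and>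
    (\<forall>k. arc_int \<tau> a (\<lambda>t. \<Phi> t * cayley \<tau> t powi k) = arc_int \<sigma> b (\<lambda>s. \<Psi> s * cayley \<sigma> s powi k))"

lemma same_moments_add:
  assumes "same_moments \<Phi> \<Psi>" "same_moments \<Phi>' \<Psi>'"
  shows "same_moments (\<lambda>t. \<Phi> t + \<Phi>' t) (\<lambda>s. \<Psi> s + \<Psi>' s)"
  using assms unfolding same_moments_def distrib_right
  by (auto simp: arc_int_add im_nz continuous_intros arc_intros)

lemma same_moments_powi:
  assumes "same_moments \<Phi> \<Psi>"
  shows "same_moments (\<lambda>t. c * cayley \<tau> t powi j * \<Phi> t) (\<lambda>s. c * cayley \<sigma> s powi j * \<Psi> s)"
proof -
  have shift: "c * cayley \<kappa> t powi j * x * cayley \<kappa> t powi k = c * (x * cayley \<kappa> t powi (j + k))"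
    if "Im \<kappa> \<noteq> 0" for \<kappa> x t k
    using cayley_nz[OF that] by (simp add: power_int_add)
  show ?thesis
    using assms unfolding same_moments_def shift[OF im_nz(1)] shift[OF im_nz(2)] arc_int_cmult
    by (auto intro!: continuous_intros arc_intros)
qed

text \<open>On the circle a real linear functional is a combination of \<open>\<zeta>\<close> and \<open>1/\<zeta>\<close>, and multiplication by powers
of \<open>\<zeta>\<close> only shifts the moments. Speaking of all pairs \<open>\<Phi>\<close>, \<open>\<Psi>\<close> at once makes the
property stable under products of polynomial functions.\<close>
lemma same_moments_polynomial:
  assumes "real_polynomial_function p" and "same_moments \<Phi> \<Psi>"
  shows "same_moments (\<lambda>t. of_real (p (cayley \<tau> t)) * \<Phi> t) (\<lambda>s. of_real (p (cayley \<sigma> s)) * \<Psi> s)"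
  using assms
proof (induction arbitrary: \<Phi> \<Psi> rule: real_polynomial_function.induct)
  case (linear f)
  interpret f: bounded_linear f by fact
  have f: "of_real (f \<zeta>) = (of_real (f 1) - \<i> * of_real (f \<i>)) / 2 * \<zeta> powi 1
       + (of_real (f 1) + \<i> * of_real (f \<i>)) / 2 * \<zeta> powi (-1)" if "norm \<zeta> = 1" for \<zeta>
  proof -
    have inv: "\<zeta> powi (-1) = cnj \<zeta>"
      using that by (simp add: power_int_minus cmod_def complex_eq_iff)
    have "f \<zeta> = f (Re \<zeta> *\<^sub>R 1 + Im \<zeta> *\<^sub>R \<i>)"
      by (rule arg_cong[of _ _ f]) (simp add: complex_eq_iff)
    also have "\<dots> = Re \<zeta> * f 1 + Im \<zeta> * f \<i>"
      by (simp add: f.add f.scaleR)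
    finally show ?thesis
      unfolding inv by (simp add: complex_eq_iff field_simps)
  qed
  show ?case
    unfolding f[OF norm_cayley[OF im_nz(1)]] f[OF norm_cayley[OF im_nz(2)]] distrib_right
    by (intro same_moments_add same_moments_powi linear.prems)
next
  case (const c)
  then show ?case using same_moments_powi[of \<Phi> \<Psi> "of_real c" 0] by simp
next
  case (add f g)
  then show ?case
    using same_moments_add[OF add.IH(1)[OF add.prems] add.IH(2)[OF add.prems]] by (simp add: distrib_right)
next
  case (mult f g)
  then show ?case
    using mult.IH(1)[OF mult.IH(2)[OF mult.prems]] by (simp add: mult.assoc)
qed

text \<open>This is the Stone--Weierstrass theorem on the circle.\<close>
lemma same_moments_continuous:
  fixes p :: "complex \<Rightarrow> real"
  assumes sm: "same_moments \<Phi> \<Psi>" and p: "continuous_on (sphere 0 1) p"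
  shows "arc_int \<tau> a (\<lambda>t. of_real (p (cayley \<tau> t)) * \<Phi> t)
       = arc_int \<sigma> b (\<lambda>s. of_real (p (cayley \<sigma> s)) * \<Psi> s)" (is "?L p = ?R p")
proof -
  have c: "continuous_on {0..a} \<Phi>" "continuous_on {0..b} \<Psi>"
    using sm by (auto simp: same_moments_def)
  obtain C1 where C1: "C1 > 0" "\<And>p q e. continuous_on (sphere 0 1) p \<Longrightarrow> continuous_on (sphere 0 1) q \<Longrightarrow>
      (\<And>z. z \<in> sphere 0 1 \<Longrightarrow> \<bar>p z - q z\<bar> < e) \<Longrightarrow> norm (?L p - ?L q) \<le> C1 * e"
    using arc_int_uniform[OF im_nz(1) c(1) ab(1)] by blast
  obtain C2 where C2: "C2 > 0" "\<And>p q e. continuous_on (sphere 0 1) p \<Longrightarrow> continuous_on (sphere 0 1) q \<Longrightarrow>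
      (\<And>z. z \<in> sphere 0 1 \<Longrightarrow> \<bar>p z - q z\<bar> < e) \<Longrightarrow> norm (?R p - ?R q) \<le> C2 * e"
    using arc_int_uniform[OF im_nz(2) c(2) ab(2)] by blast
  have "norm (?L p - ?R p) \<le> 0 + e" if e: "e > 0" for e
  proof -
    define e' where "e' = e / (C1 + C2)"
    have "C1 * e' + C2 * e' = (C1 + C2) * e'" by (simp add: distrib_right)
    then have e': "e' > 0" "C1 * e' + C2 * e' = e"
      using e C1(1) C2(1) by (simp_all add: e'_def)
    obtain q where q: "real_polynomial_function q" "\<And>z. z \<in> sphere 0 1 \<Longrightarrow> \<bar>p z - q z\<bar> < e'"
      using Stone_Weierstrass_real_polynomial_function[OF compact_sphere p e'(1)] by metis
    have cq: "continuous_on (sphere 0 1) q"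
      using q(1) by (simp add: continuous_on_polymonial_function real_polynomial_function_eq)
    have "?L q = ?R q"
      using same_moments_polynomial[OF q(1) sm] unfolding same_moments_def
      by (elim conjE allE[of _ "0::int"]) simp
    then have "?L p - ?R p = (?L p - ?L q) - (?R p - ?R q)" by simp
    also have "norm \<dots> \<le> C1 * e' + C2 * e'"
      using C1(2)[OF p cq q(2)] C2(2)[OF p cq q(2)] by (intro norm_triangle_le_diff) auto
    finally show ?thesis using e' by simp
  qed
  then have "norm (?L p - ?R p) \<le> 0"
    by (rule field_le_epsilon)
  then show ?thesis by simp
qed

text \<open>The test functions are tents around a point of the first arc that vanish on the second arc. The coordinate
\<open>T = (\<zeta> - 1) / (\<zeta> * \<tau> - cnj \<tau>)\<close> recovers \<open>t\<close> on the first arc. On the second arc it is real or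
infinite, but never between \<open>0\<close> and \<open>a\<close>. Multiplying the tent \<open>max 0 (\<rho> - |T - t|)\<close> by the modulus of the
denominator of \<open>T\<close> gives a function that is continuous on the whole circle.\<close>
lemma same_moments_imp_zero:
  assumes sm: "same_moments \<Phi> \<Psi>" and t: "t \<in> {0<..<a}"
  shows "\<Phi> t = 0"
proof -
  have c: "continuous_on {0..a} \<Phi>"
    using sm by (auto simp: same_moments_def)
  note nzd = cayley_denom_nz[OF im_nz(1)] and nzs = cayley_denom_nz[OF im_nz(2)]
  define w where "w x = norm (\<tau> - cnj \<tau>) / norm (1 - of_real x * \<tau>)" for x :: real
  have "\<Phi> t * cayley' \<tau> t * of_real (w t) = 0"
  proof (rule bump_integrals_zero_imp_zero[where a = a and s = t
        and \<eta> = "\<lambda>t. \<Phi> t * cayley' \<tau> t * of_real (w t)"])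
    show "continuous_on {0..a} (\<lambda>t. \<Phi> t * cayley' \<tau> t * of_real (w t))"
      unfolding w_def using nzd by (intro continuous_intros c arc_intros) auto
    fix \<rho> :: real assume \<rho>: "0 < \<rho>" "\<rho> \<le> t" "\<rho> \<le> a - t"
    define p where "p \<zeta> = max 0 (\<rho> * norm (\<zeta> * \<tau> - cnj \<tau>) - norm ((\<zeta> - 1) - of_real t * (\<zeta> * \<tau> - cnj \<tau>)))" for \<zeta>
    have contp: "continuous_on (sphere 0 1) p"
      unfolding p_def by (intro continuous_intros)
    have p\<tau>: "p (cayley \<tau> x) = w x * max 0 (\<rho> - \<bar>x - t\<bar>)" for x
    proof -
      have 1: "cayley \<tau> x * \<tau> - cnj \<tau> = (\<tau> - cnj \<tau>) / (1 - of_real x * \<tau>)"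
        using nzd[of x] by (simp add: cayley_def field_simps)
      have "(cayley \<tau> x - 1) - of_real t * ((\<tau> - cnj \<tau>) / (1 - of_real x * \<tau>))
          = of_real (x - t) * ((\<tau> - cnj \<tau>) / (1 - of_real x * \<tau>))"
      proof -
        have "cayley \<tau> x - 1 = of_real x * ((\<tau> - cnj \<tau>) / (1 - of_real x * \<tau>))"
          using nzd[of x] by (simp add: cayley_def field_simps)
        then show ?thesis by (simp only: of_real_diff left_diff_distrib)
      qed
      then have 2: "norm ((cayley \<tau> x - 1) - of_real t * (cayley \<tau> x * \<tau> - cnj \<tau>)) = \<bar>x - t\<bar> * w x"
        unfolding 1 by (simp only: norm_mult norm_of_real norm_divide w_def)
      have "w x \<ge> 0" by (simp add: w_def)
      then show ?thesis
        unfolding p_def 2 unfolding 1 norm_divide w_def[symmetric]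
        by (simp add: max_mult_distrib_left right_diff_distrib mult.commute)
    qed
    have p\<sigma>: "p (cayley \<sigma> s) = 0" if s: "s \<in> {0..b}" for s
    proof -
      define x y where "x = Im \<tau>" and "y = Im \<sigma>"
      define m where "m = Im (\<sigma> * cnj \<tau>)"
      have xy: "x * y < 0" using opp by (simp add: x_def y_def)
      have 1: "cayley \<sigma> s - 1 = 2 * \<i> * of_real (s * y) / (1 - of_real s * \<sigma>)" for s
      proof -
        have "cayley \<sigma> s - 1 = of_real s * (\<sigma> - cnj \<sigma>) / (1 - of_real s * \<sigma>)"
          using nzs[of s] by (simp add: cayley_def field_simps)
        also have "of_real s * (\<sigma> - cnj \<sigma>) = 2 * \<i> * of_real (s * y)"
          by (simp add: complex_eq_iff y_def)
        finally show ?thesis .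
      qed
      have 2: "cayley \<sigma> s * \<tau> - cnj \<tau> = 2 * \<i> * of_real (x + s * m) / (1 - of_real s * \<sigma>)" for s
      proof -
        have "cayley \<sigma> s * \<tau> - cnj \<tau> = ((1 - of_real s * cnj \<sigma>) * \<tau> - cnj \<tau> * (1 - of_real s * \<sigma>)) / (1 - of_real s * \<sigma>)"
          using nzs[of s] by (simp add: cayley_def field_simps)
        also have "(1 - of_real s * cnj \<sigma>) * \<tau> - cnj \<tau> * (1 - of_real s * \<sigma>) = 2 * \<i> * of_real (x + s * m)"
          by (simp add: complex_eq_iff x_def m_def algebra_simps)
        finally show ?thesis .
      qed
      have "cayley \<tau> a * \<tau> - cnj \<tau> = (\<tau> - cnj \<tau>) / (1 - of_real a * \<tau>)"
        "cayley \<tau> a - 1 = of_real a * ((\<tau> - cnj \<tau>) / (1 - of_real a * \<tau>))"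
        using nzd[of a] by (simp_all add: cayley_def field_simps)
      then have "cayley \<sigma> b - 1 = of_real a * (cayley \<sigma> b * \<tau> - cnj \<tau>)"
        using ends by simp
      then have "2 * \<i> * of_real (b * y) = 2 * \<i> * of_real (a * (x + b * m))"
        unfolding 1 2 using nzs[of b] by (simp add: field_simps)
      then have "b * y = a * (x + b * m)"
        by (simp only: mult_cancel_left of_real_eq_iff) simp
      \<comment> \<open>so numerator and denominator of \<open>T\<close> are combinations of \<open>x\<close> and \<open>y\<close> with opposite signs\<close>
      then have m: "m = y / a - x / b"
        using ab by (simp add: field_simps)
      have D: "x + s * m = x * (1 - s / b) + s * (y / a)"
        by (simp add: m algebra_simps)
      have E: "s * y - t * (x + s * m) = s * y * (1 - t / a) - t * x * (1 - s / b)"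
        by (simp add: m algebra_simps)
      have sb: "0 \<le> 1 - s / b" "0 \<le> s" and ta: "0 \<le> t / a" "\<rho> / a \<le> 1 - t / a" "0 \<le> 1 - t/a" "0 < t"
        using s ab t \<rho> by (auto simp: field_simps)
      have "\<rho> * \<bar>x + s * m\<bar> \<le> \<rho> * (\<bar>x\<bar> * (1 - s / b) + s * (\<bar>y\<bar> / a))"
      proof -
        have "\<bar>x + s * m\<bar> \<le> \<bar>x * (1 - s / b)\<bar> + \<bar>s * (y / a)\<bar>" unfolding D by (rule abs_triangle_ineq)
        also have "\<dots> = \<bar>x\<bar> * (1 - s / b) + s * (\<bar>y\<bar> / a)"
          using sb ab by (simp add: abs_mult)
        finally show ?thesis using \<rho> by simp
      qed
      also have "\<dots> = \<rho> * (\<bar>x\<bar> * (1 - s / b)) + (s * \<bar>y\<bar>) * (\<rho> / a)"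
        by (simp add: algebra_simps)
      also have "\<dots> \<le> t * (\<bar>x\<bar> * (1 - s / b)) + (s * \<bar>y\<bar>) * (1 - t / a)"
        using \<rho> sb ta by (intro add_mono mult_right_mono mult_left_mono) auto
      also have "\<dots> = \<bar>s * y - t * (x + s * m)\<bar>"
      proof -
        have nn: "0 \<le> t * (\<bar>x\<bar> * (1 - s / b)) + (s * \<bar>y\<bar>) * (1 - t / a)"
          using sb ta by (intro add_nonneg_nonneg mult_nonneg_nonneg) auto
        have "x > 0 \<and> y < 0 \<or> x < 0 \<and> y > 0" using xy by (auto simp: mult_less_0_iff)
        then have "\<bar>s * y * (1 - t / a) - t * x * (1 - s / b)\<bar> = \<bar>t * (\<bar>x\<bar> * (1 - s / b)) + (s * \<bar>y\<bar>) * (1 - t / a)\<bar>"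
        proof
          assume "x > 0 \<and> y < 0"
          then have "s * y * (1 - t / a) - t * x * (1 - s / b) = - (t * (\<bar>x\<bar> * (1 - s / b)) + (s * \<bar>y\<bar>) * (1 - t / a))"
            by simp
          then show ?thesis by (simp only: abs_minus_cancel)
        next
          assume "x < 0 \<and> y > 0"
          then have "s * y * (1 - t / a) - t * x * (1 - s / b) = t * (\<bar>x\<bar> * (1 - s / b)) + (s * \<bar>y\<bar>) * (1 - t / a)"
            by simp
          then show ?thesis by (simp only:)
        qed
        then show ?thesis unfolding E using nn by (simp only: abs_of_nonneg)
      qed
      finally have "\<rho> * \<bar>x + s * m\<bar> \<le> \<bar>s * y - t * (x + s * m)\<bar>" .
      then have "\<rho> * (2 * \<bar>x + s * m\<bar> / norm (1 - of_real s * \<sigma>)) \<le> 2 * \<bar>s * y - t * (x + s * m)\<bar> / norm (1 - of_real s * \<sigma>)"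
        by (simp add: divide_right_mono)
      moreover have "norm (cayley \<sigma> s * \<tau> - cnj \<tau>) = 2 * \<bar>x + s * m\<bar> / norm (1 - of_real s * \<sigma>)"
        unfolding 2 by (simp only: norm_mult norm_divide norm_of_real) simp
      moreover have "norm (cayley \<sigma> s - 1 - of_real t * (cayley \<sigma> s * \<tau> - cnj \<tau>)) = 2 * \<bar>s * y - t * (x + s * m)\<bar> / norm (1 - of_real s * \<sigma>)"
      proof -
        have "cayley \<sigma> s - 1 - of_real t * (cayley \<sigma> s * \<tau> - cnj \<tau>) = 2 * \<i> * of_real (s * y - t * (x + s * m)) / (1 - of_real s * \<sigma>)"
        proof -
          have "k * X / u - c * (k * Y / u) = k * (X - c * Y) / u" for k X Y u c :: complex
            by (simp add: diff_divide_distrib right_diff_distrib mult_ac)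
          then show ?thesis unfolding 1 2 of_real_diff of_real_mult[of t] .
        qed
        then show ?thesis by (simp only: norm_mult norm_divide norm_of_real) simp
      qed
      ultimately show ?thesis unfolding p_def by simp
    qed
    have "arc_int \<sigma> b (\<lambda>s. of_real (p (cayley \<sigma> s)) * \<Psi> s) = integral {0..b} (\<lambda>s. 0)"
      unfolding arc_int_def using p\<sigma> by (intro Henstock_Kurzweil_Integration.integral_cong) auto
    then have "arc_int \<tau> a (\<lambda>t. of_real (p (cayley \<tau> t)) * \<Phi> t) = 0"
      using same_moments_continuous[OF sm contp] by simp
    then show "integral {0..a} (\<lambda>x. \<Phi> x * cayley' \<tau> x * of_real (w x) * of_real (max 0 (\<rho> - \<bar>x - t\<bar>))) = 0"
      unfolding p\<tau> arc_int_def by (simp add: mult_ac)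
  qed (use t in auto)
  moreover have "cayley' \<tau> t \<noteq> 0" "w t \<noteq> 0"
  proof -
    have "\<tau> - cnj \<tau> \<noteq> 0" using im_nz(1) by (auto simp: complex_eq_iff)
    then show "cayley' \<tau> t \<noteq> 0" "w t \<noteq> 0" using nzd[of t] by (auto simp: cayley'_def w_def)
  qed
  ultimately show ?thesis by simp
qed


text \<open>A power of \<open>\<zeta>\<close> has a primitive, and contributions from the common ends cancel, unless the exponent is \<open>-1\<close>.
In that case both arcs turn around the origin and their contributions add up.\<close>
lemma arc_int_powi_diff:
  obtains N where "N \<noteq> 0" and "\<And>k. arc_int \<tau> a (\<lambda>t. cayley \<tau> t powi k) - arc_int \<sigma> b (\<lambda>s. cayley \<sigma> s powi k)
      = (if k = -1 then N else 0)"
proof -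
  obtain P where P: "P > 0" "arc_int \<tau> a (\<lambda>t. cayley \<tau> t powi (-1)) = 2 * \<i> * of_real (Im \<tau> * P)"
    unfolding arc_int_def using cayley_log_integral[OF im_nz(1) ab(1)] by blast
  obtain Q where Q: "Q > 0" "arc_int \<sigma> b (\<lambda>t. cayley \<sigma> t powi (-1)) = 2 * \<i> * of_real (Im \<sigma> * Q)"
    unfolding arc_int_def using cayley_log_integral[OF im_nz(2) ab(2)] by blast
  define N where "N = 2 * \<i> * of_real (Im \<tau> * P - Im \<sigma> * Q)"
  have "(Im \<tau> * P) * (Im \<sigma> * Q) < 0"
    using mult_neg_pos[OF opp mult_pos_pos[OF P(1) Q(1)]] by (simp add: mult_ac)
  then have "Im \<tau> * P \<noteq> Im \<sigma> * Q"
    by (metis not_square_less_zero)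
  then have "N \<noteq> 0" unfolding N_def
    by (simp del: of_real_diff of_real_mult)
  moreover have "arc_int \<tau> a (\<lambda>t. cayley \<tau> t powi k) - arc_int \<sigma> b (\<lambda>s. cayley \<sigma> s powi k)
      = (if k = -1 then N else 0)" for k
  proof (cases "k = -1")
    case True
    then show ?thesis using P(2) Q(2) by (simp add: N_def algebra_simps)
  next
    case False
    then show ?thesis
      unfolding arc_int_def
      using cayley_powi_integral[OF im_nz(1) False] cayley_powi_integral[OF im_nz(2) False] ab ends by simp
  qed
  ultimately show thesis by (rule that)
qed

text \<open>After division by \<open>(1 - t\<tau>)^n\<close> the hypothesis says that the Fourier coefficients outside \<open>0..n\<close> vanish.
Subtracting the trigonometric polynomial formed with the remaining ones leaves a pair with equal moments, which is
zero. Multiplied by \<open>(1 - t\<tau>)^n\<close>, that trigonometric polynomial becomes a polynomial in \<open>t\<close>.\<close>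
lemma moments_imp_polynomial:
  assumes c: "continuous_on {0..a} \<phi>" "continuous_on {0..b} \<psi>"
    and mom: "\<And>k::int. 0 \<le> k \<or> k \<le> - int n - 2 \<Longrightarrow>
      integral {0..a} (\<lambda>t. \<phi> t * cayley \<tau> t powi k / (1 - of_real t * \<tau>) ^ (n + 2))
      = integral {0..b} (\<lambda>s. \<psi> s * cayley \<sigma> s powi k / (1 - of_real s * \<sigma>) ^ (n + 2))"
  shows "\<exists>p::complex poly. degree p \<le> n \<and> (\<forall>t\<in>{0..a}. \<phi> t = poly p (of_real t))"
proof -
  note nz\<tau> = cayley_denom_nz[OF im_nz(1)] and nz\<sigma> = cayley_denom_nz[OF im_nz(2)]
  have d\<tau>: "\<tau> - cnj \<tau> \<noteq> 0" and d\<sigma>: "\<sigma> - cnj \<sigma> \<noteq> 0"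
    using im_nz by (auto simp: complex_eq_iff)
  define \<Phi> where "\<Phi> t = \<phi> t / ((\<tau> - cnj \<tau>) * (1 - of_real t * \<tau>) ^ n)" for t
  define \<Psi> where "\<Psi> s = \<psi> s / ((\<sigma> - cnj \<sigma>) * (1 - of_real s * \<sigma>) ^ n)" for s
  have c\<Phi>: "continuous_on {0..a} \<Phi>" and c\<Psi>: "continuous_on {0..b} \<Psi>"
    unfolding \<Phi>_def \<Psi>_def using nz\<tau> nz\<sigma> d\<tau> d\<sigma> by (auto intro!: continuous_intros c)
  have quot: "x / (d * u ^ n) * y * (d / u ^ 2) = x * y / u ^ (n + 2)" if "d \<noteq> 0" for x y u d :: complex
    using that by (simp add: power_add power2_eq_square)
  define m where "m \<kappa> A F k = arc_int \<kappa> A (\<lambda>t. F t * cayley \<kappa> t powi k)" for \<kappa> A F k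
  have mom': "m \<tau> a \<Phi> k = m \<sigma> b \<Psi> k" if "0 \<le> k \<or> k \<le> - int n - 2" for k
    using mom[OF that] unfolding m_def arc_int_def \<Phi>_def \<Psi>_def cayley'_def quot[OF d\<tau>] quot[OF d\<sigma>] .
  obtain N where N: "N \<noteq> 0" and Nk: "\<And>k. arc_int \<tau> a (\<lambda>t. cayley \<tau> t powi k)
      - arc_int \<sigma> b (\<lambda>s. cayley \<sigma> s powi k) = (if k = -1 then N else 0)"
    using arc_int_powi_diff by blast
  define C where "C j = (m \<tau> a \<Phi> (- int j - 1) - m \<sigma> b \<Psi> (- int j - 1)) / N" for j :: nat
  have split: "m \<kappa> A (\<lambda>t. F t - (\<Sum>j\<le>n. C j * cayley \<kappa> t powi int j)) k
      = m \<kappa> A F k - (\<Sum>j\<le>n. C j * arc_int \<kappa> A (\<lambda>t. cayley \<kappa> t powi (int j + k)))"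
    if k: "Im \<kappa> \<noteq> 0" and F: "continuous_on {0..A} F" for \<kappa> A F k
  proof -
    have "m \<kappa> A (\<lambda>t. F t - (\<Sum>j\<le>n. C j * cayley \<kappa> t powi int j)) k
       = arc_int \<kappa> A (\<lambda>t. F t * cayley \<kappa> t powi k - (\<Sum>j\<le>n. C j * cayley \<kappa> t powi (int j + k)))"
      unfolding m_def using cayley_nz[OF k]
      by (simp add: power_int_add left_diff_distrib sum_distrib_right mult.assoc)
    also have "\<dots> = m \<kappa> A F k - arc_int \<kappa> A (\<lambda>t. \<Sum>j\<le>n. C j * cayley \<kappa> t powi (int j + k))"
      unfolding m_def by (intro arc_int_diff continuous_intros k F)
    also have "arc_int \<kappa> A (\<lambda>t. \<Sum>j\<le>n. C j * cayley \<kappa> t powi (int j + k))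
       = (\<Sum>j\<le>n. C j * arc_int \<kappa> A (\<lambda>t. cayley \<kappa> t powi (int j + k)))"
      by (subst arc_int_sum[OF k]) (auto intro!: continuous_intros k simp: arc_int_cmult)
    finally show ?thesis .
  qed
  have "m \<tau> a \<Phi> k - m \<sigma> b \<Psi> k = (\<Sum>j\<le>n. C j * (if int j + k = -1 then N else 0))" for k
  proof (cases "0 \<le> k \<or> k \<le> - int n - 2")
    case True
    then have "(\<Sum>j\<le>n. C j * (if int j + k = -1 then N else 0)) = 0"
      by (intro sum.neutral) auto
    then show ?thesis using mom'[OF True] by simp
  next
    case False
    define i where "i = nat (- k - 1)"
    have i: "k = - int i - 1" "i \<le> n" using False by (auto simp: i_def)
    have "(\<Sum>j\<le>n. C j * (if int j + k = -1 then N else 0)) = (\<Sum>j\<le>n. if j = i then C i * N else 0)"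
      using i(1) by (intro sum.cong) auto
    also have "\<dots> = C i * N" using i(2) by simp
    finally show ?thesis using N i(1) by (simp add: C_def)
  qed
  note diff = this[folded Nk, unfolded right_diff_distrib sum_subtractf]
  have swap: "x - y = u - v \<Longrightarrow> x - u = y - v" for x y u v :: complex
    by (simp add: algebra_simps)
  have "m \<tau> a (\<lambda>t. \<Phi> t - (\<Sum>j\<le>n. C j * cayley \<tau> t powi int j)) k
      = m \<sigma> b (\<lambda>t. \<Psi> t - (\<Sum>j\<le>n. C j * cayley \<sigma> t powi int j)) k" for k
    unfolding split[OF im_nz(1) c\<Phi>] split[OF im_nz(2) c\<Psi>] by (rule swap[OF diff])
  then have "same_moments (\<lambda>t. \<Phi> t - (\<Sum>j\<le>n. C j * cayley \<tau> t powi int j)) (\<lambda>t. \<Psi> t - (\<Sum>j\<le>n. C j * cayley \<sigma> t powi int j))"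
    unfolding same_moments_def m_def[symmetric]
    using c\<Phi> c\<Psi> by (intro conjI allI continuous_intros arc_intros) auto
  from same_moments_imp_zero[OF this]
  have \<Phi>: "\<Phi> t = (\<Sum>j\<le>n. C j * cayley \<tau> t powi int j)" if "t \<in> {0<..<a}" for t
    using that by simp
  define p where "p = (\<Sum>j\<le>n. smult ((\<tau> - cnj \<tau>) * C j) ([:1, - cnj \<tau>:] ^ j * [:1, - \<tau>:] ^ (n - j)))"
  have "degree ([:1, - cnj \<tau>:] ^ j * [:1, - \<tau>:] ^ (n - j)) \<le> n" if "j \<le> n" for j
  proof -
    have "degree ([:1, - cnj \<tau>:] ^ j * [:1, - \<tau>:] ^ (n - j)) \<le> degree ([:1, - cnj \<tau>:] ^ j) + degree ([:1, - \<tau>:] ^ (n - j))"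
      by (rule degree_mult_le)
    also have "\<dots> \<le> 1 * j + 1 * (n - j)"
      by (intro add_mono order_trans[OF degree_power_le] mult_right_mono) auto
    finally show ?thesis using that by simp
  qed
  then have "degree p \<le> n"
    unfolding p_def by (intro degree_sum_le) (auto intro: order_trans[OF degree_smult_le])
  moreover have "\<phi> t - poly p (of_real t) = 0" if "t \<in> {0<..<a}" for t
  proof -
    let ?u = "1 - of_real t * \<tau>"
    have "\<phi> t = (\<tau> - cnj \<tau>) * ?u ^ n * \<Phi> t"
      using nz\<tau>[of t] d\<tau> by (simp add: \<Phi>_def)
    also have "\<dots> = (\<Sum>j\<le>n. (\<tau> - cnj \<tau>) * C j * (?u ^ n * cayley \<tau> t ^ j))"
      unfolding \<Phi>[OF that] sum_distrib_left by (intro sum.cong) (auto simp: mult_ac)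
    also have "\<dots> = poly p (of_real t)"
    proof -
      have "?u ^ n * cayley \<tau> t ^ j = (1 - of_real t * cnj \<tau>) ^ j * ?u ^ (n - j)" if "j \<le> n" for j
      proof -
        have "?u ^ n = ?u ^ j * ?u ^ (n - j)" using that by (simp add: power_add[symmetric])
        then show ?thesis using nz\<tau>[of t] by (simp add: cayley_def power_divide)
      qed
      then show ?thesis unfolding p_def poly_sum by (intro sum.cong) auto
    qed
    finally show ?thesis by simp
  qed
  then have "\<phi> t - poly p (of_real t) = 0" if "t \<in> {0..a}" for t
    using that ab c
    by (intro continuous_constant_on_closure[of "{0<..<a}" "\<lambda>t. \<phi> t - poly p (of_real t)" 0 t])
       (auto intro!: continuous_intros)
  ultimately show ?thesis by (intro exI[of _ p]) auto
qed

end

section \<open>Extension from circles and polyanalytic functions\<close>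

definition extends_disc :: "nat \<Rightarrow> (complex \<Rightarrow> complex) \<Rightarrow> complex \<Rightarrow> real \<Rightarrow> bool" where
  "extends_disc n f c r \<longleftrightarrow> r > 0 \<and>
    (\<exists>F. continuous_on (cball c r) F \<and> F holomorphic_on ball c r \<and> (\<forall>z\<in>sphere c r. F z = (z - c) ^ n * f z))"

lemma sphere_radius_unique:
  fixes c :: complex
  assumes "r > 0" "s > 0" "sphere c r = sphere c s"
  shows "r = s"
proof -
  have "c + of_real r \<in> sphere c r" using assms(1) by (simp add: dist_norm)
  then show ?thesis using assms by (simp add: dist_norm)
qed

lemma extends_from_sphere_iff:
  assumes "r > 0"
  shows "extends_holomorphically_from (sphere c r) (\<lambda>z. (z - circle_center (sphere c r)) ^ n * f z)
     \<longleftrightarrow> extends_disc n f c r"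
proof
  assume "extends_holomorphically_from (sphere c r) (\<lambda>z. (z - circle_center (sphere c r)) ^ n * f z)"
  then obtain c' r' F where *: "r' > 0" "sphere c r = sphere c' r'" "continuous_on (cball c' r') F"
    "F holomorphic_on ball c' r'" "\<forall>z\<in>sphere c r. F z = (z - circle_center (sphere c r)) ^ n * f z"
    unfolding extends_holomorphically_from_def by blast
  have "c = c'" using sphere_eq_imp_center_eq[OF assms *(1,2)] .
  moreover have "r = r'" using sphere_radius_unique[OF assms *(1)] *(2) \<open>c = c'\<close> by blast
  ultimately show "extends_disc n f c r"
    using * circle_center_sphere[OF assms] unfolding extends_disc_def by auto
next
  assume "extends_disc n f c r"
  then show "extends_holomorphically_from (sphere c r) (\<lambda>z. (z - circle_center (sphere c r)) ^ n * f z)"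
    unfolding extends_holomorphically_from_def extends_disc_def circle_center_sphere[OF assms] by blast
qed

lemma max_modulus_disc:
  assumes "continuous_on (cball 0 1) H" "H holomorphic_on ball 0 1"
    and "\<And>z. z \<in> sphere 0 1 \<Longrightarrow> norm (H z) \<le> B" and "z \<in> cball 0 1"
  shows "norm (H z) \<le> B"
  by (rule maximum_modulus_frontier[of H "cball 0 1"]) (use assms in auto)

text \<open>By the maximum principle a sequence that is uniformly Cauchy on the circle is so on the disc.\<close>
lemma disc_algebra_limit:
  assumes H: "\<And>j. continuous_on (cball 0 1) (H j)" "\<And>j. H j holomorphic_on ball 0 1"
    and lim: "uniform_limit (sphere 0 1) H g sequentially"
  obtains L where "continuous_on (cball 0 1) L" "L holomorphic_on ball 0 1" "\<And>z. z \<in> sphere 0 1 \<Longrightarrow> L z = g z"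
proof -
  have "uniformly_Cauchy_on (cball 0 1) H"
    unfolding uniformly_Cauchy_on_def
  proof (intro allI impI)
    fix e :: real assume e: "e > 0"
    have "uniformly_Cauchy_on (sphere 0 1) H"
      using lim by (auto simp: uniformly_convergent_on_def intro!: uniformly_convergent_Cauchy)
    then obtain N where N: "\<And>x m n. x \<in> sphere 0 1 \<Longrightarrow> m \<ge> N \<Longrightarrow> n \<ge> N \<Longrightarrow> dist (H m x) (H n x) < e/2"
      unfolding uniformly_Cauchy_on_def using half_gt_zero[OF e] by meson
    have "dist (H m x) (H n x) < e" if "x \<in> cball 0 1" "m \<ge> N" "n \<ge> N" for x m n
    proof -
      have "norm (H m x - H n x) \<le> e/2"
      proof (rule max_modulus_disc[where H = "\<lambda>x. H m x - H n x"])
        show "norm (H m z - H n z) \<le> e/2" if "z \<in> sphere 0 1" for z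
          using N[OF that \<open>m \<ge> N\<close> \<open>n \<ge> N\<close>] by (simp add: dist_norm)
      qed (use that H in \<open>auto intro!: continuous_intros holomorphic_intros\<close>)
      then show ?thesis using e by (simp add: dist_norm)
    qed
    then show "\<exists>M. \<forall>x\<in>cball 0 1. \<forall>m\<ge>M. \<forall>n\<ge>M. dist (H m x) (H n x) < e" by blast
  qed
  then obtain L where L: "uniform_limit (cball 0 1) H L sequentially"
    using Cauchy_uniformly_convergent uniformly_convergent_on_def by metis
  have 1: "continuous_on (cball 0 1) L \<and> L holomorphic_on ball 0 1"
    by (rule holomorphic_uniform_limit[OF _ L]) (use H in auto)
  have 2: "L z = g z" if "z \<in> sphere 0 1" for z
    using tendsto_uniform_limitI[OF L, of z] tendsto_uniform_limitI[OF lim that] that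
    by (intro LIMSEQ_unique[of "\<lambda>n. H n z"]) auto
  show thesis using that 1 2 by blast
qed

text \<open>The function \<open>(z - c)^n f(z)\<close> on the circle \<open>p = (c, r)\<close>, moved to the unit circle. This makes the
boundary values on different circles comparable.\<close>
definition circle_values :: "nat \<Rightarrow> (complex \<Rightarrow> complex) \<Rightarrow> complex \<times> real \<Rightarrow> complex \<Rightarrow> complex" where
  "circle_values n f p \<zeta> = (of_real (snd p) * \<zeta>) ^ n * f (fst p + of_real (snd p) * \<zeta>)"

definition circles_in_disc :: "(complex \<times> real) set" where
  "circles_in_disc = {p. 0 < snd p \<and> norm (fst p) + snd p \<le> 1}"

lemma circle_point_in_disc:
  assumes "p \<in> circles_in_disc" "norm \<zeta> \<le> 1"
  shows "norm (fst p + of_real (snd p) * \<zeta>) \<le> 1"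
proof -
  have "norm (fst p + of_real (snd p) * \<zeta>) \<le> norm (fst p) + \<bar>snd p\<bar> * norm \<zeta>"
    by (metis norm_mult norm_of_real norm_triangle_ineq)
  also have "\<dots> \<le> norm (fst p) + snd p * 1"
    using assms by (intro add_left_mono mult_mono) (auto simp: circles_in_disc_def)
  finally show ?thesis using assms by (simp add: circles_in_disc_def)
qed

lemma circle_values_nearby:
  assumes f: "continuous_on (cball 0 1) f" and p: "p \<in> circles_in_disc" and e: "e > 0"
  obtains X where "open X" "p \<in> X"
    "\<And>q \<zeta>. q \<in> X \<Longrightarrow> q \<in> circles_in_disc \<Longrightarrow> \<zeta> \<in> sphere 0 1 \<Longrightarrow> dist (circle_values n f q \<zeta>) (circle_values n f p \<zeta>) \<le> e"
proof -
  have c: "continuous_on (circles_in_disc \<times> sphere 0 1) (\<lambda>x. circle_values n f (fst x) (snd x))"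
    unfolding circle_values_def
    by (intro continuous_intros continuous_on_compose2[OF f]) (use circle_point_in_disc in force)
  obtain X where "p \<in> X" "open X"
    "\<forall>x\<in>X \<inter> circles_in_disc. \<forall>t\<in>sphere 0 1. dist (circle_values n f x t) (circle_values n f p t) \<le> e"
    using continuous_on_prod_compactE[OF c compact_sphere p e] by auto
  then show thesis using that by blast
qed

lemma extends_disc_normalized:
  assumes "r > 0"
  shows "extends_disc n f c r \<longleftrightarrow> (\<exists>H. continuous_on (cball 0 1) H \<and> H holomorphic_on ball 0 1 \<and>
      (\<forall>\<zeta>\<in>sphere 0 1. H \<zeta> = circle_values n f (c, r) \<zeta>))"
proof
  assume "extends_disc n f c r"
  then obtain F where F: "continuous_on (cball c r) F" "F holomorphic_on ball c r"
    "\<And>z. z\<in>sphere c r \<Longrightarrow> F z = (z - c) ^ n * f z"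
    unfolding extends_disc_def by blast
  have im: "c + of_real r * \<zeta> \<in> cball c r" if "\<zeta> \<in> cball 0 1" for \<zeta>
    using that assms by (simp add: dist_norm norm_mult)
  have im': "c + of_real r * \<zeta> \<in> ball c r" if "\<zeta> \<in> ball 0 1" for \<zeta>
    using that assms by (simp add: dist_norm norm_mult)
  show "\<exists>H. continuous_on (cball 0 1) H \<and> H holomorphic_on ball 0 1 \<and>
      (\<forall>\<zeta>\<in>sphere 0 1. H \<zeta> = circle_values n f (c, r) \<zeta>)"
  proof (intro exI[of _ "\<lambda>\<zeta>. F (c + of_real r * \<zeta>)"] conjI ballI)
    show "continuous_on (cball 0 1) (\<lambda>\<zeta>. F (c + of_real r * \<zeta>))"
      by (intro continuous_on_compose2[OF F(1)] continuous_intros) (use im in auto)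
    have "(F \<circ> (\<lambda>\<zeta>. c + of_real r * \<zeta>)) holomorphic_on ball 0 1"
      by (rule holomorphic_on_compose_gen[OF _ F(2)]) (use im' in \<open>auto intro!: holomorphic_intros\<close>)
    then show "(\<lambda>\<zeta>. F (c + of_real r * \<zeta>)) holomorphic_on ball 0 1" by (simp add: o_def)
    fix \<zeta> :: complex assume "\<zeta> \<in> sphere 0 1"
    then have "c + of_real r * \<zeta> \<in> sphere c r" using assms by (simp add: dist_norm norm_mult)
    from F(3)[OF this] show "F (c + of_real r * \<zeta>) = circle_values n f (c, r) \<zeta>" by (simp add: circle_values_def)
  qed
next
  assume "\<exists>H. continuous_on (cball 0 1) H \<and> H holomorphic_on ball 0 1 \<and>
      (\<forall>\<zeta>\<in>sphere 0 1. H \<zeta> = circle_values n f (c, r) \<zeta>)"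
  then obtain H where H: "continuous_on (cball 0 1) H" "H holomorphic_on ball 0 1"
      "\<And>\<zeta>. \<zeta>\<in>sphere 0 1 \<Longrightarrow> H \<zeta> = circle_values n f (c, r) \<zeta>" by blast
  have r: "of_real r \<noteq> (0::complex)" using assms by simp
  have im: "(z - c) / of_real r \<in> cball 0 1" if "z \<in> cball c r" for z
    using that assms by (simp add: dist_norm norm_divide norm_minus_commute)
  have im': "(z - c) / of_real r \<in> ball 0 1" if "z \<in> ball c r" for z
    using that assms by (simp add: dist_norm norm_divide norm_minus_commute)
  show "extends_disc n f c r"
    unfolding extends_disc_def
  proof (intro exI[of _ "\<lambda>z. H ((z - c) / of_real r)"] conjI ballI assms)
    show "continuous_on (cball c r) (\<lambda>z. H ((z - c) / of_real r))"
      by (intro continuous_on_compose2[OF H(1)] continuous_intros) (use im r in auto)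
    have "(H \<circ> (\<lambda>z. (z - c) / of_real r)) holomorphic_on ball c r"
      by (rule holomorphic_on_compose_gen[OF _ H(2)]) (use im' r in \<open>auto intro!: holomorphic_intros\<close>)
    then show "(\<lambda>z. H ((z - c) / of_real r)) holomorphic_on ball c r" by (simp add: o_def)
    fix z assume "z \<in> sphere c r"
    then have "(z - c) / of_real r \<in> sphere 0 1" using assms by (simp add: dist_norm norm_divide norm_minus_commute)
    from H(3)[OF this] show "H ((z - c) / of_real r) = (z - c) ^ n * f z" using r by (simp add: circle_values_def)
  qed
qed

text \<open>Two uses: the unit circle is a limit of the circles with an interior hyperbolic center, and a circle touching the
unit circle is a limit of smaller concentric ones.\<close>
lemma extends_disc_limit:
  assumes f: "continuous_on (cball 0 1) f"
    and p: "\<And>j. p j \<in> circles_in_disc" "\<And>j. extends_disc n f (fst (p j)) (snd (p j))"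
    and lim: "p \<longlonglongrightarrow> q" and q: "q \<in> circles_in_disc"
  shows "extends_disc n f (fst q) (snd q)"
proof -
  have "\<exists>H. continuous_on (cball 0 1) H \<and> H holomorphic_on ball 0 1 \<and>
      (\<forall>\<zeta>\<in>sphere 0 1. H \<zeta> = circle_values n f (p j) \<zeta>)" for j
    using p(2)[of j] p(1)[of j] extends_disc_normalized[of "snd (p j)" n f "fst (p j)"]
    by (auto simp: circles_in_disc_def)
  then obtain H where H: "\<And>j. continuous_on (cball 0 1) (H j)" "\<And>j. H j holomorphic_on ball 0 1"
      "\<And>j \<zeta>. \<zeta>\<in>sphere 0 1 \<Longrightarrow> H j \<zeta> = circle_values n f (p j) \<zeta>" by metis
  have "uniform_limit (sphere 0 1) H (circle_values n f q) sequentially"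
  proof (rule uniform_limitI)
    fix e :: real assume e: "e > 0"
    obtain X where X: "open X" "q \<in> X"
      "\<And>q' \<zeta>. q' \<in> X \<Longrightarrow> q' \<in> circles_in_disc \<Longrightarrow> \<zeta> \<in> sphere 0 1 \<Longrightarrow> dist (circle_values n f q' \<zeta>) (circle_values n f q \<zeta>) \<le> e/2"
      using circle_values_nearby[OF f q, of "e/2" n] e by auto
    have "\<forall>\<^sub>F j in sequentially. p j \<in> X" using lim X topological_tendstoD by blast
    then show "\<forall>\<^sub>F j in sequentially. \<forall>\<zeta>\<in>sphere 0 1. dist (H j \<zeta>) (circle_values n f q \<zeta>) < e"
    proof eventually_elim
      case (elim j)
      show ?case using X(3)[OF elim p(1)] e H(3) by fastforce
    qed
  qed
  from disc_algebra_limit[OF H(1,2) this] obtain L where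
    "continuous_on (cball 0 1) L" "L holomorphic_on ball 0 1" "\<And>z. z \<in> sphere 0 1 \<Longrightarrow> L z = circle_values n f q z" by blast
  then show ?thesis
    using q extends_disc_normalized[of "snd q" n f "fst q"] by (auto simp: circles_in_disc_def)
qed

text \<open>For a real derivative \<open>D\<close>, the combination \<open>D 1 + \<i> * D \<i>\<close> annihilates the holomorphic factors and
differentiates in \<open>cnj z\<close>, which lowers the degree by one.\<close>
lemma polyanalytic_coeffs_unique:
  assumes "open S" and "\<And>k. k \<le> n \<Longrightarrow> c k holomorphic_on S"
    and "\<And>z. z \<in> S \<Longrightarrow> (\<Sum>k\<le>n. c k z * cnj z ^ k) = 0"
    and "k \<le> n" and "z \<in> S"
  shows "c k z = 0"
  using assms(2-)
proof (induction n arbitrary: c k z)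
  case 0
  then show ?case by simp
next
  case (Suc n)
  have step: "(\<Sum>k\<le>n. (of_nat (Suc k) * c (Suc k) z) * cnj z ^ k) = 0" if z: "z \<in> S" for z
  proof -
    define D where "D h = (\<Sum>k\<le>Suc n. c k z * (of_nat k * cnj h * cnj z ^ (k - 1)) + deriv (c k) z * h * cnj z ^ k)" for h
    have dc: "(c k has_derivative (\<lambda>h. deriv (c k) z * h)) (at z)" if "k \<le> Suc n" for k
      using holomorphic_derivI[OF Suc.prems(1)[OF that] assms(1) z] by (simp add: has_field_derivative_def)
    have cj: "(cnj has_derivative cnj) (at z)"
      by (rule bounded_linear_imp_has_derivative[OF bounded_linear_cnj])
    have "((\<lambda>w. \<Sum>k\<le>Suc n. c k w * cnj w ^ k) has_derivative D) (at z)"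
      unfolding D_def
      by (intro has_derivative_sum has_derivative_mult dc has_derivative_power cj) auto
    moreover have "((\<lambda>w. \<Sum>k\<le>Suc n. c k w * cnj w ^ k) has_derivative (\<lambda>h. 0)) (at z)"
      using Suc.prems(2) by (intro has_derivative_transform_within_open[OF has_derivative_const[of 0] assms(1) z]) auto
    ultimately have D0: "D = (\<lambda>h. 0)" by (rule has_derivative_unique)
    have "0 = D 1 + \<i> * D \<i>" by (simp add: D0)
    also have "\<dots> = (\<Sum>k\<le>Suc n. 2 * (of_nat k * c k z * cnj z ^ (k - 1)))"
      unfolding D_def sum_distrib_left sum.distrib[symmetric]
      by (intro sum.cong refl) (simp add: algebra_simps)
    also have "\<dots> = 2 * (\<Sum>k\<le>n. (of_nat (Suc k) * c (Suc k) z) * cnj z ^ k)"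
      by (subst sum.atMost_Suc_shift) (simp add: sum_distrib_left)
    finally show ?thesis by simp
  qed
  have IH: "of_nat (Suc k) * c (Suc k) z = 0" if "k \<le> n" "z \<in> S" for k z
    by (rule Suc.IH[of "\<lambda>k z. of_nat (Suc k) * c (Suc k) z"])
       (use that step Suc.prems(1) in \<open>auto intro!: holomorphic_intros\<close>)
  then have pos: "c (Suc k) z = 0" if "k \<le> n" "z \<in> S" for k z
    using that by (metis mult_eq_0_iff of_nat_eq_0_iff nat.distinct(1))
  show ?case
  proof (cases k)
    case 0
    have "(\<Sum>k\<le>Suc n. c k z * cnj z ^ k) = c 0 z"
      using pos[OF _ Suc.prems(4)] by (subst sum.atMost_Suc_shift) simp
    then show ?thesis using Suc.prems(2)[OF Suc.prems(4)] 0 by simp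
  next
    case (Suc j)
    then show ?thesis using pos[of j z] Suc.prems by simp
  qed
qed

text \<open>On the circle \<open>(z - c) * cnj z = (z - c) * cnj c + r\<^sup>2\<close>, so the factor \<open>(z - c)^n\<close> turns every power of
\<open>cnj z\<close> up to the \<open>n\<close>-th into a polynomial in \<open>z\<close>.\<close>
lemma polyanalytic_extends_inner:
  assumes a: "\<And>k. k \<le> n \<Longrightarrow> a k holomorphic_on ball 0 1"
    and f: "\<And>z. z \<in> ball 0 1 \<Longrightarrow> f z = (\<Sum>k\<le>n. a k z * cnj z ^ k)"
    and r: "r > 0" and sub: "cball c r \<subseteq> ball 0 1"
  shows "extends_disc n f c r"
proof -
  define F where "F z = (\<Sum>k\<le>n. a k z * (z - c) ^ (n - k) * ((z - c) * cnj c + of_real (r\<^sup>2)) ^ k)" for z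
  have F: "F holomorphic_on cball c r"
    unfolding F_def
    by (intro holomorphic_intros holomorphic_on_subset[OF a sub]) auto
  have "F z = (z - c) ^ n * f z" if z: "z \<in> sphere c r" for z
  proof -
    have "(z - c) * cnj (z - c) = of_real (r\<^sup>2)"
      using z complex_norm_square[of "z - c"] by (simp add: dist_norm norm_minus_commute)
    then have zc: "(z - c) * cnj c + of_real (r\<^sup>2) = (z - c) * cnj z"
      by (simp add: algebra_simps)
    have "z \<in> ball 0 1" using z sub by auto
    moreover have "(z - c) ^ n = (z - c) ^ (n - k) * (z - c) ^ k" if "k \<le> n" for k
      using that by (simp add: power_add[symmetric])
    ultimately show ?thesis
      unfolding F_def zc f[OF \<open>z \<in> ball 0 1\<close>] sum_distrib_left
      by (intro sum.cong refl) (simp add: power_mult_distrib)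
  qed
  then show ?thesis
    unfolding extends_disc_def using r F holomorphic_on_imp_continuous_on holomorphic_on_subset ball_subset_cball
    by blast
qed

lemma sphere_in_disc:
  fixes c :: complex
  assumes "r > 0" "sphere c r \<subseteq> cball 0 1"
  shows "norm c + r \<le> 1"
proof (cases "c = 0")
  case True
  then have "of_real r \<in> sphere c r" using assms(1) by simp
  then have "of_real r \<in> cball (0::complex) 1" using assms(2) True by blast
  then show ?thesis using assms(1) True by simp
next
  case False
  let ?z = "of_real (1 + r / norm c) * c"
  have "norm (c - ?z) = norm (of_real (r / norm c) * c)" by (simp add: algebra_simps norm_minus_commute)
  also have "\<dots> = r" using assms(1) False by (simp add: norm_mult norm_divide)
  finally have "?z \<in> sphere c r" by (simp add: dist_norm)
  then have "norm ?z \<le> 1" using assms(2) by auto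
  moreover have "norm ?z = norm c + r"
    unfolding norm_mult norm_of_real using assms(1) False by (simp add: field_simps)
  ultimately show ?thesis by simp
qed

lemma polyanalytic_extends:
  assumes f: "continuous_on (cball 0 1) f" and pf: "polyanalytic_on_disc n f"
    and \<Gamma>: "is_circle \<Gamma>" "\<Gamma> \<subseteq> cball 0 1"
  shows "extends_holomorphically_from \<Gamma> (\<lambda>z. (z - circle_center \<Gamma>) ^ n * f z)"
proof -
  obtain c r where r: "r > 0" and \<Gamma>eq: "\<Gamma> = sphere c r" using \<Gamma>(1) by (auto simp: is_circle_def)
  have cr: "norm c + r \<le> 1" using sphere_in_disc[OF r] \<Gamma>(2) \<Gamma>eq by simp
  obtain a where a: "\<And>k. k \<le> n \<Longrightarrow> a k holomorphic_on ball 0 1"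
     "\<And>z. z \<in> ball 0 1 \<Longrightarrow> f z = (\<Sum>k\<le>n. a k z * cnj z ^ k)"
    using pf unfolding polyanalytic_on_disc_def by blast
  \<comment> \<open>\<open>j + 2\<close> keeps the first radius positive\<close>
  define s where "s j = r * (1 - 1 / (of_nat j + 2))" for j :: nat
  have s: "0 < s j" "s j < r" for j
  proof -
    have "0 < 1 - 1 / (real j + 2)" "1 - 1 / (real j + 2) < 1" by (simp_all add: field_simps)
    then show "0 < s j" "s j < r" using r by (simp_all only: s_def mult_pos_pos mult_less_cancel_left2) auto
  qed
  have "extends_disc n f (fst (c, r)) (snd (c, r))"
  proof (rule extends_disc_limit[OF f, where p = "\<lambda>j. (c, s j)"])
    show "(c, s j) \<in> circles_in_disc" for j using s[of j] cr by (simp add: circles_in_disc_def)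
    show "extends_disc n f (fst (c, s j)) (snd (c, s j))" for j
      unfolding fst_conv snd_conv
    proof (rule polyanalytic_extends_inner[OF a])
      show "cball c (s j) \<subseteq> ball 0 1"
      proof
        fix z assume "z \<in> cball c (s j)"
        then have "norm (z - c) \<le> s j" by (simp add: dist_norm norm_minus_commute)
        then have "norm z < norm c + r" using norm_triangle_ineq2[of z c] s[of j] by linarith
        then show "z \<in> ball 0 1" using cr by simp
      qed
    qed (use s in auto)
    have "(\<lambda>j::nat. 1 / (of_nat j + 2) :: real) \<longlonglongrightarrow> 0"
      using LIMSEQ_ignore_initial_segment[OF lim_const_over_n[of "1::real"], of 2] by (simp add: add.commute)
    then have "s \<longlonglongrightarrow> r * (1 - 0)" unfolding s_def by (intro tendsto_intros)
    then show "(\<lambda>j. (c, s j)) \<longlonglongrightarrow> (c, r)" by (auto intro!: tendsto_intros)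
    show "(c, r) \<in> circles_in_disc" using r cr by (simp add: circles_in_disc_def)
  qed
  then show ?thesis using extends_from_sphere_iff[OF r] \<Gamma>eq by simp
qed

section \<open>The pencil of circles of a point\<close>

text \<open>The circle with center \<open>t\<alpha>\<close> and this radius has the equation
\<open>t |z - \<alpha>|\<^sup>2 = (1 - t)(1 - |z|\<^sup>2)\<close>. For interior \<open>\<alpha>\<close> these are the circles with hyperbolic center
\<open>\<alpha>\<close>, for \<open>|\<alpha>| = 1\<close> those touching the unit circle at \<open>\<alpha>\<close>; \<open>t = 0\<close> is the unit
circle itself.\<close>
definition pencil_radius :: "complex \<Rightarrow> real \<Rightarrow> real" where
  "pencil_radius \<alpha> t = sqrt ((1 - t) * (1 - t * (norm \<alpha>)\<^sup>2))"

text \<open>The parameter \<open>t\<close> of the circle through \<open>z\<close>.\<close>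
definition leaf :: "complex \<Rightarrow> complex \<Rightarrow> real" where
  "leaf \<alpha> z = (1 - (norm z)\<^sup>2) / (1 - (norm z)\<^sup>2 + (norm (z - \<alpha>))\<^sup>2)"

text \<open>Over \<open>z\<close>, the complexified circle \<open>(z - t\<alpha>)(w - t cnj \<alpha>) = r\<^sup>2\<close> has a single point \<open>w\<close>. In the
coordinate \<open>y = w/(1 - zw)\<close> it is \<open>y = (1/t - offset \<alpha> z) / slope \<alpha> z\<close>. For \<open>t = leaf \<alpha> z\<close>, where
\<open>w = cnj z\<close>, this is \<open>y = corner z\<close>. So for \<open>t\<close> falling from \<open>leaf \<alpha> z\<close> to \<open>0\<close>, \<open>y\<close> runs along a ray
from \<open>corner z\<close> in the direction \<open>1 / slope \<alpha> z\<close>.\<close>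
definition slope :: "complex \<Rightarrow> complex \<Rightarrow> complex" where
  "slope \<alpha> z = (z - \<alpha>) * (1 - cnj \<alpha> * z)"

definition offset :: "complex \<Rightarrow> complex \<Rightarrow> complex" where
  "offset \<alpha> z = 1 + \<alpha> * cnj \<alpha> - cnj \<alpha> * z"

definition corner :: "complex \<Rightarrow> complex" where
  "corner z = cnj z / (1 - z * cnj z)"

lemma pencil_bounds:
  assumes "norm \<alpha> \<le> 1" "0 \<le> t" "t < 1"
  shows "0 < pencil_radius \<alpha> t" and "t * norm \<alpha> + pencil_radius \<alpha> t \<le> 1"
    and "(pencil_radius \<alpha> t)\<^sup>2 = (1 - t) * (1 - t * (norm \<alpha>)\<^sup>2)"
proof -
  have a: "(norm \<alpha>)\<^sup>2 \<le> 1" using assms(1) by (simp add: power_le_one)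
  have "t * (norm \<alpha>)\<^sup>2 \<le> t * 1" using assms(2) a by (intro mult_left_mono)
  then have pos: "0 < (1 - t) * (1 - t * (norm \<alpha>)\<^sup>2)"
    using assms by (intro mult_pos_pos) auto
  then show "0 < pencil_radius \<alpha> t" and "(pencil_radius \<alpha> t)\<^sup>2 = (1 - t) * (1 - t * (norm \<alpha>)\<^sup>2)"
    by (auto simp: pencil_radius_def)
  have "t * norm \<alpha> \<le> t * 1" using assms by (intro mult_left_mono)
  moreover have "(1 - t) * (1 - t * (norm \<alpha>)\<^sup>2) \<le> (1 - t * norm \<alpha>)\<^sup>2"
  proof -
    have "0 \<le> t * (1 - norm \<alpha>)\<^sup>2" using assms by simp
    also have "\<dots> = (1 - t * norm \<alpha>)\<^sup>2 - (1 - t) * (1 - t * (norm \<alpha>)\<^sup>2)"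
      by (simp add: power2_eq_square algebra_simps)
    finally show ?thesis by simp
  qed
  ultimately have "pencil_radius \<alpha> t \<le> 1 - t * norm \<alpha>"
    unfolding pencil_radius_def using assms by (intro real_le_lsqrt) (use pos in auto)
  then show "t * norm \<alpha> + pencil_radius \<alpha> t \<le> 1" by simp
qed

lemma leaf_denom_pos:
  fixes z \<alpha> :: complex
  assumes "norm z \<le> 1" "norm z < 1 \<or> z \<noteq> \<alpha>"
  shows "0 < 1 - (norm z)\<^sup>2 + (norm (z - \<alpha>))\<^sup>2"
proof (cases "norm z < 1")
  case True
  then have "(norm z)\<^sup>2 < 1" by (simp add: power_less_one_iff)
  then show ?thesis by (simp add: add_pos_nonneg)
next
  case False
  then have "0 < (norm (z - \<alpha>))\<^sup>2" "(norm z)\<^sup>2 \<le> 1" using assms by (auto simp: power_le_one)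
  then show ?thesis by linarith
qed

lemma leaf_bounds:
  assumes "norm z \<le> 1" "z \<noteq> \<alpha>"
  shows "0 \<le> leaf \<alpha> z" and "leaf \<alpha> z < 1"
proof -
  have d: "0 < 1 - (norm z)\<^sup>2 + (norm (z - \<alpha>))\<^sup>2" using leaf_denom_pos assms by blast
  have "(norm z)\<^sup>2 \<le> 1" using assms by (simp add: power_le_one)
  then show "0 \<le> leaf \<alpha> z" using d by (simp add: leaf_def)
  show "leaf \<alpha> z < 1" unfolding leaf_def using d assms by simp
qed

lemma leaf_pos:
  assumes "norm z < 1" shows "0 < leaf \<alpha> z"
  using leaf_denom_pos[of z \<alpha>] assms by (simp add: leaf_def power_less_one_iff)

lemma leaf_self: "norm \<alpha> < 1 \<Longrightarrow> leaf \<alpha> \<alpha> = 1"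
  using leaf_denom_pos[of \<alpha> \<alpha>] by (simp add: leaf_def)

lemma leaf_circle: "norm z = 1 \<Longrightarrow> leaf \<alpha> z = 0"
  by (simp add: leaf_def)

lemma continuous_on_leaf:
  assumes "S \<subseteq> cball 0 1" "\<alpha> \<notin> S \<or> norm \<alpha> < 1"
  shows "continuous_on S (leaf \<alpha>)"
  unfolding leaf_def using leaf_denom_pos[of _ \<alpha>] assms
  by (intro continuous_intros) (fastforce simp: subset_iff)

lemma dist_center_sq:
  assumes "norm \<alpha> \<le> 1" "0 \<le> t" "t < 1"
  shows "(pencil_radius \<alpha> t)\<^sup>2 - (norm (z - of_real t * \<alpha>))\<^sup>2
     = (1 - (norm z)\<^sup>2) - t * (1 - (norm z)\<^sup>2 + (norm (z - \<alpha>))\<^sup>2)"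
  unfolding pencil_bounds(3)[OF assms] cmod_power2
  by (simp add: power2_eq_square algebra_simps)

lemma pencil_disc_subset:
  assumes "norm \<alpha> \<le> 1" "0 \<le> t" "t < 1"
  shows "cball (of_real t * \<alpha>) (pencil_radius \<alpha> t) \<subseteq> cball 0 1"
proof
  fix z assume "z \<in> cball (of_real t * \<alpha>) (pencil_radius \<alpha> t)"
  then have "norm (z - of_real t * \<alpha>) \<le> pencil_radius \<alpha> t" by (simp add: dist_norm norm_minus_commute)
  then have "norm z \<le> norm (of_real t * \<alpha>) + pencil_radius \<alpha> t"
    using norm_triangle_ineq2[of z "of_real t * \<alpha>"] by linarith
  also have "\<dots> \<le> 1" using pencil_bounds(2)[OF assms] assms by (simp add: norm_mult)
  finally show "z \<in> cball 0 1" by simp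
qed

lemma in_pencil_disc_iff:
  assumes "norm \<alpha> \<le> 1" "0 \<le> t" "t < 1" "norm z \<le> 1" "norm z < 1 \<or> z \<noteq> \<alpha>"
  shows "z \<in> cball (of_real t * \<alpha>) (pencil_radius \<alpha> t) \<longleftrightarrow> t \<le> leaf \<alpha> z"
    and "z \<in> ball (of_real t * \<alpha>) (pencil_radius \<alpha> t) \<longleftrightarrow> t < leaf \<alpha> z"
    and "z \<in> sphere (of_real t * \<alpha>) (pencil_radius \<alpha> t) \<longleftrightarrow> t = leaf \<alpha> z"
proof -
  have r: "0 < pencil_radius \<alpha> t" using pencil_bounds assms by blast
  have d: "0 < 1 - (norm z)\<^sup>2 + (norm (z - \<alpha>))\<^sup>2" using leaf_denom_pos assms by blast
  let ?a = "norm (z - of_real t * \<alpha>)" and ?r = "pencil_radius \<alpha> t"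
  note eq = dist_center_sq[OF assms(1-3), of z]
  have le: "x \<le> y \<longleftrightarrow> x\<^sup>2 \<le> y\<^sup>2" if "0 \<le> x" "0 \<le> y" for x y :: real
    using that power_mono_iff[of x y 2] by simp
  have sq: "?a \<le> ?r \<longleftrightarrow> ?a\<^sup>2 \<le> ?r\<^sup>2" "?a < ?r \<longleftrightarrow> ?a\<^sup>2 < ?r\<^sup>2" "?a = ?r \<longleftrightarrow> ?a\<^sup>2 = ?r\<^sup>2"
    using le[of ?a ?r] le[of ?r ?a] r by (auto simp: not_le[symmetric] simp del: power2_less_eq_zero_iff)
  have e1: "?a\<^sup>2 \<le> ?r\<^sup>2 \<longleftrightarrow> t * (1 - (norm z)\<^sup>2 + (norm (z - \<alpha>))\<^sup>2) \<le> 1 - (norm z)\<^sup>2"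
    and e2: "?a\<^sup>2 < ?r\<^sup>2 \<longleftrightarrow> t * (1 - (norm z)\<^sup>2 + (norm (z - \<alpha>))\<^sup>2) < 1 - (norm z)\<^sup>2"
    and e3: "?a\<^sup>2 = ?r\<^sup>2 \<longleftrightarrow> t * (1 - (norm z)\<^sup>2 + (norm (z - \<alpha>))\<^sup>2) = 1 - (norm z)\<^sup>2"
    using eq by linarith+
  show "z \<in> cball (of_real t * \<alpha>) ?r \<longleftrightarrow> t \<le> leaf \<alpha> z"
    using sq(1) e1 d by (simp add: dist_norm norm_minus_commute leaf_def pos_le_divide_eq)
  show "z \<in> ball (of_real t * \<alpha>) ?r \<longleftrightarrow> t < leaf \<alpha> z"
    using sq(2) e2 d by (simp add: dist_norm norm_minus_commute leaf_def pos_less_divide_eq)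
  show "z \<in> sphere (of_real t * \<alpha>) ?r \<longleftrightarrow> t = leaf \<alpha> z"
    using sq(3) e3 d by (simp add: dist_norm norm_minus_commute leaf_def eq_divide_eq)
qed

lemma pencil_in_circle_family:
  assumes "norm \<alpha> \<le> 1" "0 \<le> t" "t < 1" "norm \<alpha> < 1 \<Longrightarrow> 0 < t"
  shows "sphere (of_real t * \<alpha>) (pencil_radius \<alpha> t) \<in> circle_family \<alpha>"
proof (cases "norm \<alpha> < 1")
  case False
  then have n: "norm \<alpha> = 1" using assms by simp
  have "pencil_radius \<alpha> t = 1 - t" using n assms by (simp add: pencil_radius_def)
  moreover have "norm (of_real t * \<alpha> - \<alpha>) = 1 - t"
  proof -
    have "of_real t * \<alpha> - \<alpha> = of_real (t - 1) * \<alpha>" by (simp add: algebra_simps)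
    then show ?thesis using n assms by (simp only: norm_mult norm_of_real) simp
  qed
  ultimately have "\<alpha> \<in> sphere (of_real t * \<alpha>) (pencil_radius \<alpha> t)" by (simp add: dist_norm)
  moreover have "sphere (of_real t * \<alpha>) (pencil_radius \<alpha> t) \<subseteq> cball 0 1"
    using pencil_disc_subset[OF assms(1-3)] sphere_cball by blast
  ultimately show ?thesis
    using False pencil_bounds(1)[OF assms(1-3)] by (auto simp: circle_family_def is_circle_def)
next
  case True
  let ?N = "(norm \<alpha>)\<^sup>2"
  have N: "?N < 1" using True by (simp add: power_less_one_iff)
  have t: "0 < t" "t < 1" using assms True by auto
  have tN: "t * ?N < 1" using t mult_strict_left_mono[OF N t(1)] by linarith
  \<comment> \<open>from \<open>R\<^sup>2 = |(z - \<alpha>) / (1 - cnj \<alpha> * z)|\<^sup>2\<close> and the equation of the circle\<close>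
  define R where "R = sqrt ((1 - t) / (1 - t * ?N))"
  have "t * ?N < t" using t N by simp
  then have q: "0 < (1 - t) / (1 - t * ?N)" "(1 - t) / (1 - t * ?N) < 1" using t tN by (auto simp: field_simps)
  then have R: "0 < R" "R < 1" "R\<^sup>2 = (1 - t) / (1 - t * ?N)" by (auto simp: R_def)
  have key: "(norm (\<alpha> - w))\<^sup>2 = R\<^sup>2 * (norm (1 - cnj \<alpha> * w))\<^sup>2 \<longleftrightarrow> (norm (w - of_real t * \<alpha>))\<^sup>2 = (pencil_radius \<alpha> t)\<^sup>2" for w
  proof -
    have n1: "(norm (1 - cnj \<alpha> * w))\<^sup>2 = 1 - 2 * Re (cnj \<alpha> * w) + ?N * (norm w)\<^sup>2"
      unfolding cmod_power2 by (simp add: power2_eq_square algebra_simps)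
    have n2: "(norm (\<alpha> - w))\<^sup>2 = ?N - 2 * Re (cnj \<alpha> * w) + (norm w)\<^sup>2"
      unfolding cmod_power2 by (simp add: power2_eq_square algebra_simps)
    have n3: "(norm (w - of_real t * \<alpha>))\<^sup>2 = (norm w)\<^sup>2 - 2 * t * Re (cnj \<alpha> * w) + t\<^sup>2 * ?N"
      unfolding cmod_power2 by (simp add: power2_eq_square algebra_simps)
    have "(norm (\<alpha> - w))\<^sup>2 = R\<^sup>2 * (norm (1 - cnj \<alpha> * w))\<^sup>2
       \<longleftrightarrow> (1 - t * ?N) * (norm (\<alpha> - w))\<^sup>2 = (1 - t) * (norm (1 - cnj \<alpha> * w))\<^sup>2"
      using tN by (simp add: R(3) field_simps)
    also have "\<dots> \<longleftrightarrow> (1 - ?N) * ((norm (w - of_real t * \<alpha>))\<^sup>2 - (1 - t) * (1 - t * ?N)) = 0"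
      unfolding n1 n2 n3 by (simp add: algebra_simps power2_eq_square)
    also have "\<dots> \<longleftrightarrow> (norm (w - of_real t * \<alpha>))\<^sup>2 = (pencil_radius \<alpha> t)\<^sup>2"
      unfolding pencil_bounds(3)[OF assms(1-3)] using N by simp
    finally show ?thesis .
  qed
  have nz: "1 - cnj \<alpha> * w \<noteq> 0" if "norm w \<le> 1" for w
  proof
    assume "1 - cnj \<alpha> * w = 0"
    then have "norm (cnj \<alpha> * w) = 1" by simp
    then have "norm \<alpha> * norm w = 1" by (simp add: norm_mult)
    moreover have "norm \<alpha> * norm w \<le> norm \<alpha> * 1" using that by (intro mult_left_mono) auto
    ultimately show False using True by simp
  qed
  have inS: "w \<in> sphere (of_real t * \<alpha>) (pencil_radius \<alpha> t) \<longleftrightarrow> norm (\<alpha> - w) = R * norm (1 - cnj \<alpha> * w)" for w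
  proof -
    have "w \<in> sphere (of_real t * \<alpha>) (pencil_radius \<alpha> t) \<longleftrightarrow> (norm (w - of_real t * \<alpha>))\<^sup>2 = (pencil_radius \<alpha> t)\<^sup>2"
      using pencil_bounds(1)[OF assms(1-3)] by (simp add: dist_norm norm_minus_commute power2_eq_iff_nonneg)
    also have "\<dots> \<longleftrightarrow> (norm (\<alpha> - w))\<^sup>2 = (R * norm (1 - cnj \<alpha> * w))\<^sup>2"
      using key by (simp add: power_mult_distrib)
    also have "\<dots> \<longleftrightarrow> norm (\<alpha> - w) = R * norm (1 - cnj \<alpha> * w)"
      using R by (simp add: power2_eq_iff_nonneg)
    finally show ?thesis .
  qed
  let ?\<phi> = "\<lambda>\<zeta>. (\<alpha> - of_real R * \<zeta>) / (1 - cnj \<alpha> * of_real R * \<zeta>)"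
  have aa: "1 - cnj \<alpha> * \<alpha> \<noteq> 0" using nz[of \<alpha>] True by simp
  \<comment> \<open>\<open>\<lambda>v. (\<alpha> - v) / (1 - cnj \<alpha> * v)\<close> is an involution\<close>
  have inv: "\<alpha> - (\<alpha> - v) / (1 - cnj \<alpha> * v) = v * (1 - cnj \<alpha> * \<alpha>) / (1 - cnj \<alpha> * v)"
     "1 - cnj \<alpha> * ((\<alpha> - v) / (1 - cnj \<alpha> * v)) = (1 - cnj \<alpha> * \<alpha>) / (1 - cnj \<alpha> * v)"
    if "1 - cnj \<alpha> * v \<noteq> 0" for v
    using that by (simp_all add: field_simps)
  have "sphere (of_real t * \<alpha>) (pencil_radius \<alpha> t) = ?\<phi> ` sphere 0 1"
  proof (intro equalityI subsetI)
    fix w assume w: "w \<in> sphere (of_real t * \<alpha>) (pencil_radius \<alpha> t)"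
    then have "w \<in> cball 0 1" using pencil_disc_subset[OF assms(1-3)] sphere_cball by blast
    then have d: "1 - cnj \<alpha> * w \<noteq> 0" using nz by simp
    define \<zeta> where "\<zeta> = (\<alpha> - w) / (1 - cnj \<alpha> * w) / of_real R"
    have "norm \<zeta> = 1" using w R d unfolding inS by (simp add: \<zeta>_def norm_divide norm_mult)
    have R\<zeta>: "of_real R * \<zeta> = (\<alpha> - w) / (1 - cnj \<alpha> * w)" using R by (simp add: \<zeta>_def)
    have "?\<phi> \<zeta> = w"
      unfolding mult.assoc R\<zeta> inv[OF d] using d aa by simp
    then show "w \<in> ?\<phi> ` sphere 0 1" using \<open>norm \<zeta> = 1\<close> by (intro image_eqI[of _ _ \<zeta>]) auto
  next
    fix w assume "w \<in> ?\<phi> ` sphere 0 1"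
    then obtain \<zeta> where \<zeta>: "norm \<zeta> = 1" "w = ?\<phi> \<zeta>" by auto
    have d: "1 - cnj \<alpha> * (of_real R * \<zeta>) \<noteq> 0" using \<zeta> R by (intro nz) (simp add: norm_mult)
    have w: "w = (\<alpha> - of_real R * \<zeta>) / (1 - cnj \<alpha> * (of_real R * \<zeta>))" using \<zeta>(2) by (simp add: mult.assoc)
    show "w \<in> sphere (of_real t * \<alpha>) (pencil_radius \<alpha> t)"
      unfolding inS w inv[OF d] using \<zeta> R by (simp add: norm_divide norm_mult)
  qed
  then show ?thesis using True R by (auto simp: circle_family_def)
qed

lemma slope_nz:
  assumes "norm \<alpha> \<le> 1" "norm z \<le> 1" "z \<noteq> \<alpha>"
  shows "slope \<alpha> z \<noteq> 0"
proof
  assume "slope \<alpha> z = 0"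
  then have e: "cnj \<alpha> * z = 1" using assms by (simp add: slope_def)
  then have "norm \<alpha> * norm z = 1" by (metis complex_mod_cnj norm_mult norm_one)
  then have "norm \<alpha> = 1" "norm z = 1"
    using assms mult_left_le[of "norm z" "norm \<alpha>"] mult_left_le[of "norm \<alpha>" "norm z"]
    by (simp_all add: mult.commute)
  then have "\<alpha> * cnj \<alpha> = 1" by (simp add: complex_norm_square[symmetric])
  then have "\<alpha> * (cnj \<alpha> * z) = z" by (simp add: mult.assoc[symmetric])
  then show False using e assms by simp
qed

lemma corner_denom_nz: "norm z < 1 \<Longrightarrow> 1 - z * cnj z \<noteq> 0"
proof
  assume "norm z < 1" "1 - z * cnj z = 0"
  then have "of_real ((norm z)\<^sup>2) = (1::complex)" by (metis complex_norm_square eq_iff_diff_eq_0)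
  then have "(norm z)\<^sup>2 = 1" using of_real_eq_1_iff by blast
  moreover have "(norm z)\<^sup>2 < 1" using \<open>norm z < 1\<close> by (simp add: power_less_one_iff)
  ultimately show False by simp
qed

text \<open>The first equation says that the ray begins at \<open>corner z\<close>. In the second one, the factor
\<open>1 + z * corner z\<close> depends on \<open>z\<close> alone.\<close>
lemma leaf_inverse:
  assumes "norm z < 1"
  shows "1 / of_real (leaf \<alpha> z) = slope \<alpha> z * corner z + offset \<alpha> z"
    and "z - of_real (leaf \<alpha> z) * \<alpha> = of_real (leaf \<alpha> z) * slope \<alpha> z * (1 + z * corner z)"
proof -
  have nz: "1 - z * cnj z \<noteq> 0" using corner_denom_nz assms by blast
  have "1 / of_real (leaf \<alpha> z) = (of_real (1 - (norm z)\<^sup>2 + (norm (z - \<alpha>))\<^sup>2) / of_real (1 - (norm z)\<^sup>2) :: complex)"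
    by (simp add: leaf_def)
  also have "\<dots> = (1 - z * cnj z + (z - \<alpha>) * cnj (z - \<alpha>)) / (1 - z * cnj z)"
    by (simp only: of_real_add of_real_diff complex_norm_square of_real_1)
  also have "\<dots> = slope \<alpha> z * corner z + offset \<alpha> z"
    using nz by (simp add: slope_def corner_def offset_def field_simps)
  finally show 1: "1 / of_real (leaf \<alpha> z) = slope \<alpha> z * corner z + offset \<alpha> z" .
  have l: "of_real (leaf \<alpha> z) \<noteq> (0::complex)" using leaf_pos[OF assms, of \<alpha>] by simp
  have "z - of_real (leaf \<alpha> z) * \<alpha> = of_real (leaf \<alpha> z) * (1 / of_real (leaf \<alpha> z) * z - \<alpha>)"
    using l by (simp add: field_simps)
  also have "1 / of_real (leaf \<alpha> z) * z - \<alpha> = slope \<alpha> z * (1 + z * corner z)"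
    unfolding 1 by (simp add: slope_def offset_def algebra_simps)
  finally show "z - of_real (leaf \<alpha> z) * \<alpha> = of_real (leaf \<alpha> z) * slope \<alpha> z * (1 + z * corner z)"
    by (simp add: mult.assoc)
qed

section \<open>The geodesic through two points\<close>

text \<open>Passage from the Poincare disc to the Klein disc, where geodesics are chords. There the sides of a geodesic are
convex and its points are convex combinations.\<close>
definition klein :: "complex \<Rightarrow> complex" where
  "klein z = 2 * z / of_real (1 + (norm z)\<^sup>2)"

definition unklein :: "complex \<Rightarrow> complex" where
  "unklein X = X / of_real (1 + sqrt (1 - (norm X)\<^sup>2))"

text \<open>Has the sign of the imaginary part of \<open>slope \<alpha> z / slope \<beta> z\<close>, which tells how the two rays over
\<open>z\<close> are oriented to each other.\<close>
definition side :: "complex \<Rightarrow> complex \<Rightarrow> complex \<Rightarrow> real" where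
  "side \<alpha> \<beta> z = Im (slope \<alpha> z * cnj (slope \<beta> z))"

lemma one_plus_sq_pos: "0 < 1 + (norm (z::complex))\<^sup>2"
  by (simp add: add_pos_nonneg)

lemma norm_klein: "norm (klein z) = 2 * norm z / (1 + (norm z)\<^sup>2)"
  unfolding klein_def norm_divide norm_of_real using one_plus_sq_pos[of z] by (simp add: norm_mult)

lemma klein_sq: "1 - (norm (klein z))\<^sup>2 = ((1 - (norm z)\<^sup>2) / (1 + (norm z)\<^sup>2))\<^sup>2"
proof -
  have "1 - (2 * x / (1 + x\<^sup>2))\<^sup>2 = ((1 - x\<^sup>2) / (1 + x\<^sup>2))\<^sup>2" for x :: real
  proof -
    have p: "1 + x\<^sup>2 \<noteq> 0" using zero_le_power2[of x] by linarith
    have "1 - (2 * x / (1 + x\<^sup>2))\<^sup>2 = ((1 + x\<^sup>2)\<^sup>2 - (2 * x)\<^sup>2) / (1 + x\<^sup>2)\<^sup>2"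
      using p by (simp add: power_divide diff_divide_distrib)
    also have "(1 + x\<^sup>2)\<^sup>2 - (2 * x)\<^sup>2 = (1 - x\<^sup>2)\<^sup>2" by (simp add: power2_eq_square algebra_simps)
    finally show ?thesis by (simp add: power_divide)
  qed
  then show ?thesis by (simp add: norm_klein)
qed

lemma norm_klein_le: "norm (klein z) \<le> 1"
proof -
  have "0 \<le> 1 - (norm (klein z))\<^sup>2" unfolding klein_sq by simp
  then show ?thesis by (simp add: power_le_one_iff)
qed

lemma norm_klein_less: "norm z < 1 \<Longrightarrow> norm (klein z) < 1"
proof -
  assume "norm z < 1"
  then have "(norm z)\<^sup>2 < 1" by (simp add: power_less_one_iff)
  then have "0 < 1 - (norm (klein z))\<^sup>2" unfolding klein_sq using one_plus_sq_pos[of z] by simp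
  then show ?thesis by (simp add: power_less_one_iff)
qed

lemma unklein_klein:
  assumes "norm z \<le> 1" shows "unklein (klein z) = z"
proof -
  have "(norm z)\<^sup>2 \<le> 1" using assms by (simp add: power_le_one)
  then have "sqrt (1 - (norm (klein z))\<^sup>2) = (1 - (norm z)\<^sup>2) / (1 + (norm z)\<^sup>2)"
    unfolding klein_sq using one_plus_sq_pos[of z] by (simp add: real_sqrt_abs)
  then have e: "1 + sqrt (1 - (norm (klein z))\<^sup>2) = 2 / (1 + (norm z)\<^sup>2)"
    using one_plus_sq_pos[of z] by (simp add: field_simps)
  have "of_real (1 + (norm z)\<^sup>2) \<noteq> (0::complex)"
    unfolding of_real_eq_0_iff using one_plus_sq_pos[of z] by linarith
  then show ?thesis
    unfolding unklein_def e of_real_divide unfolding klein_def by simp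
qed

lemma unklein_sq:
  assumes "norm X \<le> 1"
  defines "s \<equiv> sqrt (1 - (norm X)\<^sup>2)"
  shows "0 \<le> s" "s\<^sup>2 = 1 - (norm X)\<^sup>2"
    and "(norm (unklein X))\<^sup>2 = (1 - s) / (1 + s)"
    and "1 - (norm (unklein X))\<^sup>2 = 2 * s / (1 + s)" and "1 + (norm (unklein X))\<^sup>2 = 2 / (1 + s)"
proof -
  have "(norm X)\<^sup>2 \<le> 1" using assms by (simp add: power_le_one)
  then show s0: "0 \<le> s" and s2: "s\<^sup>2 = 1 - (norm X)\<^sup>2" by (auto simp: s_def)
  have "norm (unklein X) = norm X / (1 + s)"
    unfolding unklein_def s_def[symmetric] norm_divide norm_of_real using s0 by simp
  then have "(norm (unklein X))\<^sup>2 = (1 - s\<^sup>2) / (1 + s)\<^sup>2"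
    using s2 by (simp add: power_divide)
  also have "\<dots> = (1 - s) / (1 + s)"
  proof -
    have "1 - s\<^sup>2 = (1 - s) * (1 + s)" by (simp add: power2_eq_square algebra_simps)
    then show ?thesis using s0 by (simp add: power2_eq_square)
  qed
  finally show 1: "(norm (unklein X))\<^sup>2 = (1 - s) / (1 + s)" .
  show "1 - (norm (unklein X))\<^sup>2 = 2 * s / (1 + s)" "1 + (norm (unklein X))\<^sup>2 = 2 / (1 + s)"
    unfolding 1 using s0 by (simp_all add: field_simps)
qed

lemma norm_unklein_less: "norm X < 1 \<Longrightarrow> norm (unklein X) < 1"
proof -
  assume X: "norm X < 1"
  define s where "s = sqrt (1 - (norm X)\<^sup>2)"
  have "(norm X)\<^sup>2 < 1" using X by (simp add: power_less_one_iff)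
  then have "0 < s" by (simp add: s_def)
  then have "0 < 1 - (norm (unklein X))\<^sup>2"
    using unklein_sq(4)[of X] X by (simp add: s_def[symmetric])
  then show ?thesis by (simp add: power_less_one_iff)
qed

lemma klein_unklein:
  assumes "norm X \<le> 1" shows "klein (unklein X) = X"
proof -
  define s where "s = sqrt (1 - (norm X)\<^sup>2)"
  have s: "0 \<le> s" "1 + (norm (unklein X))\<^sup>2 = 2 / (1 + s)"
    using unklein_sq[OF assms] by (auto simp: s_def)
  have "1 + complex_of_real s \<noteq> 0"
    using s(1) by (metis add_pos_nonneg less_irrefl of_real_1 of_real_add of_real_eq_0_iff zero_less_one)
  then show ?thesis
    unfolding klein_def s(2) unfolding unklein_def s_def[symmetric] by simp
qed

lemma continuous_on_unklein: "continuous_on S unklein" if "S \<subseteq> cball 0 1"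
proof -
  have "of_real (1 + sqrt (1 - (norm X)\<^sup>2)) \<noteq> (0::complex)" if "X \<in> S" for X
  proof -
    have "0 \<le> sqrt (1 - (norm X)\<^sup>2)" using unklein_sq(1)[of X] that \<open>S \<subseteq> cball 0 1\<close> by auto
    then show ?thesis unfolding of_real_eq_0_iff by linarith
  qed
  then show ?thesis unfolding unklein_def by (intro continuous_intros) auto
qed

lemma continuous_on_klein: "continuous_on S klein"
proof -
  have "of_real (1 + (norm z)\<^sup>2) \<noteq> (0::complex)" for z :: complex
    unfolding of_real_eq_0_iff using one_plus_sq_pos[of z] by linarith
  then show ?thesis unfolding klein_def by (intro continuous_intros) auto
qed

text \<open>For \<open>|z| < 1\<close>, \<open>slope\<close> is an injective real-linear function of the displacement from \<open>\<alpha>\<close> in the Klein disc,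
the same one for all \<open>\<alpha>\<close> up to a positive factor. So the orientation of the two rays over \<open>z\<close> is decided by
that of the triangle with vertices \<open>z\<close>, \<open>\<alpha>\<close>, \<open>\<beta>\<close>, and the rays are opposite for \<open>z\<close> between \<open>\<alpha>\<close> and \<open>\<beta>\<close>.\<close>
lemma slope_klein:
  "slope \<alpha> z = of_real ((1 + (norm \<alpha>)\<^sup>2) / 2) * ((klein z - klein \<alpha>) + z\<^sup>2 * cnj (klein z - klein \<alpha>))"
proof -
  have k: "of_real (1 + (norm w)\<^sup>2) = 1 + w * cnj w" for w :: complex
    by (simp only: of_real_add complex_norm_square of_real_1)
  have nz: "1 + w * cnj w \<noteq> 0" for w :: complex
    unfolding k[symmetric] of_real_eq_0_iff using one_plus_sq_pos[of w] by linarith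
  have "klein z + z\<^sup>2 * cnj (klein z) = 2 * z"
  proof -
    have "klein z + z\<^sup>2 * cnj (klein z) = 2 * z * (1 + z * cnj z) / (1 + z * cnj z)"
      unfolding klein_def k by (simp add: k power2_eq_square add_divide_distrib algebra_simps del: of_real_add of_real_power)
    then show ?thesis using nz[of z] by simp
  qed
  moreover have "of_real ((1 + (norm \<alpha>)\<^sup>2) / 2) * (klein \<alpha> + z\<^sup>2 * cnj (klein \<alpha>)) = \<alpha> + z\<^sup>2 * cnj \<alpha>"
  proof -
    have "d / 2 * (2 * a / d + c * (2 * b / d)) = a + c * b" if "d \<noteq> 0" for a b c d :: complex
      using that by (simp add: field_simps)
    from this[OF nz[of \<alpha>], of \<alpha> "z\<^sup>2" "cnj \<alpha>"] show ?thesis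
      unfolding klein_def of_real_divide k by (simp add: mult.commute[of "cnj \<alpha>"])
  qed
  moreover have "of_real ((1 + (norm \<alpha>)\<^sup>2) / 2) * (2 * z) = (1 + \<alpha> * cnj \<alpha>) * z"
    unfolding of_real_divide k by simp
  moreover have "of_real ((1 + (norm \<alpha>)\<^sup>2) / 2) * ((klein z - klein \<alpha>) + z\<^sup>2 * cnj (klein z - klein \<alpha>))
    = of_real ((1 + (norm \<alpha>)\<^sup>2) / 2) * (klein z + z\<^sup>2 * cnj (klein z)) - of_real ((1 + (norm \<alpha>)\<^sup>2) / 2) * (klein \<alpha> + z\<^sup>2 * cnj (klein \<alpha>))"
    by (simp add: algebra_simps)
  ultimately show ?thesis
    by (simp only:) (simp add: slope_def power2_eq_square algebra_simps)
qed

lemma Re_complex_of_real_times: "Re (of_real x * z) = x * Re z"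
  by simp

definition line_side :: "complex \<Rightarrow> complex \<Rightarrow> complex \<Rightarrow> real" where
  "line_side \<alpha> \<beta> X = Im ((X - klein \<alpha>) * cnj (X - klein \<beta>))"

lemma side_klein:
  "side \<alpha> \<beta> z = (1 + (norm \<alpha>)\<^sup>2) * (1 + (norm \<beta>)\<^sup>2) / 4 * (1 - (norm z) ^ 4) * line_side \<alpha> \<beta> (klein z)"
proof -
  have *: "Im ((v + z\<^sup>2 * cnj v) * cnj (w + z\<^sup>2 * cnj w)) = (1 - (norm z) ^ 4) * Im (v * cnj w)" for v w
  proof -
    have n: "(norm z) ^ 4 = ((Re z)\<^sup>2 + (Im z)\<^sup>2)\<^sup>2"
      by (simp add: cmod_power2[symmetric] power_mult[symmetric])
    show ?thesis unfolding n by (simp add: power2_eq_square algebra_simps)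
  qed
  have "slope \<alpha> z * cnj (slope \<beta> z) = of_real ((1 + (norm \<alpha>)\<^sup>2) / 2 * ((1 + (norm \<beta>)\<^sup>2) / 2)) *
      (((klein z - klein \<alpha>) + z\<^sup>2 * cnj (klein z - klein \<alpha>)) * cnj ((klein z - klein \<beta>) + z\<^sup>2 * cnj (klein z - klein \<beta>)))"
    unfolding slope_klein[of \<alpha> z] slope_klein[of \<beta> z] complex_cnj_mult complex_cnj_complex_of_real
    by (simp only: of_real_mult mult_ac)
  then have "side \<alpha> \<beta> z = (1 + (norm \<alpha>)\<^sup>2) / 2 * ((1 + (norm \<beta>)\<^sup>2) / 2) * Im
      (((klein z - klein \<alpha>) + z\<^sup>2 * cnj (klein z - klein \<alpha>)) * cnj ((klein z - klein \<beta>) + z\<^sup>2 * cnj (klein z - klein \<beta>)))"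
    unfolding side_def by (simp only: Im_complex_of_real Re_complex_of_real times_complex.sel(2))
  then show ?thesis unfolding * line_side_def by simp
qed

lemma line_side_affine:
  "line_side \<alpha> \<beta> ((1 - t) *\<^sub>R X + t *\<^sub>R Y) = (1 - t) * line_side \<alpha> \<beta> X + t * line_side \<alpha> \<beta> Y"
  unfolding line_side_def by (simp add: algebra_simps)

lemma continuous_on_line_side [continuous_intros]:
  "continuous_on S g \<Longrightarrow> continuous_on S (\<lambda>x. line_side \<alpha> \<beta> (g x))"
  unfolding line_side_def by (intro continuous_intros)

lemma klein_inj:
  assumes "norm \<alpha> \<le> 1" "norm \<beta> \<le> 1" "\<alpha> \<noteq> \<beta>"
  shows "klein \<alpha> \<noteq> klein \<beta>"
  using unklein_klein assms by metis

definition half_disc :: "complex \<Rightarrow> complex \<Rightarrow> real \<Rightarrow> complex set" where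
  "half_disc \<alpha> \<beta> \<epsilon> = {z \<in> ball 0 1. \<epsilon> * side \<alpha> \<beta> z < 0}"

lemma half_disc_klein: "norm z < 1 \<Longrightarrow> z \<in> half_disc \<alpha> \<beta> \<epsilon> \<longleftrightarrow> \<epsilon> * line_side \<alpha> \<beta> (klein z) < 0"
proof -
  assume z: "norm z < 1"
  define K where "K = (1 + (norm \<alpha>)\<^sup>2) * (1 + (norm \<beta>)\<^sup>2) / 4 * (1 - (norm z) ^ 4)"
  have "(norm z) ^ 4 < 1" using z by (simp add: power_less_one_iff)
  then have K: "K > 0" unfolding K_def using one_plus_sq_pos by (intro mult_pos_pos divide_pos_pos) auto
  have e: "\<epsilon> * side \<alpha> \<beta> z = K * (\<epsilon> * line_side \<alpha> \<beta> (klein z))"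
    unfolding side_klein K_def by simp
  have "K * x < 0 \<longleftrightarrow> x < 0" for x using K by (simp add: mult_less_0_iff)
  then show ?thesis unfolding half_disc_def mem_Collect_eq e using z by simp
qed

lemma open_half_disc: "open (half_disc \<alpha> \<beta> \<epsilon>)"
proof -
  have "half_disc \<alpha> \<beta> \<epsilon> = ball 0 1 \<inter> {z. \<epsilon> * side \<alpha> \<beta> z < 0}" by (auto simp: half_disc_def)
  then show ?thesis unfolding side_def slope_def
    by (auto intro!: open_Int open_Collect_less continuous_intros)
qed

lemma connected_half_disc: "connected (half_disc \<alpha> \<beta> \<epsilon>)"
proof -
  define C where "C = {X \<in> ball 0 1. \<epsilon> * line_side \<alpha> \<beta> X < 0}"
  have "convex C"
    unfolding convex_alt
  proof (intro ballI allI impI)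
    fix X Y and t :: real assume X: "X \<in> C" and Y: "Y \<in> C" and t: "0 \<le> t \<and> t \<le> 1"
    have "(1 - t) *\<^sub>R X + t *\<^sub>R Y \<in> ball 0 1"
      using convex_ball[of "0::complex" 1] X Y t unfolding convex_alt C_def by blast
    moreover have "\<epsilon> * line_side \<alpha> \<beta> ((1 - t) *\<^sub>R X + t *\<^sub>R Y) < 0"
    proof -
      have "(1 - t) * (\<epsilon> * line_side \<alpha> \<beta> X) + t * (\<epsilon> * line_side \<alpha> \<beta> Y) < 0"
        using convex_real_interval(4)[of 0] X Y t unfolding convex_alt C_def by (fastforce simp: lessThan_def)
      then show ?thesis unfolding line_side_affine by (simp add: algebra_simps)
    qed
    ultimately show "(1 - t) *\<^sub>R X + t *\<^sub>R Y \<in> C" by (simp add: C_def)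
  qed
  then have "connected (unklein ` C)"
    by (intro connected_continuous_image convex_connected continuous_on_unklein) (auto simp: C_def)
  moreover have "unklein ` C = half_disc \<alpha> \<beta> \<epsilon>"
  proof (intro equalityI subsetI)
    fix z assume "z \<in> unklein ` C"
    then show "z \<in> half_disc \<alpha> \<beta> \<epsilon>"
      using half_disc_klein norm_unklein_less klein_unklein by (force simp: C_def)
  next
    fix z assume z: "z \<in> half_disc \<alpha> \<beta> \<epsilon>"
    then have "norm z < 1" by (simp add: half_disc_def)
    then have "klein z \<in> C" "unklein (klein z) = z"
      using z half_disc_klein norm_klein_less unklein_klein by (auto simp: C_def)
    then show "z \<in> unklein ` C" by force
  qed
  ultimately show ?thesis by simp
qed

lemma line_side_segment_offset:
  "line_side \<alpha> \<beta> ((1 - \<mu>) *\<^sub>R klein \<alpha> + \<mu> *\<^sub>R klein \<beta> + (\<i> * of_real \<eta>) * (klein \<alpha> - klein \<beta>))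
     = \<eta> * (norm (klein \<alpha> - klein \<beta>))\<^sup>2"
proof -
  have "line_side \<alpha> \<beta> ((1 - \<mu>) *\<^sub>R klein \<alpha> + \<mu> *\<^sub>R klein \<beta> + (\<i> * of_real \<eta>) * (klein \<alpha> - klein \<beta>))
      = Im ((- of_real \<mu> + \<i> * of_real \<eta>) * (1 - of_real \<mu> - \<i> * of_real \<eta>) * of_real ((norm (klein \<alpha> - klein \<beta>))\<^sup>2))"
    unfolding line_side_def complex_norm_square
    by (rule arg_cong[of _ _ Im]) (simp add: scaleR_conv_of_real algebra_simps)
  then show ?thesis by (simp add: algebra_simps)
qed

lemma norm_segment:
  fixes a b :: complex
  assumes "norm a \<le> 1" "norm b \<le> 1" "0 \<le> \<mu>" "\<mu> \<le> 1"
  shows "\<mu> * (1 - \<mu>) * (norm (a - b))\<^sup>2 \<le> 1 - (norm ((1 - \<mu>) *\<^sub>R a + \<mu> *\<^sub>R b))\<^sup>2"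
proof -
  have "(norm ((1 - \<mu>) *\<^sub>R a + \<mu> *\<^sub>R b))\<^sup>2 = (1 - \<mu>) * (norm a)\<^sup>2 + \<mu> * (norm b)\<^sup>2 - \<mu> * (1 - \<mu>) * (norm (a - b))\<^sup>2"
    unfolding cmod_power2 by (simp add: power2_eq_square algebra_simps)
  moreover have "(1 - \<mu>) * (norm a)\<^sup>2 + \<mu> * (norm b)\<^sup>2 \<le> (1 - \<mu>) * 1 + \<mu> * 1"
    using assms by (intro add_mono mult_left_mono) (auto simp: power_le_one)
  ultimately show ?thesis by simp
qed

definition geodesic :: "complex \<Rightarrow> complex \<Rightarrow> real \<Rightarrow> complex" where
  "geodesic \<alpha> \<beta> \<mu> = unklein ((1 - \<mu>) *\<^sub>R klein \<alpha> + \<mu> *\<^sub>R klein \<beta>)"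

context
  fixes \<alpha> \<beta> :: complex
  assumes ab: "norm \<alpha> \<le> 1" "norm \<beta> \<le> 1" "\<alpha> \<noteq> \<beta>"
begin

lemma klein_geodesic_point:
  assumes "0 < \<mu>" "\<mu> < 1"
  shows "norm ((1 - \<mu>) *\<^sub>R klein \<alpha> + \<mu> *\<^sub>R klein \<beta>) < 1"
proof -
  have "0 < \<mu> * (1 - \<mu>) * (norm (klein \<alpha> - klein \<beta>))\<^sup>2"
    using assms klein_inj[OF ab] by (intro mult_pos_pos) auto
  also have "\<dots> \<le> 1 - (norm ((1 - \<mu>) *\<^sub>R klein \<alpha> + \<mu> *\<^sub>R klein \<beta>))\<^sup>2"
    using assms by (intro norm_segment norm_klein_le) auto
  finally show ?thesis by (simp add: power_less_one_iff)
qed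

lemma klein_geodesic_le: "norm ((1 - \<mu>) *\<^sub>R klein \<alpha> + \<mu> *\<^sub>R klein \<beta>) \<le> 1" if "0 \<le> \<mu>" "\<mu> \<le> 1"
proof -
  have "norm ((1 - \<mu>) *\<^sub>R klein \<alpha> + \<mu> *\<^sub>R klein \<beta>) \<le> (1 - \<mu>) * norm (klein \<alpha>) + \<mu> * norm (klein \<beta>)"
    using that by (intro norm_triangle_le) auto
  also have "\<dots> \<le> (1 - \<mu>) * 1 + \<mu> * 1"
    using that by (intro add_mono mult_left_mono norm_klein_le) auto
  finally show ?thesis by simp
qed

lemma geodesic_in_disc: "0 < \<mu> \<Longrightarrow> \<mu> < 1 \<Longrightarrow> norm (geodesic \<alpha> \<beta> \<mu>) < 1"
  unfolding geodesic_def by (intro norm_unklein_less klein_geodesic_point)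

lemma klein_geodesic: "0 \<le> \<mu> \<Longrightarrow> \<mu> \<le> 1 \<Longrightarrow> klein (geodesic \<alpha> \<beta> \<mu>) = (1 - \<mu>) *\<^sub>R klein \<alpha> + \<mu> *\<^sub>R klein \<beta>"
  unfolding geodesic_def using klein_geodesic_le by (intro klein_unklein)

lemma continuous_on_geodesic: "continuous_on {0..1} (geodesic \<alpha> \<beta>)"
  unfolding geodesic_def
  by (intro continuous_on_compose2[OF continuous_on_unklein[OF order_refl]] continuous_intros) (use klein_geodesic_le in auto)

lemma geodesic_inj:
  assumes "0 \<le> \<mu>" "\<mu> \<le> 1" "0 \<le> \<nu>" "\<nu> \<le> 1" "geodesic \<alpha> \<beta> \<mu> = geodesic \<alpha> \<beta> \<nu>"
  shows "\<mu> = \<nu>"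
proof -
  have "(1 - \<mu>) *\<^sub>R klein \<alpha> + \<mu> *\<^sub>R klein \<beta> = (1 - \<nu>) *\<^sub>R klein \<alpha> + \<nu> *\<^sub>R klein \<beta>"
    using klein_geodesic assms by metis
  then have "(\<nu> - \<mu>) *\<^sub>R (klein \<alpha> - klein \<beta>) = 0" by (simp add: algebra_simps)
  then show ?thesis using klein_inj[OF ab] by simp
qed

lemma slope_geodesic:
  assumes "0 < \<mu>" "\<mu> < 1"
  obtains q :: real where "q < 0" "slope \<alpha> (geodesic \<alpha> \<beta> \<mu>) = of_real q * slope \<beta> (geodesic \<alpha> \<beta> \<mu>)" "slope \<beta> (geodesic \<alpha> \<beta> \<mu>) \<noteq> 0"
proof -
  let ?z = "geodesic \<alpha> \<beta> \<mu>" and ?a = "(1 + (norm \<alpha>)\<^sup>2) / 2" and ?b = "(1 + (norm \<beta>)\<^sup>2) / 2"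
  define \<delta> where "\<delta> = klein \<beta> - klein \<alpha>"
  define \<kappa> where "\<kappa> = \<delta> + ?z\<^sup>2 * cnj \<delta>"
  have k: "klein ?z - klein \<alpha> = of_real \<mu> * \<delta>" "klein ?z - klein \<beta> = of_real (- (1 - \<mu>)) * \<delta>"
    using klein_geodesic[of \<mu>] assms by (simp_all add: \<delta>_def scaleR_conv_of_real algebra_simps)
  have fac: "of_real x * (of_real m * d + s * cnj (of_real m * d)) = of_real (x * m) * (d + s * cnj d)" for x m :: real and d s
    by (simp add: algebra_simps)
  have A: "slope \<alpha> ?z = of_real (?a * \<mu>) * \<kappa>"
    unfolding slope_klein[of \<alpha>] k \<kappa>_def fac ..
  have B: "slope \<beta> ?z = of_real (?b * (- (1 - \<mu>))) * \<kappa>"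
    unfolding slope_klein[of \<beta>] k \<kappa>_def fac ..
  have \<delta>0: "\<delta> \<noteq> 0" using klein_inj[OF ab] by (simp add: \<delta>_def)
  have "\<kappa> \<noteq> 0"
  proof
    assume "\<kappa> = 0"
    then have "norm \<delta> = norm (?z\<^sup>2 * cnj \<delta>)" unfolding \<kappa>_def by (metis add_eq_0_iff norm_minus_cancel)
    then have "(norm ?z)\<^sup>2 = 1" using \<delta>0 by (simp add: norm_mult norm_power)
    moreover have "(norm ?z)\<^sup>2 < 1" using geodesic_in_disc[OF assms] by (simp add: power_less_one_iff)
    ultimately show False by simp
  qed
  moreover have p: "0 < ?a" "0 < ?b" using one_plus_sq_pos by auto
  have nb: "?b * (- (1 - \<mu>)) < 0" using p assms by (intro mult_pos_neg) auto
  show thesis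
  proof (rule that[of "(?a * \<mu>) / (?b * (- (1 - \<mu>)))"])
    show "(?a * \<mu>) / (?b * (- (1 - \<mu>))) < 0" using nb p assms by (intro divide_pos_neg mult_pos_pos)
    show "slope \<alpha> ?z = of_real ((?a * \<mu>) / (?b * (- (1 - \<mu>)))) * slope \<beta> ?z"
    proof -
      have "x / y * y = x" if "y < 0" for x y :: real using that by simp
      note q = this[OF nb, of "?a * \<mu>"]
      have "of_real ((?a * \<mu>) / (?b * (- (1 - \<mu>)))) * slope \<beta> ?z
          = of_real ((?a * \<mu>) / (?b * (- (1 - \<mu>))) * (?b * (- (1 - \<mu>)))) * \<kappa>"
        unfolding B by (simp only: of_real_mult mult.assoc)
      then show ?thesis unfolding q A by simp
    qed
    show "slope \<beta> ?z \<noteq> 0" unfolding B mult_eq_0_iff[of "of_real _"] of_real_eq_0_iff using nb \<open>\<kappa> \<noteq> 0\<close> by (metis less_irrefl)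
  qed
qed

lemma geodesic_in_closure_half:
  assumes "0 < \<mu>" "\<mu> < 1" "\<epsilon> \<noteq> 0"
  shows "geodesic \<alpha> \<beta> \<mu> \<in> closure (half_disc \<alpha> \<beta> \<epsilon>)"
proof -
  let ?X = "\<lambda>\<eta>. (1 - \<mu>) *\<^sub>R klein \<alpha> + \<mu> *\<^sub>R klein \<beta> + (\<i> * of_real \<eta>) * (klein \<alpha> - klein \<beta>)"
  define \<eta> where "\<eta> j = - \<epsilon> / of_nat (Suc j)" for j :: nat
  have "(\<lambda>j. - \<epsilon> * (1 / of_nat (Suc j))) \<longlonglongrightarrow> - \<epsilon> * 0"
    by (intro tendsto_mult tendsto_const lim_1_over_n[THEN LIMSEQ_Suc])
  then have "\<eta> \<longlonglongrightarrow> 0" by (simp add: \<eta>_def[abs_def])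
  then have lim: "(\<lambda>j. ?X (\<eta> j)) \<longlonglongrightarrow> ?X 0" by (intro tendsto_intros)
  have X0: "?X 0 = (1 - \<mu>) *\<^sub>R klein \<alpha> + \<mu> *\<^sub>R klein \<beta>" by simp
  have in0: "?X 0 \<in> ball 0 1" using klein_geodesic_point[OF assms(1,2)] by simp
  then have ev: "\<forall>\<^sub>F j in sequentially. ?X (\<eta> j) \<in> ball 0 1"
    using lim open_ball topological_tendstoD by blast
  have "isCont unklein (?X 0)"
    using continuous_on_unklein[of "ball 0 1"] in0 by (simp add: continuous_on_eq_continuous_at)
  then have lim2: "(\<lambda>j. unklein (?X (\<eta> j))) \<longlonglongrightarrow> unklein (?X 0)"
    using lim by (rule isCont_tendsto_compose)
  have "\<forall>\<^sub>F j in sequentially. unklein (?X (\<eta> j)) \<in> half_disc \<alpha> \<beta> \<epsilon>"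
    using ev
  proof eventually_elim
    case (elim j)
    then have n: "norm (?X (\<eta> j)) < 1" by simp
    have "\<epsilon> * line_side \<alpha> \<beta> (?X (\<eta> j)) = - (\<epsilon>\<^sup>2 * (norm (klein \<alpha> - klein \<beta>))\<^sup>2 / of_nat (Suc j))"
      unfolding line_side_segment_offset by (simp add: \<eta>_def power2_eq_square)
    also have "\<dots> < 0" using assms(3) klein_inj[OF ab] by simp
    finally show ?case
      using half_disc_klein[OF norm_unklein_less[OF n]] klein_unklein[of "?X (\<eta> j)"] n by simp
  qed
  then show ?thesis
    using Lim_in_closed_set[OF closed_closure _ _ lim2, of "half_disc \<alpha> \<beta> \<epsilon>"] closure_subset
    unfolding geodesic_def X0 by (smt (verit, best) eventually_mono subsetD trivial_limit_sequentially)
qed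

text \<open>Walking from the middle of the chord in the normal direction, on the side given by the sign of \<open>\<epsilon>\<close>, one meets the
unit circle at some \<open>\<zeta>\<close> off the chord; a small circular cap at \<open>\<zeta>\<close> stays on that side.\<close>
lemma half_boundary_arc:
  assumes \<epsilon>: "\<epsilon> \<noteq> 0"
  obtains \<zeta> e where "norm \<zeta> = 1" "0 < e" "\<And>z. norm z \<le> 1 \<Longrightarrow> 1 - e \<le> Re (cnj \<zeta> * z) \<Longrightarrow> z \<noteq> \<alpha> \<and> z \<noteq> \<beta> \<and> (norm z < 1 \<longrightarrow> z \<in> half_disc \<alpha> \<beta> \<epsilon>)"
proof -
  let ?X = "\<lambda>\<eta>. (1 - 1/2) *\<^sub>R klein \<alpha> + (1/2) *\<^sub>R klein \<beta> + (\<i> * of_real \<eta>) * (klein \<alpha> - klein \<beta>)"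
  have kn: "0 < norm (klein \<alpha> - klein \<beta>)" using klein_inj[OF ab] by simp
  have "\<exists>\<eta>. norm (?X \<eta>) = 1 \<and> \<epsilon> * \<eta> < 0"
  proof -
    define g where "g x = norm (?X (- \<epsilon> * x))" for x
    have X0: "?X 0 = (1 - 1/2) *\<^sub>R klein \<alpha> + (1/2) *\<^sub>R klein \<beta>" by simp
    have "g 0 < 1" using klein_geodesic_point[of "1/2"] X0 unfolding g_def by simp
    define T where "T = 2 / (\<bar>\<epsilon>\<bar> * norm (klein \<alpha> - klein \<beta>))"
    have T: "0 < T" using kn \<epsilon> by (simp add: T_def)
    have "g T \<ge> norm ((\<i> * of_real (- \<epsilon> * T)) * (klein \<alpha> - klein \<beta>)) - norm (?X 0)"
      unfolding g_def X0 using norm_diff_ineq[of "(\<i> * of_real (- \<epsilon> * T)) * (klein \<alpha> - klein \<beta>)"] by (simp add: add.commute)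
    moreover have "norm ((\<i> * of_real (- \<epsilon> * T)) * (klein \<alpha> - klein \<beta>)) = 2"
      unfolding norm_mult norm_of_real using kn \<epsilon> by (simp add: T_def abs_mult)
    moreover have "norm (?X 0) < 1" using \<open>g 0 < 1\<close> by (simp add: g_def)
    ultimately have "1 \<le> g T" by linarith
    moreover have "continuous_on {0..T} g"
      unfolding g_def by (intro continuous_intros)
    ultimately obtain x where x: "0 \<le> x" "x \<le> T" "g x = 1"
      using IVT'[of g 0 1 T] \<open>g 0 < 1\<close> T by auto
    have "x \<noteq> 0" using x \<open>g 0 < 1\<close> by auto
    then have "\<epsilon> * (- \<epsilon> * x) < 0" using x \<epsilon> by (simp add: mult.assoc[symmetric] power2_eq_square[symmetric])
    then show ?thesis using x(3) unfolding g_def by blast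
  qed
  then obtain \<eta> where \<eta>: "norm (?X \<eta>) = 1" "\<epsilon> * \<eta> < 0" by blast
  define \<zeta> where "\<zeta> = ?X \<eta>"
  have k\<zeta>: "klein \<zeta> = \<zeta>" using \<eta>(1) by (simp add: klein_def \<zeta>_def)
  have "\<epsilon> * line_side \<alpha> \<beta> \<zeta> = (\<epsilon> * \<eta>) * (norm (klein \<alpha> - klein \<beta>))\<^sup>2"
    unfolding \<zeta>_def line_side_segment_offset by simp
  also have "\<dots> < 0" by (rule mult_neg_pos[OF \<eta>(2)]) (use kn in simp)
  finally have neg: "\<epsilon> * line_side \<alpha> \<beta> (klein \<zeta>) < 0" using k\<zeta> by simp
  have "open {z. \<epsilon> * line_side \<alpha> \<beta> (klein z) < 0}"
    by (intro open_Collect_less continuous_intros continuous_on_klein)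
  then obtain d where d: "d > 0" "\<And>z. dist z \<zeta> < d \<Longrightarrow> \<epsilon> * line_side \<alpha> \<beta> (klein z) < 0"
    using neg unfolding open_dist by blast
  show thesis
  proof (rule that[of \<zeta> "d\<^sup>2 / 3"])
    show n1: "norm \<zeta> = 1" using \<eta>(1) by (simp add: \<zeta>_def)
    show "0 < d\<^sup>2 / 3" using d by simp
    fix z assume z: "norm z \<le> 1" "1 - d\<^sup>2 / 3 \<le> Re (cnj \<zeta> * z)"
    have "(norm (z - \<zeta>))\<^sup>2 = (norm z)\<^sup>2 + (norm \<zeta>)\<^sup>2 - 2 * Re (cnj \<zeta> * z)"
      unfolding cmod_power2 by (simp add: power2_eq_square algebra_simps)
    also have "\<dots> \<le> 1 + 1 - 2 * (1 - d\<^sup>2 / 3)" using z n1 power_le_one[of "norm z" 2] by simp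
    also have "\<dots> < d\<^sup>2" using d(1) by simp
    finally have "norm (z - \<zeta>) < d" using d(1) by (simp add: power2_less_imp_less)
    then have l: "\<epsilon> * line_side \<alpha> \<beta> (klein z) < 0" by (intro d(2)) (simp add: dist_norm)
    have "line_side \<alpha> \<beta> (klein \<alpha>) = 0" "line_side \<alpha> \<beta> (klein \<beta>) = 0" by (simp_all add: line_side_def)
    then have "z \<noteq> \<alpha> \<and> z \<noteq> \<beta>" using l by auto
    then show "z \<noteq> \<alpha> \<and> z \<noteq> \<beta> \<and> (norm z < 1 \<longrightarrow> z \<in> half_disc \<alpha> \<beta> \<epsilon>)"
      using l half_disc_klein by blast
  qed
qed

text \<open>The geodesic enters every disc of the pencil of \<open>\<alpha>\<close>. For interior \<open>\<alpha>\<close> this is clear, as \<open>\<alpha>\<close>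
lies in all of them. For \<open>|\<alpha>| = 1\<close> and a point with Klein coordinate \<open>X\<close>, the quantity \<open>1/leaf - 1\<close> is
\<open>(1 - Re (cnj \<alpha> * X)) / sqrt (1 - |X|\<^sup>2)\<close>. The numerator is of order \<open>\<mu>\<close>, while by strict convexity of
the disc the denominator is at least of order \<open>sqrt \<mu>\<close>.\<close>
lemma leaf_geodesic_tendsto:
  assumes t: "t < 1"
  obtains \<mu>0 where "0 < \<mu>0" "\<mu>0 < 1" "\<And>\<mu>. 0 < \<mu> \<Longrightarrow> \<mu> < \<mu>0 \<Longrightarrow> t < leaf \<alpha> (geodesic \<alpha> \<beta> \<mu>)"
proof (cases "norm \<alpha> < 1")
  case True
  have "geodesic \<alpha> \<beta> 0 = \<alpha>" using unklein_klein ab by (simp add: geodesic_def)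
  moreover have "continuous_on {0..1/2} (\<lambda>\<mu>. leaf \<alpha> (geodesic \<alpha> \<beta> \<mu>))"
  proof (rule continuous_on_compose2[OF continuous_on_leaf])
    show "continuous_on {0..1/2} (geodesic \<alpha> \<beta>)" by (rule continuous_on_subset[OF continuous_on_geodesic]) auto
    show "geodesic \<alpha> \<beta> ` {0..1/2} \<subseteq> geodesic \<alpha> \<beta> ` {0..1/2}" by simp
    have "norm (geodesic \<alpha> \<beta> \<mu>) \<le> 1" if "0 \<le> \<mu>" "\<mu> \<le> 1/2" for \<mu>
      using geodesic_in_disc[of \<mu>] that \<open>geodesic \<alpha> \<beta> 0 = \<alpha>\<close> True by (cases "\<mu> = 0") auto
    then show "geodesic \<alpha> \<beta> ` {0..1/2} \<subseteq> cball 0 1" by auto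
  qed (use True in auto)
  ultimately have "\<exists>d>0. \<forall>x'\<in>{0..1/2}. dist x' 0 < d \<longrightarrow> dist (leaf \<alpha> (geodesic \<alpha> \<beta> x')) 1 < 1 - t"
    using t leaf_self[OF True] unfolding continuous_on_iff by (metis atLeastAtMost_iff diff_gt_0_iff_gt divide_nonneg_nonneg order_refl zero_le_one zero_le_numeral)
  then obtain d where d: "d > 0" "\<And>x. 0 \<le> x \<Longrightarrow> x \<le> 1/2 \<Longrightarrow> x < d \<Longrightarrow> \<bar>leaf \<alpha> (geodesic \<alpha> \<beta> x) - 1\<bar> < 1 - t"
    by (auto simp: dist_real_def)
  show thesis
  proof (rule that[of "min d (1/2)"])
    fix \<mu> assume "0 < \<mu>" "\<mu> < min d (1/2)"
    then show "t < leaf \<alpha> (geodesic \<alpha> \<beta> \<mu>)" using d(2)[of \<mu>] by (simp add: abs_less_iff)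
  qed (use d in auto)
next
  case False
  then have n: "norm \<alpha> = 1" using ab by simp
  have k\<alpha>: "klein \<alpha> = \<alpha>" using n by (simp add: klein_def)
  define D where "D = norm (klein \<alpha> - klein \<beta>)"
  have D: "D > 0" using klein_inj[OF ab] by (simp add: D_def)
  have bound: "1 / leaf \<alpha> (geodesic \<alpha> \<beta> \<mu>) - 1 \<le> 2 * \<mu> / sqrt (\<mu> * (1 - \<mu>) * D\<^sup>2)" if \<mu>: "0 < \<mu>" "\<mu> < 1" for \<mu>
  proof -
    define X where "X = (1 - \<mu>) *\<^sub>R klein \<alpha> + \<mu> *\<^sub>R klein \<beta>"
    define s where "s = sqrt (1 - (norm X)\<^sup>2)"
    let ?z = "geodesic \<alpha> \<beta> \<mu>"
    have z: "?z = unklein X" by (simp add: geodesic_def X_def)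
    have X: "norm X < 1" using klein_geodesic_point[OF \<mu>] by (simp add: X_def)
    have seq: "1 - (norm ?z)\<^sup>2 = 2 * s / (1 + s)" "1 + (norm ?z)\<^sup>2 = 2 / (1 + s)" "0 \<le> s"
      using unklein_sq[of X] X unfolding z s_def by auto
    have "\<mu> * (1 - \<mu>) * D\<^sup>2 \<le> 1 - (norm X)\<^sup>2"
      unfolding X_def D_def using \<mu> by (intro norm_segment norm_klein_le) auto
    then have sl: "sqrt (\<mu> * (1 - \<mu>) * D\<^sup>2) \<le> s" by (simp add: s_def)
    have sp: "0 < sqrt (\<mu> * (1 - \<mu>) * D\<^sup>2)" using \<mu> D by simp
    then have s0: "0 < s" using sl by linarith
    have rz: "Re (cnj \<alpha> * ?z) = Re (cnj \<alpha> * X) / (1 + s)"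
      unfolding z unklein_def s_def[symmetric] by (simp add: Re_divide_of_real del: of_real_add)
    have "(norm (?z - \<alpha>))\<^sup>2 = 1 + (norm ?z)\<^sup>2 - 2 * Re (cnj \<alpha> * ?z)"
      using n unfolding cmod_power2[of "?z - \<alpha>"] cmod_power2[of ?z]
      by (simp add: power2_eq_square algebra_simps cmod_def)
    also have "\<dots> = 2 * (1 - Re (cnj \<alpha> * X)) / (1 + s)"
      unfolding seq rz by (simp add: diff_divide_distrib)
    finally have nz: "(norm (?z - \<alpha>))\<^sup>2 = 2 * (1 - Re (cnj \<alpha> * X)) / (1 + s)" .
    have "1 / leaf \<alpha> ?z - 1 = (norm (?z - \<alpha>))\<^sup>2 / (1 - (norm ?z)\<^sup>2)"
    proof -
      have "1 - (norm ?z)\<^sup>2 \<noteq> 0" unfolding seq(1) using s0 by simp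
      then show ?thesis unfolding leaf_def by (simp add: add_divide_distrib)
    qed
    also have "\<dots> = (1 - Re (cnj \<alpha> * X)) / s"
    proof -
      have "2 * x / (1 + s) / (2 * s / (1 + s)) = x / s" for x
        using s0 by simp
      then show ?thesis unfolding nz seq(1) .
    qed
    also have "1 - Re (cnj \<alpha> * X) = \<mu> * (1 - Re (cnj \<alpha> * klein \<beta>))"
    proof -
      have "Re (cnj \<alpha> * \<alpha>) = 1" using n by (simp add: cmod_def power2_eq_square)
      moreover have "cnj \<alpha> * X = of_real (1 - \<mu>) * (cnj \<alpha> * \<alpha>) + of_real \<mu> * (cnj \<alpha> * klein \<beta>)"
        unfolding X_def k\<alpha> by (simp add: scaleR_conv_of_real algebra_simps)
      then have "Re (cnj \<alpha> * X) = Re (of_real (1 - \<mu>) * (cnj \<alpha> * \<alpha>)) + Re (of_real \<mu> * (cnj \<alpha> * klein \<beta>))"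
        by (simp only: plus_complex.sel)
      then have "Re (cnj \<alpha> * X) = (1 - \<mu>) * Re (cnj \<alpha> * \<alpha>) + \<mu> * Re (cnj \<alpha> * klein \<beta>)"
        unfolding Re_complex_of_real_times .
      ultimately show ?thesis by (simp add: algebra_simps)
    qed
    also have "\<mu> * (1 - Re (cnj \<alpha> * klein \<beta>)) / s \<le> \<mu> * 2 / sqrt (\<mu> * (1 - \<mu>) * D\<^sup>2)"
    proof (intro frac_le mult_left_mono)
      have "\<bar>Re (cnj \<alpha> * klein \<beta>)\<bar> \<le> norm (cnj \<alpha> * klein \<beta>)" by (rule abs_Re_le_cmod)
      also have "\<dots> \<le> 1" using n norm_klein_le[of \<beta>] by (simp add: norm_mult)
      finally show "1 - Re (cnj \<alpha> * klein \<beta>) \<le> 2" by linarith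
    qed (use \<mu> sl sp in auto)
    finally show ?thesis by (simp add: mult.commute)
  qed
  have bound2: "1 / leaf \<alpha> (geodesic \<alpha> \<beta> \<mu>) - 1 \<le> (4 / D) * sqrt \<mu>" if \<mu>: "0 < \<mu>" "\<mu> < 1/2" for \<mu>
  proof -
    have q: "(1/2) * sqrt \<mu> * D \<le> sqrt (\<mu> * (1 - \<mu>) * D\<^sup>2)"
    proof -
      have "(1/2) * sqrt \<mu> * D = sqrt ((1/4) * \<mu> * D\<^sup>2)" using D by (simp add: real_sqrt_mult real_sqrt_divide)
      also have "\<dots> \<le> sqrt (\<mu> * (1 - \<mu>) * D\<^sup>2)" using \<mu> D by simp
      finally show ?thesis .
    qed
    have "2 * \<mu> / sqrt (\<mu> * (1 - \<mu>) * D\<^sup>2) \<le> 2 * \<mu> / ((1/2) * sqrt \<mu> * D)"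
      using \<mu> D by (intro divide_left_mono q mult_pos_pos) auto
    also have "\<dots> = (4 / D) * (\<mu> / sqrt \<mu>)" by simp
    also have "\<mu> / sqrt \<mu> = sqrt \<mu>" using \<mu> by (simp add: real_div_sqrt)
    finally show ?thesis using bound[of \<mu>] \<mu> by linarith
  qed
  \<comment> \<open>a positive level, so that the inequality can be inverted\<close>
  define T where "T = max t (1/2)"
  have T: "t \<le> T" "0 < T" "T < 1" using t by (auto simp: T_def)
  define c where "c = (1 / T - 1) * D / 4"
  have c: "c > 0" using T D by (simp add: c_def field_simps)
  show thesis
  proof (rule that[of "min (1/2) (c\<^sup>2)"])
    show "0 < min (1/2) (c\<^sup>2)" "min (1/2) (c\<^sup>2) < 1" using c by auto
    fix \<mu> assume \<mu>: "0 < \<mu>" "\<mu> < min (1/2) (c\<^sup>2)"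
    have "sqrt \<mu> < sqrt (c\<^sup>2)" using \<mu> by (intro real_sqrt_less_mono) simp
    then have "sqrt \<mu> < c" using c by simp
    then have "(4 / D) * sqrt \<mu> < (4 / D) * c" using D by (intro mult_strict_left_mono) auto
    also have "\<dots> = 1 / T - 1" using D by (simp add: c_def)
    finally have l: "1 / leaf \<alpha> (geodesic \<alpha> \<beta> \<mu>) < 1 / T" using bound2[of \<mu>] \<mu> by linarith
    have "0 < leaf \<alpha> (geodesic \<alpha> \<beta> \<mu>)" using \<mu> by (intro leaf_pos geodesic_in_disc) auto
    then have "T < leaf \<alpha> (geodesic \<alpha> \<beta> \<mu>)" using l T by (simp add: field_simps)
    then show "t < leaf \<alpha> (geodesic \<alpha> \<beta> \<mu>)" using T by linarith
  qed
qed

end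

section \<open>Integrating the extensions over a pencil\<close>

locale extendible_pencil =
  fixes \<alpha> :: complex and n :: nat and f :: "complex \<Rightarrow> complex"
  assumes \<alpha>: "norm \<alpha> \<le> 1" and f: "continuous_on (cball 0 1) f"
    and extends: "\<And>t. 0 \<le> t \<Longrightarrow> t < 1 \<Longrightarrow> extends_disc n f (of_real t * \<alpha>) (pencil_radius \<alpha> t)"
begin

definition pencil_circle :: "real \<Rightarrow> complex \<times> real" where
  "pencil_circle t = (of_real t * \<alpha>, pencil_radius \<alpha> t)"

definition disc_ext :: "real \<Rightarrow> complex \<Rightarrow> complex" where
  "disc_ext t = (SOME K. continuous_on (cball 0 1) K \<and> K holomorphic_on ball 0 1 \<and>
      (\<forall>\<zeta>\<in>sphere 0 1. K \<zeta> = circle_values n f (pencil_circle t) \<zeta>))"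

definition circle_ext :: "real \<Rightarrow> complex \<Rightarrow> complex" where
  "circle_ext t z = disc_ext t ((z - of_real t * \<alpha>) / of_real (pencil_radius \<alpha> t))"

lemma pencil_circle_in: "0 \<le> t \<Longrightarrow> t < 1 \<Longrightarrow> pencil_circle t \<in> circles_in_disc"
  using pencil_bounds[OF \<alpha>, of t] by (simp add: pencil_circle_def circles_in_disc_def norm_mult)

lemma disc_ext_props:
  assumes "0 \<le> t" "t < 1"
  shows "continuous_on (cball 0 1) (disc_ext t)" "disc_ext t holomorphic_on ball 0 1"
    "\<And>\<zeta>. \<zeta> \<in> sphere 0 1 \<Longrightarrow> disc_ext t \<zeta> = circle_values n f (pencil_circle t) \<zeta>"
proof -
  have "\<exists>K. continuous_on (cball 0 1) K \<and> K holomorphic_on ball 0 1 \<and>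
      (\<forall>\<zeta>\<in>sphere 0 1. K \<zeta> = circle_values n f (pencil_circle t) \<zeta>)"
    using extends[OF assms] extends_disc_normalized pencil_bounds(1)[OF \<alpha> assms] unfolding pencil_circle_def by blast
  from someI_ex[OF this, folded disc_ext_def]
  show "continuous_on (cball 0 1) (disc_ext t)" "disc_ext t holomorphic_on ball 0 1"
    "\<And>\<zeta>. \<zeta> \<in> sphere 0 1 \<Longrightarrow> disc_ext t \<zeta> = circle_values n f (pencil_circle t) \<zeta>" by auto
qed

lemma continuous_on_pencil_circle: "continuous_on S pencil_circle"
  unfolding pencil_circle_def[abs_def] pencil_radius_def by (intro continuous_intros)

text \<open>The boundary values depend continuously on the circle, uniformly along it; the maximum principle transfers this to
the extensions.\<close>
lemma continuous_on_disc_ext: "continuous_on ({0..<1} \<times> cball 0 1) (\<lambda>x. disc_ext (fst x) (snd x))"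
  unfolding continuous_on_iff
proof (intro ballI allI impI)
  fix x :: "real \<times> complex" and e :: real
  assume x: "x \<in> {0..<1} \<times> cball 0 1" and e: "0 < e"
  obtain t \<zeta> where x_eq: "x = (t, \<zeta>)" by force
  have t: "0 \<le> t" "t < 1" and \<zeta>: "\<zeta> \<in> cball 0 1" using x by (auto simp: x_eq)
  obtain X where X: "open X" "pencil_circle t \<in> X"
    "\<And>q \<zeta>. q \<in> X \<Longrightarrow> q \<in> circles_in_disc \<Longrightarrow> \<zeta> \<in> sphere 0 1 \<Longrightarrow> dist (circle_values n f q \<zeta>) (circle_values n f (pencil_circle t) \<zeta>) \<le> e/3"
    using circle_values_nearby[OF f pencil_circle_in[OF t], of "e/3" n] e by auto
  have "open (pencil_circle -` X)" using X(1) continuous_on_pencil_circle by (rule open_vimage)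
  then obtain d1 where d1: "d1 > 0" "\<And>s. dist s t < d1 \<Longrightarrow> pencil_circle s \<in> X"
    using X(2) unfolding open_dist by (metis vimageE vimageI)
  obtain d2 where d2: "d2 > 0" "\<And>\<xi>. \<xi> \<in> cball 0 1 \<Longrightarrow> dist \<xi> \<zeta> < d2 \<Longrightarrow> dist (disc_ext t \<xi>) (disc_ext t \<zeta>) < e/3"
    using disc_ext_props(1)[OF t] \<zeta> e unfolding continuous_on_iff by (metis zero_less_divide_iff zero_less_numeral)
  show "\<exists>d>0. \<forall>x'\<in>{0..<1} \<times> cball 0 1. dist x' x < d \<longrightarrow> dist (disc_ext (fst x') (snd x')) (disc_ext (fst x) (snd x)) < e"
  proof (intro exI[of _ "min d1 d2"] conjI ballI impI)
    show "0 < min d1 d2" using d1 d2 by simp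
    fix x' :: "real \<times> complex" assume x': "x' \<in> {0..<1} \<times> cball 0 1" and dx: "dist x' x < min d1 d2"
    obtain s \<xi> where x'_eq: "x' = (s, \<xi>)" by force
    have s: "0 \<le> s" "s < 1" and \<xi>: "\<xi> \<in> cball 0 1" using x' by (auto simp: x'_eq)
    have ds: "dist s t < d1" "dist \<xi> \<zeta> < d2"
      using dx dist_fst_le[of x' x] dist_snd_le[of x' x] by (auto simp: x_eq x'_eq)
    have "norm (disc_ext s \<xi> - disc_ext t \<xi>) \<le> e/3"
    proof (rule max_modulus_disc[where H = "\<lambda>\<xi>. disc_ext s \<xi> - disc_ext t \<xi>"])
      fix \<xi> :: complex assume "\<xi> \<in> sphere 0 1"
      then show "norm (disc_ext s \<xi> - disc_ext t \<xi>) \<le> e/3"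
        using X(3)[OF d1(2)[OF ds(1)] pencil_circle_in[OF s]] disc_ext_props(3)[OF s] disc_ext_props(3)[OF t] by (simp add: dist_norm)
    qed (use \<xi> disc_ext_props[OF s] disc_ext_props[OF t] in \<open>auto intro!: continuous_intros holomorphic_intros\<close>)
    then have "dist (disc_ext s \<xi>) (disc_ext t \<zeta>) < e"
      using d2(2)[OF \<xi> ds(2)] dist_triangle[of "disc_ext s \<xi>" "disc_ext t \<zeta>" "disc_ext t \<xi>"] e by (simp add: dist_norm)
    then show "dist (disc_ext (fst x') (snd x')) (disc_ext (fst x) (snd x)) < e" by (simp add: x_eq x'_eq)
  qed
qed

lemma circle_ext_holomorphic:
  assumes "0 \<le> t" "t < 1"
  shows "circle_ext t holomorphic_on ball (of_real t * \<alpha>) (pencil_radius \<alpha> t)"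
proof -
  have r: "pencil_radius \<alpha> t > 0" using pencil_bounds(1)[OF \<alpha> assms] .
  have "(disc_ext t \<circ> (\<lambda>z. (z - of_real t * \<alpha>) / of_real (pencil_radius \<alpha> t))) holomorphic_on ball (of_real t * \<alpha>) (pencil_radius \<alpha> t)"
    by (rule holomorphic_on_compose_gen[OF _ disc_ext_props(2)[OF assms]])
       (use r in \<open>auto intro!: holomorphic_intros simp: dist_norm norm_divide norm_minus_commute\<close>)
  then show ?thesis by (simp add: o_def circle_ext_def[abs_def])
qed

lemma circle_ext_on_circle:
  assumes "0 \<le> t" "t < 1" "z \<in> sphere (of_real t * \<alpha>) (pencil_radius \<alpha> t)"
  shows "circle_ext t z = (z - of_real t * \<alpha>) ^ n * f z"
proof -
  have r: "pencil_radius \<alpha> t > 0" using pencil_bounds(1)[OF \<alpha> assms(1,2)] .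
  have "(z - of_real t * \<alpha>) / of_real (pencil_radius \<alpha> t) \<in> sphere 0 1"
    using assms(3) r by (simp add: dist_norm norm_divide norm_minus_commute)
  from disc_ext_props(3)[OF assms(1,2) this] show ?thesis
    using r by (simp add: circle_ext_def circle_values_def pencil_circle_def)
qed

lemma continuous_on_circle_ext:
  "continuous_on {x. 0 \<le> snd x \<and> snd x < 1 \<and> fst x \<in> cball (of_real (snd x) * \<alpha>) (pencil_radius \<alpha> (snd x))}
     (\<lambda>x. circle_ext (snd x) (fst x))" (is "continuous_on ?V _")
proof -
  have r: "pencil_radius \<alpha> (snd x) > 0" if "x \<in> ?V" for x using pencil_bounds(1)[OF \<alpha>] that by auto
  have m: "(fst x - of_real (snd x) * \<alpha>) / of_real (pencil_radius \<alpha> (snd x)) \<in> cball 0 1" if "x \<in> ?V" for x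
  proof -
    have "norm (fst x - of_real (snd x) * \<alpha>) \<le> pencil_radius \<alpha> (snd x)"
      using that by (auto simp: dist_norm norm_minus_commute)
    then show ?thesis using r[OF that] by (simp add: norm_divide)
  qed
  have "continuous_on ?V (\<lambda>x. (snd x, (fst x - of_real (snd x) * \<alpha>) / of_real (pencil_radius \<alpha> (snd x))))"
  proof -
    have "continuous_on ?V (\<lambda>x. pencil_radius \<alpha> (snd x))"
      unfolding pencil_radius_def by (intro continuous_intros)
    then show ?thesis using r by (intro continuous_intros) fastforce+
  qed
  then have "continuous_on ?V (\<lambda>x. disc_ext (fst (snd x, (fst x - of_real (snd x) * \<alpha>) / of_real (pencil_radius \<alpha> (snd x))))
      (snd (snd x, (fst x - of_real (snd x) * \<alpha>) / of_real (pencil_radius \<alpha> (snd x)))))"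
    by (rule continuous_on_compose2[OF continuous_on_disc_ext]) (use m in auto)
  then show ?thesis by (simp add: circle_ext_def)
qed

text \<open>The pairs \<open>(z, t)\<close> for which \<open>z\<close> lies on or inside the circle \<open>t\<close>.\<close>
definition fan :: "complex set \<Rightarrow> (complex \<times> real) set" where
  "fan S = {x. fst x \<in> S \<and> 0 \<le> snd x \<and> snd x \<le> leaf \<alpha> (fst x)}"

lemma continuous_on_circle_ext_fan:
  assumes "S \<subseteq> cball 0 1 - {\<alpha>}"
  shows "continuous_on (fan S) (\<lambda>x. circle_ext (snd x) (fst x))"
proof (rule continuous_on_subset[OF continuous_on_circle_ext], rule subsetI)
  fix x assume x: "x \<in> fan S"
  then have z: "norm (fst x) \<le> 1" "fst x \<noteq> \<alpha>" "0 \<le> snd x" "snd x \<le> leaf \<alpha> (fst x)"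
    using assms by (auto simp: fan_def)
  then have "snd x < 1" using leaf_bounds(2)[of "fst x" \<alpha>] by linarith
  then show "x \<in> {x. 0 \<le> snd x \<and> snd x < 1 \<and> fst x \<in> cball (of_real (snd x) * \<alpha>) (pencil_radius \<alpha> (snd x))}"
    using z in_pencil_disc_iff(1)[OF \<alpha>] by auto
qed

definition leaf_integral :: "(complex \<Rightarrow> real \<Rightarrow> complex) \<Rightarrow> complex \<Rightarrow> complex" where
  "leaf_integral \<kappa> z = integral {0..leaf \<alpha> z} (\<lambda>t. circle_ext t z * \<kappa> z t)"

lemma continuous_on_slice:
  assumes "S \<subseteq> cball 0 1 - {\<alpha>}" "continuous_on (fan S) (\<lambda>x. \<kappa> (fst x) (snd x))" "z \<in> S"
  shows "continuous_on {0..leaf \<alpha> z} (\<lambda>t. circle_ext t z * \<kappa> z t)"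
proof -
  have "continuous_on (fan S) (\<lambda>x. circle_ext (snd x) (fst x) * \<kappa> (fst x) (snd x))"
    by (intro continuous_on_mult continuous_on_circle_ext_fan assms)
  then have "continuous_on {0..leaf \<alpha> z} (\<lambda>t. circle_ext (snd (z, t)) (fst (z, t)) * \<kappa> (fst (z, t)) (snd (z, t)))"
    by (rule continuous_on_compose2) (use assms(3) in \<open>auto simp: fan_def intro!: continuous_intros\<close>)
  then show ?thesis by simp
qed

lemma continuous_on_leaf_integral:
  assumes S: "S \<subseteq> cball 0 1 - {\<alpha>}" and \<kappa>: "continuous_on (fan S) (\<lambda>x. \<kappa> (fst x) (snd x))"
  shows "continuous_on S (leaf_integral \<kappa>)"
proof -
  have cl: "continuous_on S (leaf \<alpha>)" using S by (intro continuous_on_leaf) auto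
  have lb: "0 \<le> leaf \<alpha> z" if "z \<in> S" for z
  proof -
    have "z \<in> cball 0 1 - {\<alpha>}" using S that by blast
    then show ?thesis using leaf_bounds(1) by auto
  qed
  have eq: "leaf_integral \<kappa> z = integral {0..1} (\<lambda>x. of_real (leaf \<alpha> z) * (circle_ext (leaf \<alpha> z * x) z * \<kappa> z (leaf \<alpha> z * x)))"
    if z: "z \<in> S" for z
  proof -
    have c: "continuous_on {0..leaf \<alpha> z} (\<lambda>t. circle_ext t z * \<kappa> z t)"
      by (rule continuous_on_slice[OF S \<kappa> z])
    have "((\<lambda>x. leaf \<alpha> z *\<^sub>R (circle_ext (leaf \<alpha> z * x) z * \<kappa> z (leaf \<alpha> z * x))) has_integral
        integral {leaf \<alpha> z * 0..leaf \<alpha> z * 1} (\<lambda>t. circle_ext t z * \<kappa> z t)) {0..1}"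
    proof (rule has_integral_substitution[OF _ _ _ c])
      show "(\<lambda>x. leaf \<alpha> z * x) ` {0..1} \<subseteq> {0..leaf \<alpha> z}" using lb[OF z] by (auto simp: mult_left_le)
      show "((*) (leaf \<alpha> z) has_real_derivative leaf \<alpha> z) (at x within {0..1})" for x
        by (auto intro!: derivative_eq_intros)
    qed (use lb[OF z] in auto)
    from integral_unique[OF this] show ?thesis by (simp add: leaf_integral_def scaleR_conv_of_real)
  qed
  have "continuous_on (fan S) (\<lambda>x. circle_ext (snd x) (fst x) * \<kappa> (fst x) (snd x))"
    by (intro continuous_on_mult continuous_on_circle_ext_fan S \<kappa>)
  then have "continuous_on (S \<times> {0..1}) (\<lambda>x. circle_ext (snd (fst x, leaf \<alpha> (fst x) * snd x)) (fst (fst x, leaf \<alpha> (fst x) * snd x))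
      * \<kappa> (fst (fst x, leaf \<alpha> (fst x) * snd x)) (snd (fst x, leaf \<alpha> (fst x) * snd x)))"
  proof (rule continuous_on_compose2)
    show "continuous_on (S \<times> {0..1}) (\<lambda>x. (fst x, leaf \<alpha> (fst x) * snd x))"
      by (intro continuous_intros continuous_on_compose2[OF cl]) auto
    show "(\<lambda>x. (fst x, leaf \<alpha> (fst x) * snd x)) ` (S \<times> {0..1}) \<subseteq> fan S"
      using lb by (auto simp: fan_def mult_left_le)
  qed
  then have cG: "continuous_on (S \<times> {0..1}) (\<lambda>x. circle_ext (leaf \<alpha> (fst x) * snd x) (fst x) * \<kappa> (fst x) (leaf \<alpha> (fst x) * snd x))"
    by simp
  have "continuous_on (S \<times> cbox 0 1) (\<lambda>(z, x). of_real (leaf \<alpha> z) * (circle_ext (leaf \<alpha> z * x) z * \<kappa> z (leaf \<alpha> z * x)))"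
    unfolding case_prod_beta box_real
    by (intro continuous_on_mult[OF _ cG] continuous_on_of_real continuous_on_compose2[OF cl]) (auto intro!: continuous_intros)
  then have "continuous_on S (\<lambda>z. integral (cbox 0 1) (\<lambda>x. of_real (leaf \<alpha> z) * (circle_ext (leaf \<alpha> z * x) z * \<kappa> z (leaf \<alpha> z * x))))"
    by (rule integral_continuous_on_param)
  then show ?thesis using eq by (simp add: continuous_on_eq)
qed

text \<open>Since \<open>1/leaf\<close> is \<open>slope * corner + offset\<close> with holomorphic \<open>slope\<close> and \<open>offset\<close>, to first order
\<open>leaf\<close> is a holomorphic function minus a multiple of \<open>corner\<close>.\<close>
lemma leaf_expansion:
  assumes z1: "norm z1 < 1"
  defines "t1 \<equiv> of_real (leaf \<alpha> z1) :: complex"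
  shows "((\<lambda>z. of_real (leaf \<alpha> z) + t1\<^sup>2 * slope \<alpha> z1 * corner z
           + t1\<^sup>2 * (slope \<alpha> z * corner z1 + offset \<alpha> z)) has_derivative (\<lambda>h. 0 :: complex)) (at z1)"
    and "leaf \<alpha> differentiable (at z1)"
proof -
  have z1b: "z1 \<in> ball 0 1" using z1 by simp
  have "corner differentiable (at z1)"
  proof -
    have "cnj differentiable (at z1)"
      using bounded_linear_imp_differentiable[OF bounded_linear_cnj] .
    then show ?thesis unfolding corner_def[abs_def]
      using corner_denom_nz[OF z1] by (intro derivative_intros) auto
  qed
  then obtain Dc where Dc: "(corner has_derivative Dc) (at z1)" unfolding differentiable_def by blast
  have "slope \<alpha> field_differentiable at z1"
    unfolding slope_def[abs_def] by (intro derivative_intros)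
  then obtain s' where s': "(slope \<alpha> has_field_derivative s') (at z1)"
    unfolding field_differentiable_def by blast
  have "offset \<alpha> field_differentiable at z1"
    unfolding offset_def[abs_def] by (intro derivative_intros)
  then obtain o' where o': "(offset \<alpha> has_field_derivative o') (at z1)"
    unfolding field_differentiable_def by blast
  note s'' = s'[unfolded has_field_derivative_def] and o'' = o'[unfolded has_field_derivative_def]
  define u where "u z = slope \<alpha> z * corner z + offset \<alpha> z" for z
  define Du where "Du h = slope \<alpha> z1 * Dc h + s' * h * corner z1 + o' * h" for h
  have Du: "(u has_derivative Du) (at z1)"
    unfolding u_def[abs_def] Du_def[abs_def]
    by (rule has_derivative_add[OF has_derivative_mult[OF s'' Dc] o''])
  have t1u: "1 / t1 = u z1" and t1: "t1 \<noteq> 0"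
    using leaf_inverse(1)[OF z1] leaf_pos[OF z1, of \<alpha>] by (auto simp: t1_def u_def)
  then have u1: "u z1 \<noteq> 0" by auto
  have "((\<lambda>z. inverse (u z)) has_derivative (\<lambda>h. - (inverse (u z1) * Du h * inverse (u z1)))) (at z1)"
    by (rule Deriv.has_derivative_inverse[OF u1 Du])
  moreover have "inverse (u z1) = t1" using t1u by (metis inverse_eq_divide inverse_inverse_eq)
  ultimately have inv: "((\<lambda>z. inverse (u z)) has_derivative (\<lambda>h. - (t1\<^sup>2 * Du h))) (at z1)"
    by (simp add: power2_eq_square mult_ac)
  have leaf: "((\<lambda>z. of_real (leaf \<alpha> z) :: complex) has_derivative (\<lambda>h. - (t1\<^sup>2 * Du h))) (at z1)"
  proof (rule has_derivative_transform_within_open[OF inv open_ball z1b])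
    fix z :: complex assume "z \<in> ball 0 1"
    then have z: "norm z < 1" by simp
    show "inverse (u z) = of_real (leaf \<alpha> z)"
      using leaf_inverse(1)[OF z, of \<alpha>] by (metis u_def inverse_eq_divide inverse_inverse_eq)
  qed
  have "((\<lambda>z. of_real (leaf \<alpha> z) + t1\<^sup>2 * slope \<alpha> z1 * corner z
           + t1\<^sup>2 * (slope \<alpha> z * corner z1 + offset \<alpha> z)) has_derivative
        (\<lambda>h. - (t1\<^sup>2 * Du h) + t1\<^sup>2 * slope \<alpha> z1 * Dc h + t1\<^sup>2 * (s' * h * corner z1 + o' * h))) (at z1)"
    by (intro has_derivative_add leaf has_derivative_mult_right Dc has_derivative_mult_left s'' o'')
  moreover have "(\<lambda>h. - (t1\<^sup>2 * Du h) + t1\<^sup>2 * slope \<alpha> z1 * Dc h + t1\<^sup>2 * (s' * h * corner z1 + o' * h)) = (\<lambda>h. 0)"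
    by (rule ext) (simp add: Du_def algebra_simps)
  ultimately show "((\<lambda>z. of_real (leaf \<alpha> z) + t1\<^sup>2 * slope \<alpha> z1 * corner z
           + t1\<^sup>2 * (slope \<alpha> z * corner z1 + offset \<alpha> z)) has_derivative (\<lambda>h. 0 :: complex)) (at z1)"
    by simp
  have "((\<lambda>z. Re (of_real (leaf \<alpha> z))) has_derivative (\<lambda>h. Re (- (t1\<^sup>2 * Du h)))) (at z1)"
    by (rule bounded_linear.has_derivative[OF bounded_linear_Re leaf])
  then show "leaf \<alpha> differentiable (at z1)" unfolding differentiable_def by auto
qed

text \<open>Near \<open>z1\<close>, cut the integral at a fixed parameter slightly below \<open>leaf \<alpha> z1\<close>. The first part is holomorphic. The
second one is, to first order, the integrand at the corner times the length of the interval, and by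
\<open>leaf_expansion\<close> that length is holomorphic up to a multiple of \<open>corner z\<close>. The constant \<open>c\<close> is the
resulting coefficient.\<close>
lemma leaf_integral_nearly_holomorphic:
  assumes S: "open S" "S \<subseteq> ball 0 1 - {\<alpha>}" and z1: "z1 \<in> S"
    and \<kappa>: "continuous_on (fan S) (\<lambda>x. \<kappa> (fst x) (snd x))"
    and \<kappa>h: "\<And>t. 0 \<le> t \<Longrightarrow> (\<lambda>z. \<kappa> z t) holomorphic_on {z \<in> S. t < leaf \<alpha> z}"
    and c: "c = circle_ext (leaf \<alpha> z1) z1 * \<kappa> z1 (leaf \<alpha> z1) * of_real (leaf \<alpha> z1) ^ 2 * slope \<alpha> z1"
    and \<epsilon>: "\<epsilon> > 0"
  shows "\<exists>r0>0. \<forall>r. 0 < r \<and> r < r0 \<longrightarrow> (\<exists>h. h holomorphic_on ball z1 r \<and>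
     (\<forall>z\<in>ball z1 r. norm (leaf_integral \<kappa> z + c * corner z - h z) \<le> \<epsilon> * r))"
proof -
  define t1 where "t1 = leaf \<alpha> z1"
  define g where "g z t = circle_ext t z * \<kappa> z t" for z t
  define Q where "Q = g z1 t1"
  have S': "S \<subseteq> cball 0 1 - {\<alpha>}" using S(2) ball_subset_cball by blast
  have nz1: "norm z1 < 1" using z1 S(2) by auto
  have t1: "0 < t1" using leaf_pos[OF nz1] by (simp add: t1_def)
  have cg: "continuous_on (fan S) (\<lambda>x. g (fst x) (snd x))"
    unfolding g_def by (intro continuous_on_mult continuous_on_circle_ext_fan S' \<kappa>)
  obtain D where D: "(leaf \<alpha> has_derivative D) (at z1)"
    using leaf_expansion(2)[OF nz1] unfolding differentiable_def by blast
  obtain B where B: "\<And>h. norm (D h) \<le> norm h * B" "0 \<le> B"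
    using bounded_linear.nonneg_bounded[OF has_derivative_bounded_linear[OF D]] by blast
  obtain d1 where d1: "d1 > 0" "\<And>z. norm (z - z1) < d1 \<Longrightarrow> norm (leaf \<alpha> z - leaf \<alpha> z1 - D (z - z1)) \<le> 1 * norm (z - z1)"
    using D unfolding has_derivative_at_alt by (metis zero_less_one)
  define L where "L = B + 1"
  have L: "L > 0" using B by (simp add: L_def)
  have lip: "\<bar>leaf \<alpha> z - t1\<bar> \<le> L * norm (z - z1)" if "norm (z - z1) < d1" for z
    using d1(2)[OF that] B(1)[of "z - z1"] by (simp add: t1_def L_def algebra_simps)
  \<comment> \<open>\<open>\<Theta>\<close> is the combination with vanishing derivative from \<open>leaf_expansion\<close>; \<open>p\<close> is its explicit holomorphic part\<close>
  define p where "p z = of_real t1 ^ 2 * (slope \<alpha> z * corner z1 + offset \<alpha> z)" for z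
  define \<Theta> where "\<Theta> z = of_real (leaf \<alpha> z) + of_real t1 ^ 2 * slope \<alpha> z1 * corner z + p z" for z
  have "(\<Theta> has_derivative (\<lambda>h. 0)) (at z1)"
    using leaf_expansion(1)[OF nz1] unfolding \<Theta>_def p_def t1_def by simp
  moreover have e2: "0 < \<epsilon> / (2 * (norm Q + 1))" using \<epsilon> by (simp add: add_nonneg_pos)
  ultimately obtain d2 where d2: "d2 > 0" "\<And>z. norm (z - z1) < d2 \<Longrightarrow> norm (\<Theta> z - \<Theta> z1 - 0) \<le> \<epsilon> / (2 * (norm Q + 1)) * norm (z - z1)"
    unfolding has_derivative_at_alt by metis
  have "(z1, t1) \<in> fan S" using z1 t1 by (simp add: fan_def t1_def)
  moreover have e4: "0 < \<epsilon> / (4 * L)" using \<epsilon> L by simp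
  ultimately obtain d3 where d3: "d3 > 0" "\<And>x. x \<in> fan S \<Longrightarrow> dist x (z1, t1) < d3 \<Longrightarrow> dist (g (fst x) (snd x)) Q < \<epsilon> / (4 * L)"
    using cg unfolding continuous_on_iff Q_def by (metis fst_conv snd_conv)
  obtain d4 where d4: "d4 > 0" "ball z1 d4 \<subseteq> S" using S(1) z1 openE by blast
  define r0 where "r0 = min (min d1 d2) (min (min (d3 / 2) (d3 / (2 * L))) (min d4 (t1 / L)))"
  have r0: "r0 > 0" using d1 d2 d3 d4 t1 L by (simp add: r0_def)
  show ?thesis
  proof (intro exI[of _ r0] conjI allI impI r0)
    fix r assume r: "0 < r \<and> r < r0"
    then have rr: "r < d1" "r < d2" "r < d3 / 2" "r < d3 / (2 * L)" "r < d4" "r < t1 / L"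
      by (auto simp: r0_def)
    have Lr: "L * r < d3 / 2" "L * r < t1" using rr L by (auto simp: field_simps)
    \<comment> \<open>all points of the disc of radius \<open>r\<close> lie inside the circle \<open>ts\<close>, and \<open>leaf\<close> exceeds \<open>ts\<close> by at most \<open>2 * L * r\<close> there\<close>
    define ts where "ts = t1 - L * r"
    have ts: "0 < ts" using Lr by (simp add: ts_def)
    have zr: "z \<in> S" "\<bar>leaf \<alpha> z - t1\<bar> < L * r" "ts < leaf \<alpha> z" "norm (z - z1) < r" "z \<in> cball 0 1 - {\<alpha>}"
      if z: "z \<in> ball z1 r" for z
    proof -
      show n: "norm (z - z1) < r" using z by (simp add: dist_norm norm_minus_commute)
      show "z \<in> S" using d4(2) n rr by (auto simp: dist_norm norm_minus_commute)
      then show "z \<in> cball 0 1 - {\<alpha>}" using S' by blast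
      have "\<bar>leaf \<alpha> z - t1\<bar> \<le> L * norm (z - z1)" using n rr by (intro lip) auto
      also have "\<dots> < L * r" using n L by simp
      finally show "\<bar>leaf \<alpha> z - t1\<bar> < L * r" .
      then show "ts < leaf \<alpha> z" by (simp add: ts_def abs_less_iff)
    qed
    have brS: "ball z1 r \<times> {0..ts} \<subseteq> fan S" using zr by (fastforce simp: fan_def)
    have hol0: "(\<lambda>z. integral {0..ts} (g z)) holomorphic_on ball z1 r"
    proof (rule holomorphic_on_integral)
      show "continuous_on (ball z1 r \<times> {0..ts}) (\<lambda>(z, t). g z t)"
        using continuous_on_subset[OF cg brS] by (simp add: case_prod_beta)
      fix t assume t: "t \<in> {0..ts}"
      have sub: "ball z1 r \<subseteq> {z \<in> S. t < leaf \<alpha> z}" using zr t by fastforce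
      have t1': "t < 1" using zr(3)[of z1] zr(5)[of z1] leaf_bounds(2)[of z1 \<alpha>] t r by auto
      have "ball z1 r \<subseteq> ball (of_real t * \<alpha>) (pencil_radius \<alpha> t)"
      proof
        fix z assume z: "z \<in> ball z1 r"
        then have "t < leaf \<alpha> z" "norm z \<le> 1" "z \<noteq> \<alpha>" using sub zr(5)[OF z] by auto
        then show "z \<in> ball (of_real t * \<alpha>) (pencil_radius \<alpha> t)"
          using in_pencil_disc_iff(2)[OF \<alpha>] t t1' by auto
      qed
      then show "(\<lambda>z. g z t) holomorphic_on ball z1 r"
        unfolding g_def using t t1'
        by (intro holomorphic_intros holomorphic_on_subset[OF circle_ext_holomorphic] holomorphic_on_subset[OF \<kappa>h sub]) auto
    qed simp
    define h where "h z = integral {0..ts} (g z) + Q * (\<Theta> z1 - p z - of_real ts)" for z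
    show "\<exists>h. h holomorphic_on ball z1 r \<and> (\<forall>z\<in>ball z1 r. norm (leaf_integral \<kappa> z + c * corner z - h z) \<le> \<epsilon> * r)"
    proof (intro exI[of _ h] conjI ballI)
      show "h holomorphic_on ball z1 r"
        unfolding h_def p_def slope_def offset_def by (intro holomorphic_intros hol0)
      fix z assume z: "z \<in> ball z1 r"
      note zz = zr[OF z]
      have cgz: "continuous_on {0..leaf \<alpha> z} (g z)"
        unfolding g_def by (rule continuous_on_slice[OF S' \<kappa> zz(1)])
      then have int: "g z integrable_on {0..leaf \<alpha> z}" by (rule integrable_continuous_real)
      have cgz': "continuous_on {ts..leaf \<alpha> z} (g z)" by (rule continuous_on_subset[OF cgz]) (use ts in auto)
      have "leaf_integral \<kappa> z = integral {0..ts} (g z) + integral {ts..leaf \<alpha> z} (g z)"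
        unfolding leaf_integral_def g_def[symmetric]
        using Henstock_Kurzweil_Integration.integral_combine[of 0 ts "leaf \<alpha> z" "g z"] int ts zz(3) by simp
      moreover have "integral {ts..leaf \<alpha> z} (g z) = integral {ts..leaf \<alpha> z} (\<lambda>t. g z t - Q) + of_real (leaf \<alpha> z - ts) * Q"
        using zz(3) integrable_continuous_real[OF cgz']
        by (subst Henstock_Kurzweil_Integration.integral_diff) (auto simp: scaleR_conv_of_real)
      moreover have "c = Q * (of_real t1 ^ 2 * slope \<alpha> z1)"
        unfolding c Q_def g_def t1_def by (simp add: mult_ac)
      ultimately have "leaf_integral \<kappa> z + c * corner z - h z
         = integral {ts..leaf \<alpha> z} (\<lambda>t. g z t - Q) + Q * (\<Theta> z - \<Theta> z1)"
        by (simp add: h_def \<Theta>_def algebra_simps)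
      also have "norm \<dots> \<le> \<epsilon> / (4 * L) * (leaf \<alpha> z - ts) + norm Q * (\<epsilon> / (2 * (norm Q + 1)) * norm (z - z1))"
      proof (intro norm_triangle_mono)
        show "norm (integral {ts..leaf \<alpha> z} (\<lambda>t. g z t - Q)) \<le> \<epsilon> / (4 * L) * (leaf \<alpha> z - ts)"
        proof (rule integral_bound)
          fix t assume t: "t \<in> {ts..leaf \<alpha> z}"
          have "\<bar>t - t1\<bar> \<le> L * r" using t zz(2) by (auto simp: ts_def abs_le_iff abs_less_iff)
          then have "dist (z, t) (z1, t1) < d3"
            using zz(4) Lr rr dist_Pair_Pair[of z t z1 t1] sqrt_sum_squares_le_sum_abs[of "dist z z1" "dist t t1"]
            by (simp add: dist_norm)
          moreover have "(z, t) \<in> fan S" using t ts zz(1) by (simp add: fan_def)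
          ultimately show "norm (g z t - Q) \<le> \<epsilon> / (4 * L)"
            using d3(2)[of "(z, t)"] by (simp add: dist_norm less_imp_le)
        qed (use zz(3) cgz' in \<open>auto intro!: continuous_intros\<close>)
        have "norm (\<Theta> z - \<Theta> z1) \<le> \<epsilon> / (2 * (norm Q + 1)) * norm (z - z1)"
          using d2(2)[of z] zz(4) rr by simp
        then show "norm (Q * (\<Theta> z - \<Theta> z1)) \<le> norm Q * (\<epsilon> / (2 * (norm Q + 1)) * norm (z - z1))"
          unfolding norm_mult by (rule mult_left_mono) simp
      qed
      also have "\<dots> \<le> \<epsilon> / (4 * L) * (2 * (L * r)) + (norm Q + 1) * (\<epsilon> / (2 * (norm Q + 1)) * r)"
      proof (intro add_mono mult_left_mono mult_mono)
        show "leaf \<alpha> z - ts \<le> 2 * (L * r)" using zz(2) by (simp add: ts_def abs_less_iff)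
      qed (use e4 e2 \<epsilon> zz(4) in \<open>auto intro!: divide_nonneg_nonneg mult_nonneg_nonneg add_nonneg_nonneg\<close>)
      also have "\<dots> = \<epsilon> * r"
      proof -
        have "norm Q + 1 \<noteq> 0" by (metis add_nonneg_pos less_irrefl norm_ge_zero zero_less_one)
        moreover have "x * (\<epsilon> / (2 * x) * r) = \<epsilon> / 2 * r" if "x \<noteq> 0" for x :: real using that by simp
        ultimately have "(norm Q + 1) * (\<epsilon> / (2 * (norm Q + 1)) * r) = \<epsilon> / 2 * r" by blast
        moreover have "\<epsilon> / (4 * L) * (2 * (L * r)) = \<epsilon> / 2 * r" using L by simp
        ultimately show ?thesis by (simp only:)
      qed
      finally show "norm (leaf_integral \<kappa> z + c * corner z - h z) \<le> \<epsilon> * r" .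
    qed
  qed
qed

end

section \<open>Comparing two pencils\<close>

definition lagrange :: "(nat \<Rightarrow> complex) \<Rightarrow> nat \<Rightarrow> nat \<Rightarrow> complex poly" where
  "lagrange x n i = (\<Prod>j\<in>{..n} - {i}. smult (1 / (x i - x j)) [:- x j, 1:])"

lemma degree_lagrange:
  assumes "i \<le> n" shows "degree (lagrange x n i) \<le> n"
proof -
  have "degree (lagrange x n i) \<le> (\<Sum>j\<in>{..n} - {i}. degree (smult (1 / (x i - x j)) [:- x j, 1:]))"
  proof -
    have "degree (\<Prod>j\<in>{..n} - {i}. smult (1 / (x i - x j)) [:- x j, 1:])
        \<le> sum (degree \<circ> (\<lambda>j. smult (1 / (x i - x j)) [:- x j, 1:])) ({..n} - {i})"
      by (rule degree_prod_sum_le) simp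
    then show ?thesis unfolding lagrange_def by (simp only: o_def)
  qed
  also have "\<dots> \<le> (\<Sum>j\<in>{..n} - {i}. 1)"
    by (intro sum_mono order_trans[OF degree_smult_le]) simp
  finally show ?thesis using assms by simp
qed

lemma lagrange_interpolation:
  assumes inj: "inj_on x {..n}" and p: "degree p \<le> n"
  shows "p = (\<Sum>i\<le>n. smult (poly p (x i)) (lagrange x n i))" (is "_ = ?q")
proof -
  have node: "poly (lagrange x n i) (x k) = (if k = i then 1 else 0)" if "i \<le> n" "k \<le> n" for i k
  proof (cases "k = i")
    case True
    have "x i - x j \<noteq> 0" if "j \<in> {..n} - {i}" for j
      using inj \<open>i \<le> n\<close> that by (auto dest: inj_onD)
    then have "poly (smult (1 / (x i - x j)) [:- x j, 1:]) (x i) = 1" if "j \<in> {..n} - {i}" for j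
      using that by (simp add: diff_divide_distrib[symmetric])
    then show ?thesis unfolding lagrange_def poly_prod using True by (simp add: prod.neutral)
  next
    case False
    then show ?thesis using that by (auto simp: lagrange_def poly_prod intro!: prod_zero)
  qed
  have q: "degree ?q \<le> n"
    by (intro degree_sum_le) (auto intro: order_trans[OF degree_smult_le] degree_lagrange)
  have "card (x ` {..n}) = Suc n" using inj by (simp add: card_image)
  moreover have "poly (p - ?q) (x k) = 0" if "k \<le> n" for k
  proof -
    have "(\<Sum>i\<le>n. poly p (x i) * poly (lagrange x n i) (x k)) = (\<Sum>i\<le>n. if i = k then poly p (x k) else 0)"
      by (intro sum.cong) (auto simp: node that)
    then show ?thesis using that by (simp add: poly_sum)
  qed
  then have "x ` {..n} \<subseteq> {y. poly (p - ?q) y = 0}" by auto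
  ultimately have "p - ?q = 0"
    using card_poly_roots_bound[of "p - ?q"] poly_roots_finite[of "p - ?q"] card_mono degree_diff_le[OF p q]
    by (metis Suc_n_not_le_n le_trans)
  then show ?thesis by simp
qed

lemma poly_eq_on_interval:
  fixes p q :: "complex poly"
  assumes "a < b" "\<And>t. a < t \<Longrightarrow> t < b \<Longrightarrow> poly p (of_real t) = poly q (of_real t)"
  shows "p = q"
proof (rule ccontr)
  assume "p \<noteq> q"
  then have "finite {x. poly (p - q) x = 0}" by (intro poly_roots_finite) simp
  moreover have "(of_real :: real \<Rightarrow> complex) ` {a<..<b} \<subseteq> {x. poly (p - q) x = 0}" using assms(2) by auto
  ultimately have "finite ((of_real :: real \<Rightarrow> complex) ` {a<..<b})" by (rule finite_subset[rotated])
  then have "finite {a<..<b}" by (rule finite_imageD) (auto simp: inj_on_def)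
  then show False using infinite_Ioo[OF assms(1)] by simp
qed

text \<open>Powers of the Cayley transform become the two types of kernels, with the pole at either of two conjugate points.\<close>
lemma moment_kernel_powi:
  fixes u v :: complex
  assumes "u \<noteq> 0" "v \<noteq> 0"
  shows "(v / u) powi int m / u ^ (n + 2) = v ^ m / u ^ (m + n + 2)"
    and "(v / u) powi (- int (m + n + 2)) / u ^ (n + 2) = u ^ m / v ^ (m + n + 2)"
proof -
  show "(v / u) powi int m / u ^ (n + 2) = v ^ m / u ^ (m + n + 2)"
    by (simp add: power_divide power_add)
  have "(v / u) powi (- int (m + n + 2)) = (u / v) ^ (m + n + 2)"
    by (simp only: power_int_minus power_int_of_nat power_inverse[symmetric] inverse_divide)
  also have "\<dots> = u ^ m * u ^ (n + 2) / v ^ (m + n + 2)"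
    by (simp add: power_divide power_add)
  finally show "(v / u) powi (- int (m + n + 2)) / u ^ (n + 2) = u ^ m / v ^ (m + n + 2)"
    using assms by simp
qed

locale two_pencils =
  a: extendible_pencil \<alpha> n f + b: extendible_pencil \<beta> n f for \<alpha> \<beta> n f +
  assumes neq: "\<alpha> \<noteq> \<beta>"
begin

text \<open>The kernels have a zero and a pole at the points which the coordinate \<open>u = 1/t\<close> of the pencil of \<open>\<alpha>\<close>
places at \<open>cnj \<tau>\<close> and \<open>\<tau>\<close>. The value \<open>pole \<gamma> \<tau> z\<close> is the second point in the coordinate belonging to
the pencil of \<open>\<gamma>\<close>.\<close>
definition pole :: "complex \<Rightarrow> complex \<Rightarrow> complex \<Rightarrow> complex" where
  "pole \<gamma> \<tau> z = offset \<gamma> z + (\<tau> - offset \<alpha> z) / slope \<alpha> z * slope \<gamma> z"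

definition kernel :: "complex \<Rightarrow> complex \<Rightarrow> nat \<Rightarrow> complex \<Rightarrow> real \<Rightarrow> complex" where
  "kernel \<gamma> \<tau> m z t = slope \<gamma> z * (1 - of_real t * pole \<gamma> (cnj \<tau>) z) ^ m / (1 - of_real t * pole \<gamma> \<tau> z) ^ (m + n + 2)"

text \<open>Here the sector between the two rays avoids the pole of the kernel. The unit circle belongs to this set, apart from
\<open>\<alpha>\<close> and \<open>\<beta>\<close>, because both rays have the same direction there.\<close>
definition closed_half :: "complex \<Rightarrow> complex set" where
  "closed_half \<tau> = {z \<in> cball 0 1 - {\<alpha>, \<beta>}. Im \<tau> * side \<alpha> \<beta> z \<le> 0}"

text \<open>The integral of \<open>F\<close>, times a kernel that vanishes to order \<open>n + 2\<close> at infinity, along the boundary of the sector.\<close>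
definition moment :: "complex \<Rightarrow> nat \<Rightarrow> complex \<Rightarrow> complex" where
  "moment \<tau> m z = a.leaf_integral (kernel \<alpha> \<tau> m) z - b.leaf_integral (kernel \<beta> \<tau> m) z"

lemma closed_half_slopes: "z \<in> closed_half \<tau> \<Longrightarrow> slope \<alpha> z \<noteq> 0 \<and> slope \<beta> z \<noteq> 0"
  using slope_nz[OF a.\<alpha>] slope_nz[OF b.\<alpha>] by (auto simp: closed_half_def)

lemma pole_\<alpha>: "slope \<alpha> z \<noteq> 0 \<Longrightarrow> pole \<alpha> \<tau> z = \<tau>"
  by (simp add: pole_def)

lemma half_disc_subset_closed_half: "half_disc \<alpha> \<beta> (Im \<tau>) \<subseteq> closed_half \<tau>"
  by (auto simp: half_disc_def closed_half_def side_def slope_def)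

lemma leaf_pos_disc:
  assumes "norm z \<le> 1" "0 < t" "t \<le> leaf \<gamma> z" shows "norm z < 1"
  using assms leaf_circle[of z \<gamma>] by (cases "norm z = 1") auto

lemma one_minus_pole:
  assumes "norm z < 1" "slope \<alpha> z \<noteq> 0" "slope \<gamma> z \<noteq> 0"
  shows "1 - of_real t * pole \<gamma> \<tau> z = 1 - of_real t * (1 / of_real (leaf \<gamma> z))
      + of_real t * slope \<gamma> z * (1 / of_real (leaf \<alpha> z) - \<tau>) / slope \<alpha> z"
proof -
  define q where "q = (\<tau> - offset \<alpha> z) / slope \<alpha> z"
  have "1 / of_real (leaf \<alpha> z) - \<tau> = slope \<alpha> z * (corner z - q)"
  proof -
    have "slope \<alpha> z * q = \<tau> - offset \<alpha> z" using assms(2) by (simp add: q_def)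
    then show ?thesis unfolding leaf_inverse(1)[OF assms(1)] by (simp add: right_diff_distrib)
  qed
  then have "of_real t * slope \<gamma> z * (1 / of_real (leaf \<alpha> z) - \<tau>) / slope \<alpha> z = of_real t * slope \<gamma> z * (corner z - q)"
    using assms(2) by simp
  then show ?thesis
    unfolding leaf_inverse(1)[OF assms(1), of \<gamma>] pole_def q_def[symmetric] by (simp add: algebra_simps)
qed

lemma pole_avoids_fan_\<alpha>:
  assumes "z \<in> closed_half \<tau>" "Im \<tau> \<noteq> 0"
  shows "1 - of_real t * pole \<alpha> \<tau> z \<noteq> 0"
  using pole_\<alpha> closed_half_slopes[OF assms(1)] cayley_denom_nz(1)[OF assms(2), of t] by simp

text \<open>In the coordinate \<open>u\<close> of the pencil of \<open>\<alpha>\<close>, the ray of \<open>\<beta>\<close> starts at a real point and has the direction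
\<open>slope \<alpha> z / slope \<beta> z\<close>. On \<open>closed_half \<tau>\<close> it does not enter the open half plane that contains \<open>\<tau>\<close>.\<close>
lemma pole_avoids_fan_\<beta>:
  assumes z: "z \<in> closed_half \<tau>" and \<tau>: "Im \<tau> \<noteq> 0" and t: "0 \<le> t" "t \<le> leaf \<beta> z"
  shows "1 - of_real t * pole \<beta> \<tau> z \<noteq> 0"
proof (cases "t = 0")
  case False
  note sl = closed_half_slopes[OF z]
  have z1: "norm z < 1" using leaf_pos_disc[of z t \<beta>] z t False by (auto simp: closed_half_def)
  show ?thesis
  proof
    assume zero: "1 - of_real t * pole \<beta> \<tau> z = 0"
    define x where "x = 1 / t - 1 / leaf \<beta> z"
    have x: "0 \<le> x" using t False leaf_pos[OF z1, of \<beta>] by (simp add: x_def frac_le)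
    define r where "r = slope \<alpha> z / slope \<beta> z"
    have "of_real t * (of_real x + (1 / of_real (leaf \<alpha> z) - \<tau>) / r) = 0"
      using zero False sl unfolding one_minus_pole[OF z1 conjunct1[OF sl] conjunct2[OF sl]] x_def r_def
      by (simp add: field_simps)
    then have "of_real x + (1 / of_real (leaf \<alpha> z) - \<tau>) / r = 0" using False by simp
    then have "of_real x * r + of_real (1 / leaf \<alpha> z) - \<tau> = 0"
      using sl by (simp add: r_def field_simps)
    then have "Im (of_real x * r + of_real (1 / leaf \<alpha> z) - \<tau>) = 0" by (simp only: zero_complex.sel)
    then have "x * Im r = Im \<tau>" by simp
    then have "Im \<tau> * (x * Im r) = (Im \<tau>)\<^sup>2" by (simp add: power2_eq_square)
    moreover have "Im r = side \<alpha> \<beta> z / (norm (slope \<beta> z))\<^sup>2"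
      unfolding r_def side_def complex_div_cnj[of "slope \<alpha> z"] by (simp add: Im_divide_of_real del: of_real_power)
    then have "Im \<tau> * (x * Im r) = x * (Im \<tau> * side \<alpha> \<beta> z) / (norm (slope \<beta> z))\<^sup>2" by simp
    moreover have "x * (Im \<tau> * side \<alpha> \<beta> z) \<le> 0" using x z by (auto simp: closed_half_def intro: mult_nonneg_nonpos)
    moreover from this have "x * (Im \<tau> * side \<alpha> \<beta> z) / (norm (slope \<beta> z))\<^sup>2 \<le> 0" by (intro divide_nonpos_nonneg) auto
    ultimately have "(Im \<tau>)\<^sup>2 \<le> 0" by linarith
    then show False using \<tau> by simp
  qed
qed simp

lemma kernel_continuous:
  assumes "\<And>x. x \<in> F \<Longrightarrow> slope \<alpha> (fst x) \<noteq> 0" "\<And>x. x \<in> F \<Longrightarrow> 1 - of_real (snd x) * pole \<gamma> \<tau> (fst x) \<noteq> 0"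
  shows "continuous_on F (\<lambda>x. kernel \<gamma> \<tau> m (fst x) (snd x))"
proof -
  have p: "continuous_on F (\<lambda>x. pole \<gamma> \<sigma> (fst x))" for \<sigma>
    unfolding pole_def using assms(1)
    by (intro continuous_intros) (auto simp: offset_def slope_def intro!: continuous_intros)
  have s: "continuous_on F (\<lambda>x. slope \<gamma> (fst x))"
    unfolding slope_def by (intro continuous_intros)
  show ?thesis unfolding kernel_def using assms(2) by (intro continuous_intros p s) auto
qed

lemma kernel_holomorphic:
  assumes "\<And>z. z \<in> S \<Longrightarrow> slope \<alpha> z \<noteq> 0" "\<And>z. z \<in> S \<Longrightarrow> 1 - of_real t * pole \<gamma> \<tau> z \<noteq> 0"
  shows "(\<lambda>z. kernel \<gamma> \<tau> m z t) holomorphic_on S"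
proof -
  have so: "slope \<delta> holomorphic_on S" "offset \<delta> holomorphic_on S" for \<delta>
    unfolding slope_def[abs_def] offset_def[abs_def] by (intro holomorphic_intros)+
  have p: "(\<lambda>z. pole \<gamma> \<sigma> z) holomorphic_on S" for \<sigma>
    unfolding pole_def using assms(1) by (intro holomorphic_intros so) auto
  show ?thesis unfolding kernel_def using assms(2) by (intro holomorphic_intros p so) auto
qed

lemma continuous_on_kernels:
  assumes "Im \<tau> \<noteq> 0" "S \<subseteq> closed_half \<tau>"
  shows "continuous_on (a.fan S) (\<lambda>x. kernel \<alpha> \<tau> m (fst x) (snd x))"
    and "continuous_on (b.fan S) (\<lambda>x. kernel \<beta> \<tau> m (fst x) (snd x))"
  using assms closed_half_slopes pole_avoids_fan_\<alpha>[of _ \<tau>] pole_avoids_fan_\<beta>[of _ \<tau>]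
  by (auto intro!: kernel_continuous simp: a.fan_def b.fan_def)

lemma continuous_on_moment:
  assumes "Im \<tau> \<noteq> 0"
  shows "continuous_on (closed_half \<tau>) (moment \<tau> m)"
proof -
  have "closed_half \<tau> \<subseteq> cball 0 1 - {\<alpha>}" "closed_half \<tau> \<subseteq> cball 0 1 - {\<beta>}" by (auto simp: closed_half_def)
  then show ?thesis
    unfolding moment_def[abs_def]
    by (intro continuous_on_diff a.continuous_on_leaf_integral b.continuous_on_leaf_integral continuous_on_kernels assms) auto
qed

lemma moment_circle: "z \<in> closed_half \<tau> \<Longrightarrow> norm z = 1 \<Longrightarrow> moment \<tau> m z = 0"
  by (simp add: moment_def a.leaf_integral_def b.leaf_integral_def leaf_circle)

text \<open>The right-hand side is the same for both pencils. Since the left-hand side is the constant of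
\<open>leaf_integral_nearly_holomorphic\<close>, the contributions of the moving vertex cancel in \<open>moment\<close>.\<close>
lemma endpoint_constant:
  assumes z: "norm z < 1" "slope \<alpha> z \<noteq> 0" "slope \<gamma> z \<noteq> 0"
  shows "(z - of_real (leaf \<gamma> z) * \<gamma>) ^ n * f z * kernel \<gamma> \<tau> m z (leaf \<gamma> z) * of_real (leaf \<gamma> z) ^ 2 * slope \<gamma> z
    = (1 + z * corner z) ^ n * f z * (corner z - (cnj \<tau> - offset \<alpha> z) / slope \<alpha> z) ^ m
        / (corner z - (\<tau> - offset \<alpha> z) / slope \<alpha> z) ^ (m + n + 2)"
proof -
  define l s where "l = (of_real (leaf \<gamma> z) :: complex)" and "s = slope \<gamma> z"
  have l: "l \<noteq> 0" "s \<noteq> 0" using leaf_pos[OF z(1), of \<gamma>] z(3) by (auto simp: l_def s_def)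
  have inv: "1 = l * (s * corner z + offset \<gamma> z)"
    using leaf_inverse(1)[OF z(1), of \<gamma>] l(1) unfolding l_def[symmetric] s_def[symmetric] by (simp add: field_simps)
  have p: "1 - l * pole \<gamma> \<sigma> z = (l * s) * (corner z - (\<sigma> - offset \<alpha> z) / slope \<alpha> z)" for \<sigma>
    unfolding pole_def s_def[symmetric] by (subst inv) (simp add: algebra_simps)
  have alg: "(x * w) ^ n * F * (s * (x * y) ^ m / (x * y') ^ (m + n + 2)) * l\<^sup>2 * s = w ^ n * F * y ^ m / y' ^ (m + n + 2)"
    if "x = l * s" for x w y y' F
  proof -
    have x: "x \<noteq> 0" "l\<^sup>2 * s * s = x\<^sup>2" using l that by (auto simp: power2_eq_square)
    have "(x * w) ^ n * F * (s * (x * y) ^ m / (x * y') ^ N) * l\<^sup>2 * s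
        = (l\<^sup>2 * s * s) * (x ^ n * x ^ m) / x ^ N * (w ^ n * F * y ^ m / y' ^ N)" for N
      by (simp add: power_mult_distrib mult_ac)
    note this[of "m + n + 2"]
    also have "(l\<^sup>2 * s * s) * (x ^ n * x ^ m) = x ^ (m + n + 2)" unfolding x by (simp add: power_add power2_eq_square mult_ac)
    finally show ?thesis using x(1) by simp
  qed
  show ?thesis
    unfolding leaf_inverse(2)[OF z(1)] kernel_def
    unfolding l_def[symmetric] s_def[symmetric] p by (rule alg) simp
qed

lemma moment_holomorphic:
  assumes \<tau>: "Im \<tau> \<noteq> 0"
  shows "moment \<tau> m holomorphic_on half_disc \<alpha> \<beta> (Im \<tau>)"
proof (rule locally_nearly_holomorphic_imp_holomorphic)
  let ?S = "half_disc \<alpha> \<beta> (Im \<tau>)"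
  show "open ?S" by (rule open_half_disc)
  show "continuous_on ?S (moment \<tau> m)"
    using continuous_on_moment[OF \<tau>] half_disc_subset_closed_half continuous_on_subset by blast
  fix x \<epsilon> assume x: "x \<in> ?S" and \<epsilon>: "\<epsilon> > (0::real)"
  have SW: "z \<in> closed_half \<tau>" "norm z < 1" if "z \<in> ?S" for z using that half_disc_subset_closed_half by (auto simp: half_disc_def)
  have sub: "?S \<subseteq> ball 0 1 - {\<alpha>}" "?S \<subseteq> ball 0 1 - {\<beta>}" using SW by (auto simp: closed_half_def)
  have sx: "slope \<alpha> x \<noteq> 0" "slope \<beta> x \<noteq> 0" and nx: "norm x < 1" using closed_half_slopes SW x by auto
  define c where "c = (1 + x * corner x) ^ n * f x * (corner x - (cnj \<tau> - offset \<alpha> x) / slope \<alpha> x) ^ m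
        / (corner x - (\<tau> - offset \<alpha> x) / slope \<alpha> x) ^ (m + n + 2)"
  have xl: "x \<noteq> \<alpha>" "x \<noteq> \<beta>" using sub x by auto
  have ca: "c = a.circle_ext (leaf \<alpha> x) x * kernel \<alpha> \<tau> m x (leaf \<alpha> x) * of_real (leaf \<alpha> x) ^ 2 * slope \<alpha> x"
    unfolding c_def endpoint_constant[OF nx sx(1) sx(1), symmetric]
    using leaf_bounds[of x \<alpha>] nx xl in_pencil_disc_iff(3)[OF a.\<alpha>, of "leaf \<alpha> x" x]
    by (subst a.circle_ext_on_circle) auto
  have cb: "c = b.circle_ext (leaf \<beta> x) x * kernel \<beta> \<tau> m x (leaf \<beta> x) * of_real (leaf \<beta> x) ^ 2 * slope \<beta> x"
    unfolding c_def endpoint_constant[OF nx sx(1) sx(2), symmetric]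
    using leaf_bounds[of x \<beta>] nx xl in_pencil_disc_iff(3)[OF b.\<alpha>, of "leaf \<beta> x" x]
    by (subst b.circle_ext_on_circle) auto
  have ha: "(\<lambda>z. kernel \<alpha> \<tau> m z t) holomorphic_on {z \<in> ?S. t < leaf \<alpha> z}" if "0 \<le> t" for t
    using closed_half_slopes SW pole_avoids_fan_\<alpha>[OF _ \<tau>] by (intro kernel_holomorphic) auto
  have hb: "(\<lambda>z. kernel \<beta> \<tau> m z t) holomorphic_on {z \<in> ?S. t < leaf \<beta> z}" if "0 \<le> t" for t
    using closed_half_slopes SW pole_avoids_fan_\<beta>[OF _ \<tau>] that by (intro kernel_holomorphic) auto
  have e2: "\<epsilon> / 2 > 0" using \<epsilon> by simp
  obtain r1 where r1: "r1 > 0" "\<And>r. 0 < r \<Longrightarrow> r < r1 \<Longrightarrow> \<exists>h. h holomorphic_on ball x r \<and>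
     (\<forall>z\<in>ball x r. norm (a.leaf_integral (kernel \<alpha> \<tau> m) z + c * corner z - h z) \<le> \<epsilon> / 2 * r)"
    using a.leaf_integral_nearly_holomorphic[OF open_half_disc sub(1) x continuous_on_kernels(1)[OF \<tau> half_disc_subset_closed_half] ha ca e2]
    by blast
  obtain r2 where r2: "r2 > 0" "\<And>r. 0 < r \<Longrightarrow> r < r2 \<Longrightarrow> \<exists>h. h holomorphic_on ball x r \<and>
     (\<forall>z\<in>ball x r. norm (b.leaf_integral (kernel \<beta> \<tau> m) z + c * corner z - h z) \<le> \<epsilon> / 2 * r)"
    using b.leaf_integral_nearly_holomorphic[OF open_half_disc sub(2) x continuous_on_kernels(2)[OF \<tau> half_disc_subset_closed_half] hb cb e2]
    by blast
  show "\<exists>r0>0. \<forall>r. 0 < r \<and> r < r0 \<longrightarrow>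
        (\<exists>h. h holomorphic_on ball x r \<and> (\<forall>z\<in>ball x r. norm (moment \<tau> m z - h z) \<le> \<epsilon> * r))"
  proof (intro exI[of _ "min r1 r2"] conjI allI impI)
    show "0 < min r1 r2" using r1 r2 by simp
    fix r assume r: "0 < r \<and> r < min r1 r2"
    obtain h1 where h1: "h1 holomorphic_on ball x r"
      "\<And>z. z\<in>ball x r \<Longrightarrow> norm (a.leaf_integral (kernel \<alpha> \<tau> m) z + c * corner z - h1 z) \<le> \<epsilon> / 2 * r"
      using r1(2)[of r] r by auto
    obtain h2 where h2: "h2 holomorphic_on ball x r"
      "\<And>z. z\<in>ball x r \<Longrightarrow> norm (b.leaf_integral (kernel \<beta> \<tau> m) z + c * corner z - h2 z) \<le> \<epsilon> / 2 * r"
      using r2(2)[of r] r by auto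
    show "\<exists>h. h holomorphic_on ball x r \<and> (\<forall>z\<in>ball x r. norm (moment \<tau> m z - h z) \<le> \<epsilon> * r)"
    proof (intro exI[of _ "\<lambda>z. h1 z - h2 z"] conjI ballI)
      show "(\<lambda>z. h1 z - h2 z) holomorphic_on ball x r" by (intro holomorphic_intros h1 h2)
      fix z assume z: "z \<in> ball x r"
      have "moment \<tau> m z - (h1 z - h2 z) = (a.leaf_integral (kernel \<alpha> \<tau> m) z + c * corner z - h1 z)
          - (b.leaf_integral (kernel \<beta> \<tau> m) z + c * corner z - h2 z)" by (simp add: moment_def)
      also have "norm \<dots> \<le> \<epsilon> / 2 * r + \<epsilon> / 2 * r"
        by (rule norm_triangle_le_diff[OF add_mono[OF h1(2)[OF z] h2(2)[OF z]]])
      finally show "norm (moment \<tau> m z - (h1 z - h2 z)) \<le> \<epsilon> * r" by simp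
    qed
  qed
qed

lemma moment_zero_half:
  assumes \<tau>: "Im \<tau> \<noteq> 0" and z: "z \<in> half_disc \<alpha> \<beta> (Im \<tau>)"
  shows "moment \<tau> m z = 0"
proof -
  obtain \<zeta> e where \<zeta>: "norm \<zeta> = 1" "0 < e" "\<And>z. norm z \<le> 1 \<Longrightarrow> 1 - e \<le> Re (cnj \<zeta> * z) \<Longrightarrow> z \<noteq> \<alpha> \<and> z \<noteq> \<beta> \<and> (norm z < 1 \<longrightarrow> z \<in> half_disc \<alpha> \<beta> (Im \<tau>))"
    using half_boundary_arc[OF a.\<alpha> b.\<alpha> neq \<tau>] by blast
  define U where "U = {z. norm z \<le> 1 \<and> 1 - e \<le> Re (cnj \<zeta> * z)}"
  define V where "V = {z. norm z < 1 \<and> 1 - e < Re (cnj \<zeta> * z)}"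
  have side1: "side \<alpha> \<beta> z = 0" if "norm z = 1" for z unfolding side_klein using that by simp
  have UW: "U \<subseteq> closed_half \<tau>"
  proof
    fix z assume z: "z \<in> U"
    then have "z \<noteq> \<alpha>" "z \<noteq> \<beta>" "norm z < 1 \<Longrightarrow> z \<in> half_disc \<alpha> \<beta> (Im \<tau>)" "norm z \<le> 1" using \<zeta>(3) by (auto simp: U_def)
    then show "z \<in> closed_half \<tau>" using half_disc_subset_closed_half side1[of z] by (cases "norm z = 1") (auto simp: closed_half_def)
  qed
  have intU: "interior U \<subseteq> half_disc \<alpha> \<beta> (Im \<tau>)"
  proof
    fix z assume z: "z \<in> interior U"
    have "interior U \<subseteq> interior (cball 0 1)" by (intro interior_mono) (auto simp: U_def)
    then have "norm z < 1" using z by auto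
    then show "z \<in> half_disc \<alpha> \<beta> (Im \<tau>)" using \<zeta>(3) interior_subset z by (auto simp: U_def)
  qed
  have V0: "moment \<tau> m z = 0" if "z \<in> V" for z
  proof (rule holomorphic_zero_near_boundary_arc[OF \<zeta>(1,2) U_def, where M = "moment \<tau> m"])
    show "continuous_on U (moment \<tau> m)" using continuous_on_moment[OF \<tau>] UW continuous_on_subset by blast
    show "moment \<tau> m holomorphic_on interior U" using moment_holomorphic[OF \<tau>] intU holomorphic_on_subset by blast
    show "\<And>z. z \<in> U \<Longrightarrow> norm z = 1 \<Longrightarrow> moment \<tau> m z = 0" using moment_circle UW by blast
  qed (use that in \<open>auto simp: V_def\<close>)
  have "open V" unfolding V_def by (intro open_Collect_conj open_Collect_less continuous_intros)
  moreover have "V \<subseteq> half_disc \<alpha> \<beta> (Im \<tau>)" using \<zeta>(3) by (auto simp: V_def)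
  moreover have "V \<noteq> {}"
  proof -
    define d where "d = min e 1 / 2"
    have d: "0 < d" "d < e" "d < 1" using \<zeta>(2) by (auto simp: d_def)
    have "cnj \<zeta> * (of_real (1 - d) * \<zeta>) = of_real (1 - d)"
      using complex_norm_square[of \<zeta>] \<zeta>(1) by (simp add: mult_ac)
    then have "Re (cnj \<zeta> * (of_real (1 - d) * \<zeta>)) = 1 - d" by (simp only: Re_complex_of_real)
    moreover have "norm (of_real (1 - d) * \<zeta>) = 1 - d" unfolding norm_mult norm_of_real using \<zeta>(1) d by simp
    ultimately have "of_real (1 - d) * \<zeta> \<in> V" using d unfolding V_def by simp
    then show ?thesis by blast
  qed
  ultimately show ?thesis
    using analytic_continuation_open[of V "half_disc \<alpha> \<beta> (Im \<tau>)" "moment \<tau> m" "\<lambda>_. 0" z]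
      open_half_disc connected_half_disc moment_holomorphic[OF \<tau>] V0 z by auto
qed

lemma geodesic_in_closed_half:
  assumes "0 < \<mu>" "\<mu> < 1"
  shows "geodesic \<alpha> \<beta> \<mu> \<in> closed_half \<tau>"
proof -
  obtain q where q: "q < 0" "slope \<alpha> (geodesic \<alpha> \<beta> \<mu>) = of_real q * slope \<beta> (geodesic \<alpha> \<beta> \<mu>)" "slope \<beta> (geodesic \<alpha> \<beta> \<mu>) \<noteq> 0"
    using slope_geodesic[OF a.\<alpha> b.\<alpha> neq assms] by blast
  have "side \<alpha> \<beta> (geodesic \<alpha> \<beta> \<mu>) = 0"
    unfolding side_def q(2) mult.assoc complex_norm_square[symmetric] by simp
  moreover have "slope \<alpha> (geodesic \<alpha> \<beta> \<mu>) \<noteq> 0" using q by simp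
  then have "geodesic \<alpha> \<beta> \<mu> \<noteq> \<alpha>" "geodesic \<alpha> \<beta> \<mu> \<noteq> \<beta>" using q(3) by (auto simp: slope_def)
  ultimately show ?thesis using geodesic_in_disc[OF a.\<alpha> b.\<alpha> neq assms] by (simp add: closed_half_def)
qed

lemma moment_zero_geodesic:
  assumes \<tau>: "Im \<tau> \<noteq> 0" and \<mu>: "0 < \<mu>" "\<mu> < 1"
  shows "moment \<tau> m (geodesic \<alpha> \<beta> \<mu>) = 0"
proof -
  have "\<exists>x. (\<forall>j. x j \<in> half_disc \<alpha> \<beta> (Im \<tau>)) \<and> x \<longlonglongrightarrow> geodesic \<alpha> \<beta> \<mu>"
    using geodesic_in_closure_half[OF a.\<alpha> b.\<alpha> neq \<mu> \<tau>] by (simp only: closure_sequential)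
  then obtain x where "\<forall>j. x j \<in> half_disc \<alpha> \<beta> (Im \<tau>)" and lim: "x \<longlonglongrightarrow> geodesic \<alpha> \<beta> \<mu>" by (elim exE conjE)
  then have x: "x j \<in> half_disc \<alpha> \<beta> (Im \<tau>)" "x j \<in> closed_half \<tau>" for j using half_disc_subset_closed_half by auto
  have "(\<lambda>j. moment \<tau> m (x j)) \<longlonglongrightarrow> moment \<tau> m (geodesic \<alpha> \<beta> \<mu>)"
    by (rule continuous_on_tendsto_compose[OF continuous_on_moment[OF \<tau>] lim geodesic_in_closed_half[OF \<mu>]]) (simp add: x(2))
  then have "(\<lambda>j::nat. 0) \<longlonglongrightarrow> moment \<tau> m (geodesic \<alpha> \<beta> \<mu>)" by (simp only: moment_zero_half[OF \<tau> x(1)])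
  then show ?thesis by (simp only: LIMSEQ_const_iff)
qed

text \<open>Between \<open>\<alpha>\<close> and \<open>\<beta>\<close> the two rays form a line, which is the real line in the coordinate \<open>u = 1/t\<close>. The
moments for \<open>\<tau> = \<i>\<close> and \<open>\<tau> = -\<i>\<close>, obtained from the two sides of the geodesic, are the Fourier
coefficients required by \<open>moments_imp_polynomial\<close>.\<close>
lemma circle_ext_polynomial_on_geodesic:
  assumes \<mu>: "0 < \<mu>" "\<mu> < 1"
  shows "\<exists>p::complex poly. degree p \<le> n \<and> (\<forall>t\<in>{0..leaf \<alpha> (geodesic \<alpha> \<beta> \<mu>)}. a.circle_ext t (geodesic \<alpha> \<beta> \<mu>) = poly p (of_real t))"
proof -
  define z where "z = geodesic \<alpha> \<beta> \<mu>"
  have z1: "norm z < 1" using geodesic_in_disc[OF a.\<alpha> b.\<alpha> neq \<mu>] by (simp add: z_def)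
  have zW: "z \<in> closed_half \<tau>" for \<tau> using geodesic_in_closed_half[OF \<mu>] by (simp add: z_def)
  note sl = closed_half_slopes[OF zW]
  have zab: "z \<noteq> \<alpha>" "z \<noteq> \<beta>" using zW by (auto simp: closed_half_def)
  obtain q where q: "q < 0" "slope \<alpha> z = of_real q * slope \<beta> z"
    using slope_geodesic[OF a.\<alpha> b.\<alpha> neq \<mu>] unfolding z_def by blast
  define r where "r = 1 / q"
  have r: "r < 0" "slope \<beta> z / slope \<alpha> z = of_real r" using q sl by (auto simp: r_def field_simps)
  define la lb where "la = leaf \<alpha> z" and "lb = leaf \<beta> z"
  have l: "0 < la" "0 < lb" using leaf_pos[OF z1] by (auto simp: la_def lb_def)
  have pole: "1 - of_real t * pole \<beta> \<tau> z = 1 - of_real t * (of_real (1 / lb - r / la) + of_real r * \<tau>)" for t \<tau>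
  proof -
    have "of_real t * slope \<beta> z * (1 / of_real la - \<tau>) / slope \<alpha> z = of_real t * (slope \<beta> z / slope \<alpha> z) * (1 / of_real la - \<tau>)"
      by simp
    then show ?thesis
      unfolding one_minus_pole[OF z1 conjunct1[OF sl] conjunct2[OF sl]] la_def[symmetric] lb_def[symmetric] r(2)
      by (simp add: algebra_simps)
  qed
  define \<sigma> where "\<sigma> = of_real (1 / lb - r / la) + of_real r * \<i>"
  have p\<i>: "1 - of_real t * pole \<beta> \<i> z = 1 - of_real t * \<sigma>"
    and pm\<i>: "1 - of_real t * pole \<beta> (- \<i>) z = 1 - of_real t * cnj \<sigma>" for t
    unfolding pole \<sigma>_def by simp_all
  have "cayley \<i> la = cayley \<sigma> lb"
  proof -
    have "1 - of_real lb * \<sigma> = of_real (r * lb / la) * (1 - of_real la * \<i>)"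
      "1 - of_real lb * cnj \<sigma> = of_real (r * lb / la) * (1 - of_real la * cnj \<i>)"
      using l by (simp_all add: \<sigma>_def complex_eq_iff field_simps)
    moreover have "of_real (r * lb / la) \<noteq> (0::complex)" using r l by simp
    ultimately show ?thesis unfolding cayley_def by (simp only: mult_divide_mult_cancel_left not_False_eq_True)
  qed
  then interpret two_arcs \<i> \<sigma> la lb
    using r l by unfold_locales (auto simp: \<sigma>_def)
  have cz: "continuous_on {0..la} (\<lambda>t. a.circle_ext t z)" "continuous_on {0..lb} (\<lambda>t. b.circle_ext t z)"
    using a.continuous_on_slice[of "{z}" "\<lambda>_ _. 1" z] b.continuous_on_slice[of "{z}" "\<lambda>_ _. 1" z] z1 zab
    by (auto simp: la_def lb_def)
  have "\<exists>p::complex poly. degree p \<le> n \<and> (\<forall>t\<in>{0..la}. a.circle_ext t z * slope \<alpha> z = poly p (of_real t))"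
  proof (rule moments_imp_polynomial)
    show "continuous_on {0..la} (\<lambda>t. a.circle_ext t z * slope \<alpha> z)" "continuous_on {0..lb} (\<lambda>t. b.circle_ext t z * slope \<beta> z)"
      by (intro continuous_intros cz)+
    fix k :: int assume k: "0 \<le> k \<or> k \<le> - int n - 2"
    have A: "cayley \<kappa> t powi int m / (1 - of_real t * \<kappa>) ^ (n + 2) = (1 - of_real t * cnj \<kappa>) ^ m / (1 - of_real t * \<kappa>) ^ (m + n + 2)"
      and B: "cayley \<kappa> t powi (- int (m + n + 2)) / (1 - of_real t * \<kappa>) ^ (n + 2) = (1 - of_real t * \<kappa>) ^ m / (1 - of_real t * cnj \<kappa>) ^ (m + n + 2)"
      if "Im \<kappa> \<noteq> 0" for \<kappa> t m
      unfolding cayley_def by (rule moment_kernel_powi[OF cayley_denom_nz[OF that]])+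
    note sp = pole_\<alpha>[OF conjunct1[OF sl]] and cs = complex_cnj_i complex_cnj_minus minus_minus
    have "\<exists>\<tau> m. Im \<tau> \<noteq> 0 \<and>
        (\<forall>t. slope \<alpha> z * cayley \<i> t powi k / (1 - of_real t * \<i>) ^ (n + 2) = kernel \<alpha> \<tau> m z t) \<and>
        (\<forall>t. slope \<beta> z * cayley \<sigma> t powi k / (1 - of_real t * \<sigma>) ^ (n + 2) = kernel \<beta> \<tau> m z t)"
    proof (cases "0 \<le> k")
      case True
      then obtain m where m: "k = int m" using nonneg_int_cases by blast
      have "slope \<alpha> z * cayley \<i> t powi k / (1 - of_real t * \<i>) ^ (n + 2) = kernel \<alpha> \<i> m z t"
        "slope \<beta> z * cayley \<sigma> t powi k / (1 - of_real t * \<sigma>) ^ (n + 2) = kernel \<beta> \<i> m z t" for t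
        unfolding kernel_def sp m times_divide_eq_right[symmetric] A[OF im_nz(1)] A[OF im_nz(2)] cs p\<i> pm\<i> by (rule refl)+
      then show ?thesis by (intro exI[of _ \<i>] exI[of _ m]) simp
    next
      case False
      define m where "m = nat (- k - int n - 2)"
      have m: "k = - int (m + n + 2)" using False k by (simp add: m_def)
      have "slope \<alpha> z * cayley \<i> t powi k / (1 - of_real t * \<i>) ^ (n + 2) = kernel \<alpha> (- \<i>) m z t"
        "slope \<beta> z * cayley \<sigma> t powi k / (1 - of_real t * \<sigma>) ^ (n + 2) = kernel \<beta> (- \<i>) m z t" for t
        unfolding kernel_def sp m times_divide_eq_right[symmetric] B[OF im_nz(1)] B[OF im_nz(2)] cs p\<i> pm\<i> by (rule refl)+
      then show ?thesis by (intro exI[of _ "- \<i>"] exI[of _ m]) simp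
    qed
    then obtain \<tau> m where \<tau>: "Im \<tau> \<noteq> 0"
       "\<And>t. slope \<alpha> z * cayley \<i> t powi k / (1 - of_real t * \<i>) ^ (n + 2) = kernel \<alpha> \<tau> m z t"
       "\<And>t. slope \<beta> z * cayley \<sigma> t powi k / (1 - of_real t * \<sigma>) ^ (n + 2) = kernel \<beta> \<tau> m z t" by blast
    have "a.leaf_integral (kernel \<alpha> \<tau> m) z = b.leaf_integral (kernel \<beta> \<tau> m) z"
      using moment_zero_geodesic[OF \<tau>(1) \<mu>, of m] by (simp add: moment_def z_def)
    then show "integral {0..la} (\<lambda>t. a.circle_ext t z * slope \<alpha> z * cayley \<i> t powi k / (1 - of_real t * \<i>) ^ (n + 2))
      = integral {0..lb} (\<lambda>s. b.circle_ext s z * slope \<beta> z * cayley \<sigma> s powi k / (1 - of_real s * \<sigma>) ^ (n + 2))"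
      unfolding a.leaf_integral_def b.leaf_integral_def \<tau>(2,3)[symmetric] la_def[symmetric] lb_def[symmetric]
      by (simp add: mult.assoc)
  qed
  then obtain p where p: "degree p \<le> n" "\<And>t. t\<in>{0..la} \<Longrightarrow> a.circle_ext t z * slope \<alpha> z = poly p (of_real t)" by blast
  have "a.circle_ext t z = poly (smult (1 / slope \<alpha> z) p) (of_real t)" if "t \<in> {0..la}" for t
    using p(2)[OF that, symmetric] sl by simp
  then show ?thesis
    using p(1) degree_smult_le[of "1 / slope \<alpha> z" p] unfolding z_def[symmetric] la_def[symmetric]
    by (intro exI[of _ "smult (1 / slope \<alpha> z) p"]) auto
qed

end

section \<open>From the geodesic to the disc\<close>

definition node :: "nat \<Rightarrow> real \<Rightarrow> nat \<Rightarrow> real" where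
  "node n \<delta> i = \<delta> * real i / real (n + 1)"

lemma node_bounds:
  assumes "0 < \<delta>" "i \<le> n" shows "0 \<le> node n \<delta> i" "node n \<delta> i < \<delta>"
proof -
  have "real i / real (n + 1) < 1" using assms(2) by simp
  then have "\<delta> * (real i / real (n + 1)) < \<delta> * 1" using assms(1) by (intro mult_strict_left_mono)
  then show "0 \<le> node n \<delta> i" "node n \<delta> i < \<delta>" using assms(1) by (simp_all add: node_def)
qed

lemma node_inj: "0 < \<delta> \<Longrightarrow> inj_on (\<lambda>i. of_real (node n \<delta> i) :: complex) {..n}"
  unfolding inj_on_def of_real_eq_iff by (simp add: node_def)

definition node_poly :: "nat \<Rightarrow> real \<Rightarrow> nat \<Rightarrow> complex poly" where
  "node_poly n \<delta> = lagrange (\<lambda>i. of_real (node n \<delta> i)) n"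

lemma leaf_le_1: "norm z \<le> 1 \<Longrightarrow> leaf \<alpha> z \<le> 1"
  using leaf_bounds(2)[of z \<alpha>] leaf_self[of \<alpha>] leaf_circle[of z \<alpha>]
  by (cases "z = \<alpha>"; cases "norm z = 1") auto

text \<open>For fixed \<open>t\<close> both sides are holomorphic in \<open>z\<close>, and on the part of the geodesic inside the circle they agree by
Lagrange's formula. Interpolation at fixed parameters expresses polynomial dependence on \<open>t\<close> by a formula to which
the identity theorem in \<open>z\<close> applies.\<close>
lemma (in two_pencils) circle_ext_interpolation:
  assumes \<delta>: "0 < \<delta>" "\<delta> < leaf \<alpha> z" and z: "norm z < 1" and t: "0 \<le> t" "t < leaf \<alpha> z"
  shows "a.circle_ext t z = (\<Sum>i\<le>n. a.circle_ext (node n \<delta> i) z * poly (node_poly n \<delta> i) (of_real t))"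
proof -
  define T where "T = max t \<delta>"
  have T: "0 < T" "t \<le> T" "\<delta> \<le> T" "T < leaf \<alpha> z" using \<delta> t by (auto simp: T_def)
  have T1: "T < 1" using T(4) leaf_le_1[of z \<alpha>] z by linarith
  define D where "D = ball (of_real T * \<alpha>) (pencil_radius \<alpha> T)"
  have Dball: "D \<subseteq> ball 0 1"
  proof -
    have "interior D \<subseteq> interior (cball 0 1)"
      using pencil_disc_subset[OF a.\<alpha> less_imp_le[OF T(1)] T1] by (intro interior_mono) (auto simp: D_def)
    then show ?thesis by (simp add: D_def)
  qed
  have inD: "w \<in> D \<longleftrightarrow> T < leaf \<alpha> w" if "norm w < 1" for w
    unfolding D_def using in_pencil_disc_iff(2)[OF a.\<alpha> less_imp_le[OF T(1)] T1] that by simp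
  have sub: "D \<subseteq> ball (of_real s * \<alpha>) (pencil_radius \<alpha> s)" if s: "0 \<le> s" "s \<le> T" for s
  proof
    fix w assume w: "w \<in> D"
    then have "norm w < 1" using Dball by auto
    moreover have "s < 1" using s T1 by simp
    ultimately show "w \<in> ball (of_real s * \<alpha>) (pencil_radius \<alpha> s)"
      using in_pencil_disc_iff(2)[OF a.\<alpha> s(1), of w] inD w s by simp
  qed
  have hol: "a.circle_ext s holomorphic_on D" if s: "0 \<le> s" "s \<le> T" for s
    using holomorphic_on_subset[OF a.circle_ext_holomorphic sub[OF s]] s T1 by auto
  define E where "E w = a.circle_ext t w - (\<Sum>i\<le>n. a.circle_ext (node n \<delta> i) w * poly (node_poly n \<delta> i) (of_real t))" for w
  have Ehol: "E holomorphic_on D"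
  proof -
    have "0 \<le> node n \<delta> i \<and> node n \<delta> i \<le> T" if "i \<le> n" for i
      using node_bounds[OF \<delta>(1) that] T by linarith
    then show ?thesis unfolding E_def using t T by (intro holomorphic_intros hol) auto
  qed
  obtain \<mu>0 where \<mu>0: "0 < \<mu>0" "\<mu>0 < 1" "\<And>\<mu>. 0 < \<mu> \<Longrightarrow> \<mu> < \<mu>0 \<Longrightarrow> T < leaf \<alpha> (geodesic \<alpha> \<beta> \<mu>)"
    using leaf_geodesic_tendsto[OF a.\<alpha> b.\<alpha> neq T1] by blast
  define A where "A = geodesic \<alpha> \<beta> ` {0<..<\<mu>0}"
  have segD: "geodesic \<alpha> \<beta> \<mu> \<in> D" if "0 < \<mu>" "\<mu> < \<mu>0" for \<mu>
    using inD[OF geodesic_in_disc[OF a.\<alpha> b.\<alpha> neq]] \<mu>0 that by simp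
  have E0: "E w = 0" if w: "w \<in> A" for w
  proof -
    obtain \<mu> where \<mu>: "0 < \<mu>" "\<mu> < \<mu>0" "w = geodesic \<alpha> \<beta> \<mu>" using w by (auto simp: A_def)
    obtain p where p: "degree p \<le> n" "\<And>s. s\<in>{0..leaf \<alpha> w} \<Longrightarrow> a.circle_ext s w = poly p (of_real s)"
      using circle_ext_polynomial_on_geodesic[of \<mu>] \<mu> \<mu>0 by auto
    have l: "T < leaf \<alpha> w" using \<mu> \<mu>0 by simp
    have "p = (\<Sum>i\<le>n. smult (poly p (of_real (node n \<delta> i))) (node_poly n \<delta> i))"
      unfolding node_poly_def by (rule lagrange_interpolation[OF node_inj[OF \<delta>(1)] p(1)])
    then have "poly p (of_real t) = (\<Sum>i\<le>n. poly p (of_real (node n \<delta> i)) * poly (node_poly n \<delta> i) (of_real t))"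
      by (metis (no_types, lifting) poly_smult poly_sum sum.cong)
    moreover have "poly p (of_real (node n \<delta> i)) = a.circle_ext (node n \<delta> i) w" if "i \<le> n" for i
      using node_bounds[OF \<delta>(1) that] T l by (intro p(2)[symmetric]) simp
    moreover have "poly p (of_real t) = a.circle_ext t w" using t T l by (intro p(2)[symmetric]) simp
    ultimately show "E w = 0" by (simp add: E_def)
  qed
  have "geodesic \<alpha> \<beta> (\<mu>0/2) islimpt A"
    unfolding islimpt_approachable
  proof (intro allI impI)
    fix e :: real assume e: "e > 0"
    have m: "\<mu>0/2 \<in> {0..1}" using \<mu>0 by auto
    then obtain d where d: "d > 0" "\<And>x. x\<in>{0..1} \<Longrightarrow> dist x (\<mu>0/2) < d \<Longrightarrow> dist (geodesic \<alpha> \<beta> x) (geodesic \<alpha> \<beta> (\<mu>0/2)) < e"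
      using continuous_on_geodesic[OF a.\<alpha> b.\<alpha> neq] e unfolding continuous_on_iff by metis
    define x where "x = \<mu>0/2 + min (d/2) (\<mu>0/4)"
    have x: "0 < x" "x < \<mu>0" "x \<noteq> \<mu>0/2" "dist x (\<mu>0/2) < d"
      using d(1) \<mu>0(1) by (auto simp: x_def dist_real_def min_def)
    have "geodesic \<alpha> \<beta> x \<noteq> geodesic \<alpha> \<beta> (\<mu>0/2)"
      using geodesic_inj[OF a.\<alpha> b.\<alpha> neq, of x "\<mu>0/2"] x \<mu>0 by auto
    moreover have "dist (geodesic \<alpha> \<beta> x) (geodesic \<alpha> \<beta> (\<mu>0/2)) < e" using x \<mu>0 by (intro d(2)) auto
    ultimately show "\<exists>x'\<in>A. x' \<noteq> geodesic \<alpha> \<beta> (\<mu>0/2) \<and> dist x' (geodesic \<alpha> \<beta> (\<mu>0/2)) < e"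
      using x by (auto simp: A_def)
  qed
  moreover have "open D" "connected D" by (simp_all add: D_def)
  moreover have "A \<subseteq> D" using segD by (auto simp: A_def)
  moreover have "geodesic \<alpha> \<beta> (\<mu>0/2) \<in> D" using \<mu>0 by (intro segD) auto
  moreover have "z \<in> D" using inD[OF z] T(4) by blast
  ultimately have "E z = 0"
    using analytic_continuation[OF Ehol _ _ _ _ _ E0] by blast
  then show ?thesis by (simp add: E_def)
qed

lemma poly_sum_atMost:
  fixes p :: "'a::comm_semiring_1 poly"
  assumes "degree p \<le> n" shows "poly p x = (\<Sum>k\<le>n. coeff p k * x ^ k)"
  unfolding poly_altdef using assms
  by (intro sum.mono_neutral_left) (auto simp: coeff_eq_0)

text \<open>Polynomials in \<open>cnj z\<close> are handled as formal polynomials with coefficients depending on \<open>z\<close>.\<close>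
definition holomorphic_coeffs :: "complex set \<Rightarrow> (complex \<Rightarrow> complex poly) \<Rightarrow> bool" where
  "holomorphic_coeffs S P \<longleftrightarrow> (\<forall>k. (\<lambda>z. coeff (P z) k) holomorphic_on S)"

lemma holomorphic_coeffs_mult:
  "holomorphic_coeffs S P \<Longrightarrow> holomorphic_coeffs S Q \<Longrightarrow> holomorphic_coeffs S (\<lambda>z. P z * Q z)"
  unfolding holomorphic_coeffs_def coeff_mult by (auto intro!: holomorphic_intros)

lemma holomorphic_coeffs_linear:
  assumes "a holomorphic_on S" "b holomorphic_on S"
  shows "holomorphic_coeffs S (\<lambda>z. [:a z, b z:])"
  unfolding holomorphic_coeffs_def
proof
  fix k show "(\<lambda>z. coeff [:a z, b z:] k) holomorphic_on S"
  proof (cases k)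
    case 0 then show ?thesis using assms by simp
  next
    case (Suc j)
    then show ?thesis using assms by (cases j) simp_all
  qed
qed

lemma holomorphic_coeffs_power:
  "holomorphic_coeffs S P \<Longrightarrow> holomorphic_coeffs S (\<lambda>z. P z ^ m)"
proof (induction m)
  case 0
  then show ?case by (simp add: holomorphic_coeffs_def)
next
  case (Suc m)
  then show ?case using holomorphic_coeffs_mult[of S P "\<lambda>z. P z ^ m"] by simp
qed

context extendible_pencil
begin

text \<open>On the circle through \<open>z\<close> the extension is \<open>(z - t\<alpha>)^n f(z)\<close> with \<open>t = leaf \<alpha> z\<close>. Both \<open>t\<close>
and \<open>z - t\<alpha>\<close> are fractions with the denominator \<open>offset \<alpha> z - \<alpha> cnj z\<close> and the numerators
\<open>1 - z cnj z\<close> and \<open>slope \<alpha> z\<close>. Clearing denominators in the polynomial of degree \<open>n\<close> in \<open>t\<close> leaves a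
polynomial of degree at most \<open>n\<close> in \<open>cnj z\<close>.\<close>
lemma polyanalytic_times_slope:
  assumes interp: "\<And>\<delta> z t. 0 < \<delta> \<Longrightarrow> \<delta> < leaf \<alpha> z \<Longrightarrow> norm z < 1 \<Longrightarrow> 0 \<le> t \<Longrightarrow> t < leaf \<alpha> z \<Longrightarrow>
      circle_ext t z = (\<Sum>i\<le>n. circle_ext (node n \<delta> i) z * poly (node_poly n \<delta> i) (of_real t))"
  obtains d where "\<And>k. d k holomorphic_on ball 0 1"
    and "\<And>z. z \<in> ball 0 1 - {\<alpha>} \<Longrightarrow> f z * slope \<alpha> z ^ n = (\<Sum>k\<le>n. d k z * cnj z ^ k)"
proof -
  define P where "P \<delta> z = (\<Sum>i\<le>n. smult (circle_ext (node n \<delta> i) z) (node_poly n \<delta> i))" for \<delta> z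
  define Q where "Q z = P (leaf \<alpha> z / 2) z" for z
  have polyP: "circle_ext t z = poly (P \<delta> z) (of_real t)"
    if "0 < \<delta>" "\<delta> < leaf \<alpha> z" "norm z < 1" "0 \<le> t" "t < leaf \<alpha> z" for \<delta> z t
    using interp[OF that] by (simp add: P_def poly_sum)
  have PQ: "P \<delta> z = Q z" if "0 < \<delta>" "\<delta> < leaf \<alpha> z" "norm z < 1" for \<delta> z
  proof (rule poly_eq_on_interval)
    show "0 < leaf \<alpha> z" using leaf_pos that by blast
    fix t assume t: "0 < t" "t < leaf \<alpha> z"
    show "poly (P \<delta> z) (of_real t) = poly (Q z) (of_real t)"
      using polyP[OF that, of t] polyP[of "leaf \<alpha> z / 2" z t] t that leaf_pos[OF that(3), of \<alpha>] by (simp add: Q_def)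
  qed
  have Qhol: "(\<lambda>z. coeff (Q z) j) holomorphic_on ball 0 1" for j
  proof -
    have "(\<lambda>z. coeff (Q z) j) analytic_on ball 0 1"
      unfolding analytic_on_def
    proof
      fix x :: complex assume "x \<in> ball 0 1"
      then have x: "norm x < 1" by simp
      define \<delta> where "\<delta> = leaf \<alpha> x / 2"
      have \<delta>: "0 < \<delta>" "\<delta> < leaf \<alpha> x" "\<delta> < 1"
        using leaf_pos[OF x, of \<alpha>] leaf_le_1[of x \<alpha>] x by (auto simp: \<delta>_def)
      have inD: "w \<in> ball (of_real s * \<alpha>) (pencil_radius \<alpha> s) \<longleftrightarrow> s < leaf \<alpha> w" if "norm w < 1" "0 \<le> s" "s < 1" for w s
        using in_pencil_disc_iff(2)[OF \<alpha> that(2,3)] that(1) by simp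
      have "x \<in> ball (of_real \<delta> * \<alpha>) (pencil_radius \<alpha> \<delta>) \<inter> ball 0 1" using inD[OF x, of \<delta>] \<delta> x by simp
      then obtain e where e: "e > 0" "ball x e \<subseteq> ball (of_real \<delta> * \<alpha>) (pencil_radius \<alpha> \<delta>) \<inter> ball 0 1"
        using openE[OF open_Int[OF open_ball open_ball]] by blast
      have be: "\<delta> < leaf \<alpha> w" "norm w < 1" if "w \<in> ball x e" for w
      proof -
        have w: "w \<in> ball (of_real \<delta> * \<alpha>) (pencil_radius \<alpha> \<delta>)" "w \<in> ball 0 1" using e(2) that by blast+
        then show "norm w < 1" by simp
        then show "\<delta> < leaf \<alpha> w" using inD[of w \<delta>] \<delta> w(1) by simp
      qed
      have Ghol: "circle_ext (node n \<delta> i) holomorphic_on ball x e" if "i \<le> n" for i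
      proof (rule holomorphic_on_subset[OF circle_ext_holomorphic])
        show "0 \<le> node n \<delta> i" "node n \<delta> i < 1" using node_bounds[OF \<delta>(1) that] \<delta> by auto
        show "ball x e \<subseteq> ball (of_real (node n \<delta> i) * \<alpha>) (pencil_radius \<alpha> (node n \<delta> i))"
          using inD be node_bounds[OF \<delta>(1) that] \<delta> by fastforce
      qed
      have "(\<lambda>z. \<Sum>i\<le>n. circle_ext (node n \<delta> i) z * coeff (node_poly n \<delta> i) j) holomorphic_on ball x e"
        by (intro holomorphic_intros Ghol) auto
      moreover have "(\<Sum>i\<le>n. circle_ext (node n \<delta> i) z * coeff (node_poly n \<delta> i) j) = coeff (Q z) j" if "z \<in> ball x e" for z
        unfolding PQ[OF \<delta>(1) be[OF that], symmetric] by (simp add: P_def coeff_sum)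
      ultimately have "(\<lambda>z. coeff (Q z) j) holomorphic_on ball x e" by (rule holomorphic_transform)
      then show "\<exists>e>0. (\<lambda>z. coeff (Q z) j) holomorphic_on ball x e" using e(1) by blast
    qed
    then show ?thesis by (rule analytic_imp_holomorphic)
  qed
  have degQ: "degree (Q z) \<le> n" if "norm z < 1" for z
  proof -
    let ?\<delta> = "leaf \<alpha> z / 2"
    have \<delta>: "0 < ?\<delta>" using leaf_pos[OF that] by simp
    have "degree (node_poly n ?\<delta> i) \<le> n" if "i \<le> n" for i
      unfolding node_poly_def by (rule degree_lagrange[OF that])
    then show ?thesis unfolding Q_def P_def
      by (intro degree_sum_le) (auto intro: order_trans[OF degree_smult_le])
  qed
  define R where "R z = (\<Sum>j\<le>n. [:coeff (Q z) j:] * ([:1, - z:] ^ j * [:offset \<alpha> z, - \<alpha>:] ^ (n - j)))" for z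
  have main: "f z * slope \<alpha> z ^ n = poly (R z) (cnj z)" if z: "z \<in> ball 0 1 - {\<alpha>}" for z
  proof -
    have z1: "norm z < 1" "z \<noteq> \<alpha>" using z by auto
    define l where "l = leaf \<alpha> z"
    have l: "0 < l" "l < 1" using leaf_pos[OF z1(1)] leaf_bounds(2)[of z \<alpha>] z1 by (auto simp: l_def)
    have c: "continuous_on {0..l} (\<lambda>t. circle_ext t z - poly (Q z) (of_real t))"
      using continuous_on_slice[of "{z}" "\<lambda>_ _. 1" z] z1 unfolding l_def by (auto intro!: continuous_intros)
    have "circle_ext t z - poly (Q z) (of_real t) = 0" if "t \<in> {0..<l}" for t
      using polyP[of "leaf \<alpha> z / 2" z t] that z1 l by (simp add: Q_def l_def)
    then have "circle_ext l z - poly (Q z) (of_real l) = 0"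
      using c l by (intro continuous_constant_on_closure[of "{0..<l}" "\<lambda>t. circle_ext t z - poly (Q z) (of_real t)" 0 l]) auto
    moreover have "z \<in> sphere (of_real l * \<alpha>) (pencil_radius \<alpha> l)"
      using in_pencil_disc_iff(3)[OF \<alpha>, of l z] l z1 by (simp add: l_def)
    then have "circle_ext l z = (z - of_real l * \<alpha>) ^ n * f z" using l by (intro circle_ext_on_circle) auto
    ultimately have e: "(z - of_real l * \<alpha>) ^ n * f z = (\<Sum>j\<le>n. coeff (Q z) j * of_real l ^ j)"
      using poly_sum_atMost[OF degQ[OF z1(1)], of "of_real l"] by simp
    define dd where "dd = offset \<alpha> z - \<alpha> * cnj z"
    have dr: "dd = of_real (1 - (norm z)\<^sup>2 + (norm (z - \<alpha>))\<^sup>2)"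
      unfolding of_real_add of_real_diff complex_norm_square dd_def offset_def by (simp add: algebra_simps)
    have dd0: "dd \<noteq> 0" unfolding dr of_real_eq_0_iff using leaf_denom_pos[of z \<alpha>] z1 by simp
    have ld: "of_real l * dd = 1 - z * cnj z"
    proof -
      have "of_real l * dd = of_real (1 - (norm z)\<^sup>2)"
        unfolding dr of_real_mult[symmetric] l_def leaf_def using leaf_denom_pos[of z \<alpha>] z1 by simp
      then show ?thesis by (simp only: of_real_diff complex_norm_square of_real_1)
    qed
    have sd: "(z - of_real l * \<alpha>) * dd = slope \<alpha> z"
    proof -
      have "(z - of_real l * \<alpha>) * dd = z * dd - \<alpha> * (of_real l * dd)" by (simp add: algebra_simps)
      then show ?thesis unfolding ld by (simp add: dd_def offset_def slope_def algebra_simps)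
    qed
    have "f z * slope \<alpha> z ^ n = ((z - of_real l * \<alpha>) ^ n * f z) * dd ^ n"
      unfolding sd[symmetric] by (simp add: power_mult_distrib)
    also have "\<dots> = (\<Sum>j\<le>n. coeff (Q z) j * ((1 - z * cnj z) ^ j * dd ^ (n - j)))"
      unfolding e sum_distrib_right
    proof (intro sum.cong refl)
      fix j assume "j \<in> {..n}"
      then have "dd ^ n = dd ^ j * dd ^ (n - j)" by (simp add: power_add[symmetric])
      then show "coeff (Q z) j * of_real l ^ j * dd ^ n = coeff (Q z) j * ((1 - z * cnj z) ^ j * dd ^ (n - j))"
        unfolding ld[symmetric] by (simp add: power_mult_distrib)
    qed
    also have "\<dots> = poly (R z) (cnj z)"
      by (simp add: R_def poly_sum dd_def mult.commute)
    finally show ?thesis .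
  qed
  have degR: "degree (R z) \<le> n" for z
  proof -
    have "degree ([:coeff (Q z) j:] * ([:1, - z:] ^ j * [:offset \<alpha> z, - \<alpha>:] ^ (n - j))) \<le> n" if "j \<le> n" for j
    proof -
      have "degree ([:coeff (Q z) j:] * ([:1, - z:] ^ j * [:offset \<alpha> z, - \<alpha>:] ^ (n - j)))
          \<le> degree [:coeff (Q z) j:] + degree ([:1, - z:] ^ j * [:offset \<alpha> z, - \<alpha>:] ^ (n - j))" by (rule degree_mult_le)
      also have "degree ([:1, - z:] ^ j * [:offset \<alpha> z, - \<alpha>:] ^ (n - j)) \<le> degree ([:1, - z:] ^ j) + degree ([:offset \<alpha> z, - \<alpha>:] ^ (n - j))"
        by (rule degree_mult_le)
      also have "\<dots> \<le> 1 * j + 1 * (n - j)"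
        by (intro add_mono order_trans[OF degree_power_le] mult_right_mono) auto
      finally show ?thesis using that by simp
    qed
    then show ?thesis unfolding R_def by (intro degree_sum_le) auto
  qed
  have Rhol: "(\<lambda>z. coeff (R z) k) holomorphic_on ball 0 1" for k
  proof -
    have "holomorphic_coeffs (ball 0 1) (\<lambda>z. [:coeff (Q z) j:] * ([:1, - z:] ^ j * [:offset \<alpha> z, - \<alpha>:] ^ (n - j)))" for j
    proof (intro holomorphic_coeffs_mult holomorphic_coeffs_power holomorphic_coeffs_linear)
      show "holomorphic_coeffs (ball 0 1) (\<lambda>z. [:coeff (Q z) j:])"
        using holomorphic_coeffs_linear[OF Qhol, of "\<lambda>_. 0" j] by simp
    qed (auto simp: offset_def intro!: holomorphic_intros)
    then show ?thesis
      unfolding R_def coeff_sum holomorphic_coeffs_def by (intro holomorphic_intros) auto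
  qed
  show thesis
  proof (rule that[of "\<lambda>k z. coeff (R z) k"])
    fix z assume z: "z \<in> ball 0 1 - {\<alpha>}"
    show "f z * slope \<alpha> z ^ n = (\<Sum>k\<le>n. coeff (R z) k * cnj z ^ k)"
      unfolding main[OF z] by (rule poly_sum_atMost[OF degR])
  qed (rule Rhol)
qed

end

text \<open>For interior \<open>\<alpha>\<close> the unit circle is not in the family; it is reached as a limit.\<close>
lemma extendible_pencilI:
  assumes \<alpha>: "\<alpha> \<in> cball 0 1" and f: "continuous_on (cball 0 1) f"
    and ext: "\<And>\<Gamma>. \<Gamma> \<in> circle_family \<alpha> \<Longrightarrow> extends_holomorphically_from \<Gamma> (\<lambda>z. (z - circle_center \<Gamma>) ^ n * f z)"
  shows "extendible_pencil \<alpha> n f"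
proof
  show n\<alpha>: "norm \<alpha> \<le> 1" using \<alpha> by simp
  show "continuous_on (cball 0 1) f" by fact
  have main: "extends_disc n f (of_real t * \<alpha>) (pencil_radius \<alpha> t)"
    if t: "0 \<le> t" "t < 1" "norm \<alpha> < 1 \<Longrightarrow> 0 < t" for t
    using ext[OF pencil_in_circle_family[OF n\<alpha> t]] extends_from_sphere_iff[OF pencil_bounds(1)[OF n\<alpha> t(1,2)]] by simp
  fix t :: real assume t: "0 \<le> t" "t < 1"
  show "extends_disc n f (of_real t * \<alpha>) (pencil_radius \<alpha> t)"
  proof (cases "t = 0")
    case False
    then show ?thesis using main[OF t] t by simp
  next
    case True
    define s where "s j = 1 / real (j + 2)" for j
    have s: "0 < s j" "s j < 1" for j by (auto simp: s_def)
    have s0: "s \<longlonglongrightarrow> 0"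
      unfolding s_def[abs_def] by (rule LIMSEQ_ignore_initial_segment[OF lim_const_over_n])
    have cont: "isCont (\<lambda>s. (of_real s * \<alpha>, pencil_radius \<alpha> s)) 0"
      unfolding pencil_radius_def by (intro continuous_intros)
    have inC: "(of_real u * \<alpha>, pencil_radius \<alpha> u) \<in> circles_in_disc" if "0 \<le> u" "u < 1" for u
      using pencil_bounds[OF n\<alpha> that] that by (simp add: circles_in_disc_def norm_mult)
    have "extends_disc n f (fst (of_real 0 * \<alpha>, pencil_radius \<alpha> 0)) (snd (of_real 0 * \<alpha>, pencil_radius \<alpha> 0))"
      by (rule extends_disc_limit[OF f _ _ isCont_tendsto_compose[OF cont s0]])
         (use s main inC inC[of 0] in \<open>auto simp: less_imp_le\<close>)
    then show ?thesis using True by simp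
  qed
qed

theorem theorem1p1:
  fixes \<alpha> \<beta> :: complex and n :: nat and f :: "complex \<Rightarrow> complex"
  assumes "\<alpha> \<in> cball 0 1" and "\<beta> \<in> cball 0 1" and "\<alpha> \<noteq> \<beta>"
    and "continuous_on (cball 0 1) f"
    and "\<forall>\<Gamma> \<in> circle_family \<alpha> \<union> circle_family \<beta>.
           extends_holomorphically_from \<Gamma> (\<lambda>z. (z - circle_center \<Gamma>) ^ n * f z)"
  shows "polyanalytic_on_disc n f \<and>
         (\<forall>\<Gamma>. is_circle \<Gamma> \<and> \<Gamma> \<subseteq> cball 0 1 \<longrightarrow>
           extends_holomorphically_from \<Gamma> (\<lambda>z. (z - circle_center \<Gamma>) ^ n * f z))"
proof -
  interpret a: extendible_pencil \<alpha> n f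
    using assms by (intro extendible_pencilI) auto
  interpret b: extendible_pencil \<beta> n f
    using assms by (intro extendible_pencilI) auto
  interpret ab: two_pencils \<alpha> \<beta> n f
    by unfold_locales (rule assms)
  interpret ba: two_pencils \<beta> \<alpha> n f
    by unfold_locales (use assms in auto)
  obtain d where d: "\<And>k. d k holomorphic_on ball 0 1"
    "\<And>z. z \<in> ball 0 1 - {\<alpha>} \<Longrightarrow> f z * slope \<alpha> z ^ n = (\<Sum>k\<le>n. d k z * cnj z ^ k)"
    using a.polyanalytic_times_slope[OF ab.circle_ext_interpolation] by blast
  obtain e where e: "\<And>k. e k holomorphic_on ball 0 1"
    "\<And>z. z \<in> ball 0 1 - {\<beta>} \<Longrightarrow> f z * slope \<beta> z ^ n = (\<Sum>k\<le>n. e k z * cnj z ^ k)"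
    using b.polyanalytic_times_slope[OF ba.circle_ext_interpolation] by blast
  have snz: "slope \<alpha> z \<noteq> 0" if "z \<in> ball 0 1 - {\<alpha>}" for z using slope_nz[OF a.\<alpha>] that by auto
  have snz': "slope \<beta> z \<noteq> 0" if "z \<in> ball 0 1 - {\<beta>}" for z using slope_nz[OF b.\<alpha>] that by auto
  have sh: "slope \<gamma> holomorphic_on S" for \<gamma> S
    unfolding slope_def[abs_def] by (intro holomorphic_intros)
  have de: "d k z * slope \<beta> z ^ n - e k z * slope \<alpha> z ^ n = 0" if k: "k \<le> n" and z: "z \<in> ball 0 1 - {\<alpha>, \<beta>}" for k z
  proof (rule polyanalytic_coeffs_unique[where S = "ball 0 1 - {\<alpha>, \<beta>}" and n = n
        and c = "\<lambda>k z. d k z * slope \<beta> z ^ n - e k z * slope \<alpha> z ^ n"])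
    show "open (ball 0 1 - {\<alpha>, \<beta>})" by (intro open_Diff) auto
    show "(\<lambda>z. d k z * slope \<beta> z ^ n - e k z * slope \<alpha> z ^ n) holomorphic_on ball 0 1 - {\<alpha>, \<beta>}" for k
      by (intro holomorphic_intros sh holomorphic_on_subset[OF d(1)] holomorphic_on_subset[OF e(1)]) auto
    fix z assume z: "z \<in> ball 0 1 - {\<alpha>, \<beta>}"
    have "(\<Sum>k\<le>n. (d k z * slope \<beta> z ^ n - e k z * slope \<alpha> z ^ n) * cnj z ^ k)
       = (\<Sum>k\<le>n. d k z * cnj z ^ k) * slope \<beta> z ^ n - (\<Sum>k\<le>n. e k z * cnj z ^ k) * slope \<alpha> z ^ n"
      unfolding sum_distrib_right sum_subtractf[symmetric] by (intro sum.cong refl) (simp add: algebra_simps)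
    also have "\<dots> = 0" using d(2)[of z] e(2)[of z] z by (simp flip: d(2) e(2))
    finally show "(\<Sum>k\<le>n. (d k z * slope \<beta> z ^ n - e k z * slope \<alpha> z ^ n) * cnj z ^ k) = 0" .
  qed (use k z in auto)
  \<comment> \<open>the quotients for \<open>\<alpha>\<close> and \<open>\<beta>\<close> agree where both are defined, and their domains cover the disc\<close>
  define c where "c k z = (if z = \<alpha> then e k z / slope \<beta> z ^ n else d k z / slope \<alpha> z ^ n)" for k z
  have ce: "c k z = e k z / slope \<beta> z ^ n" if "k \<le> n" "z \<in> ball 0 1 - {\<beta>}" for k z
    using de[of k z] snz[of z] snz'[of z] that by (auto simp: c_def field_simps)
  have "c k holomorphic_on ball 0 1" if k: "k \<le> n" for k
  proof -
    have "c k holomorphic_on ball 0 1 - {\<alpha>}"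
    proof (rule holomorphic_transform)
      show "(\<lambda>z. d k z / slope \<alpha> z ^ n) holomorphic_on ball 0 1 - {\<alpha>}"
        using snz by (intro holomorphic_intros sh holomorphic_on_subset[OF d(1)]) auto
    qed (simp add: c_def)
    moreover have "c k holomorphic_on ball 0 1 - {\<beta>}"
    proof (rule holomorphic_transform)
      show "(\<lambda>z. e k z / slope \<beta> z ^ n) holomorphic_on ball 0 1 - {\<beta>}"
        using snz' by (intro holomorphic_intros sh holomorphic_on_subset[OF e(1)]) auto
    qed (simp add: ce k)
    ultimately have "c k holomorphic_on (ball 0 1 - {\<alpha>}) \<union> (ball 0 1 - {\<beta>})"
      by (intro holomorphic_on_Un) (auto intro!: open_Diff)
    moreover have "(ball 0 1 - {\<alpha>}) \<union> (ball 0 1 - {\<beta>}) = ball 0 1" using assms(3) by auto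
    ultimately show ?thesis by simp
  qed
  moreover have "f z = (\<Sum>k\<le>n. c k z * cnj z ^ k)" if z: "z \<in> ball 0 1" for z
  proof (cases "z = \<alpha>")
    case True
    then have z': "z \<in> ball 0 1 - {\<beta>}" using z assms(3) by auto
    have "(\<Sum>k\<le>n. c k z * cnj z ^ k) = (\<Sum>k\<le>n. e k z * cnj z ^ k) / slope \<beta> z ^ n"
      unfolding sum_divide_distrib using ce[OF _ z'] by (intro sum.cong) auto
    also have "\<dots> = f z" using snz'[OF z'] by (simp flip: e(2)[OF z'])
    finally show ?thesis by simp
  next
    case False
    then have z': "z \<in> ball 0 1 - {\<alpha>}" using z by auto
    have "(\<Sum>k\<le>n. c k z * cnj z ^ k) = (\<Sum>k\<le>n. d k z * cnj z ^ k) / slope \<alpha> z ^ n"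
      unfolding sum_divide_distrib using False by (intro sum.cong) (auto simp: c_def)
    also have "\<dots> = f z" using snz[OF z'] by (simp flip: d(2)[OF z'])
    finally show ?thesis by simp
  qed
  ultimately have "polyanalytic_on_disc n f"
    unfolding polyanalytic_on_disc_def by blast
  then show ?thesis
    using polyanalytic_extends[OF assms(4)] by blast
qed

end
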